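(* Let $\mathcal F$ be a progressive family of directed graphs. Let $G,H$ be finitely generated groups, and let $C$ be a finite group that embeds in $G$ and in $H$ (with fixed embeddings). Then the $\mathcal F$-uniform rational subset membership problem for the amalgamated free product $G*_CH$ is $\mathbf{P}$-time Cook reducible to the $\mathcal F$-uniform rational subset membership problems for $G$ and for $H$.
   Context: A family $\mathcal F$ of finite directed graphs is progressive if it is closed under the following operations: (1) taking subgraphs; (2) adding shortcuts, i.e., drawing an edge from the origin of an oriented path to its terminus; (3) appending a hanging oriented path by its origin. Let $K$ be a group with a finite generating set $X$. A subset of $K$ is $\mathcal F$-rational if it can be given by a finite (non-deterministic) automaton, with transitions labeled by letters in $X\cup X^{-1}\cup\{\varepsilon\}$ ($\varepsilon$ the empty word), whose underlying directed graph is in $\mathcal F$; the subset given by the automaton consists of the elements of $K$ represented by the words it accepts. The $\mathcal F$-uniform rational subset membership problem for $K$ is: given as input an $\mathcal F$-rational subset of $K$ (by such an automaton) and a word over $X\cup X^{-1}$, decide whether the subset contains an element equal to the given word in $K$. A decision problem $A$ is $\mathbf{P}$-time Cook reducible to given problems if there is an algorithm that solves $A$ using a polynomial number of calls to subroutines for those problems, and polynomial time outside of those calls.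
   Formalization: The problems are taken over fixed generating sets: X∪C for G, Y∪C for H, and their union for G*_C H, with X, Y arbitrary finite generating sets; for unrelated generating sets the claim fails for some progressive families (e.g. graphs whose only cycles are loops). *)

theory Defs
  imports
    "HOL-Algebra.Generated_Groups"
    "HOL-Computational_Algebra.Polynomial"
    "Graph_Theory.Pair_Digraph"
    "Graph_Theory.Digraph_Component"
begin

section \<open>Progressive families of finite directed graphs\<close>

text \<open>
  Graphs are finite digraphs on vertices of type \<^typ>\<open>nat\<close>, loops allowed; as a family of graphs
  is meant up to isomorphism, closure under relabelling of the vertices is part of the definition.
  Parallel edges carry no information here: a parallel edge is a shortcut of a path of length one.
  An oriented path is a directed walk of length at least one; it may be closed, in which case
  its shortcut is a loop.
\<close>

definition relabel :: "(nat \<Rightarrow> nat) \<Rightarrow> nat pair_pre_digraph \<Rightarrow> nat pair_pre_digraph" where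
  "relabel f D = \<lparr>pverts = f ` pverts D, parcs = map_prod f f ` parcs D\<rparr>"

definition add_edge :: "nat \<Rightarrow> nat \<Rightarrow> nat pair_pre_digraph \<Rightarrow> nat pair_pre_digraph" where
  "add_edge u v D = D\<lparr>parcs := insert (u, v) (parcs D)\<rparr>"

definition append_path :: "nat \<Rightarrow> nat list \<Rightarrow> nat pair_pre_digraph \<Rightarrow> nat pair_pre_digraph" where
  "append_path v vs D =
     \<lparr>pverts = pverts D \<union> set vs, parcs = parcs D \<union> set (zip (v # vs) vs)\<rparr>"

definition progressive :: "nat pair_pre_digraph set \<Rightarrow> bool" where
  "progressive F \<longleftrightarrow>
     (\<forall>D\<in>F. pair_fin_digraph D) \<and>
     (\<forall>D\<in>F. \<forall>f. inj_on f (pverts D) \<longrightarrow> relabel f D \<in> F) \<and>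
     (\<forall>D\<in>F. \<forall>D'. subgraph (with_proj D') (with_proj D) \<longrightarrow> D' \<in> F) \<and>
     (\<forall>D\<in>F. \<forall>u v. u \<rightarrow>\<^sup>+\<^bsub>with_proj D\<^esub> v \<longrightarrow> add_edge u v D \<in> F) \<and>
     (\<forall>D\<in>F. \<forall>v\<in>pverts D. \<forall>vs. distinct vs \<and> set vs \<inter> pverts D = {} \<longrightarrow>
        append_path v vs D \<in> F)"


section \<open>Automata over a finite generating set\<close>

text \<open>
  A finite generating set is given by an enumeration \<open>gs\<close>; \<open>Gen i\<close> and \<open>Inv i\<close> are the letters
  for \<open>gs ! i\<close> and its inverse. The label \<^const>\<open>None\<close> of a transition is the empty word.
  The states of an automaton are the numbers below \<open>num_states\<close>.
\<close>

datatype letter = Gen nat | Inv nat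

primrec letter_index :: "letter \<Rightarrow> nat" where
  "letter_index (Gen i) = i"
| "letter_index (Inv i) = i"

primrec letter_val :: "('a, 'm) monoid_scheme \<Rightarrow> 'a list \<Rightarrow> letter \<Rightarrow> 'a" where
  "letter_val K gs (Gen i) = gs ! i"
| "letter_val K gs (Inv i) = inv\<^bsub>K\<^esub> (gs ! i)"

primrec word_val :: "('a, 'm) monoid_scheme \<Rightarrow> 'a list \<Rightarrow> letter list \<Rightarrow> 'a" where
  "word_val K gs [] = \<one>\<^bsub>K\<^esub>"
| "word_val K gs (x # w) = letter_val K gs x \<otimes>\<^bsub>K\<^esub> word_val K gs w"

record automaton =
  num_states :: nat
  start :: nat
  finals :: "nat list"
  transitions :: "(nat \<times> letter option \<times> nat) list"

definition wf_automaton :: "nat \<Rightarrow> automaton \<Rightarrow> bool" where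
  "wf_automaton m A \<longleftrightarrow>
     start A < num_states A \<and>
     (\<forall>f\<in>set (finals A). f < num_states A) \<and>
     (\<forall>(p, l, q)\<in>set (transitions A).
        p < num_states A \<and> q < num_states A \<and> (\<forall>x. l = Some x \<longrightarrow> letter_index x < m))"

definition wf_word :: "nat \<Rightarrow> letter list \<Rightarrow> bool" where
  "wf_word m w \<longleftrightarrow> (\<forall>x\<in>set w. letter_index x < m)"

definition underlying_graph :: "automaton \<Rightarrow> nat pair_pre_digraph" where
  "underlying_graph A =
     \<lparr>pverts = {..<num_states A}, parcs = {(p, q). \<exists>l. (p, l, q) \<in> set (transitions A)}\<rparr>"

inductive run :: "automaton \<Rightarrow> nat \<Rightarrow> letter list \<Rightarrow> nat \<Rightarrow> bool" for A where
  run_refl: "run A p [] p"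
| run_eps: "(p, None, q) \<in> set (transitions A) \<Longrightarrow> run A q w r \<Longrightarrow> run A p w r"
| run_letter: "(p, Some x, q) \<in> set (transitions A) \<Longrightarrow> run A q w r \<Longrightarrow> run A p (x # w) r"

definition accepts :: "automaton \<Rightarrow> letter list \<Rightarrow> bool" where
  "accepts A w \<longleftrightarrow> (\<exists>f\<in>set (finals A). run A (start A) w f)"

definition rational_subset :: "('a, 'm) monoid_scheme \<Rightarrow> 'a list \<Rightarrow> automaton \<Rightarrow> 'a set" where
  "rational_subset K gs A = word_val K gs ` {w. accepts A w}"


section \<open>Inputs as binary trees\<close>

text \<open>
  Numbers are encoded in unary, which is polynomially equivalent to the usual input size because
  states are numbers below \<open>num_states\<close> and letters are numbers below a constant.
\<close>

datatype tree = Leaf | Node tree tree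

primrec enc_nat :: "nat \<Rightarrow> tree" where
  "enc_nat 0 = Leaf"
| "enc_nat (Suc n) = Node Leaf (enc_nat n)"

primrec enc_list :: "('a \<Rightarrow> tree) \<Rightarrow> 'a list \<Rightarrow> tree" where
  "enc_list f [] = Leaf"
| "enc_list f (x # xs) = Node (f x) (enc_list f xs)"

primrec enc_letter :: "letter \<Rightarrow> tree" where
  "enc_letter (Gen i) = Node Leaf (enc_nat i)"
| "enc_letter (Inv i) = Node (Node Leaf Leaf) (enc_nat i)"

primrec enc_label :: "letter option \<Rightarrow> tree" where
  "enc_label None = Leaf"
| "enc_label (Some x) = enc_letter x"

definition enc_transition :: "nat \<times> letter option \<times> nat \<Rightarrow> tree" where
  "enc_transition = (\<lambda>(p, l, q). Node (enc_nat p) (Node (enc_label l) (enc_nat q)))"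

definition enc_automaton :: "automaton \<Rightarrow> tree" where
  "enc_automaton A =
     Node (enc_nat (num_states A))
       (Node (enc_nat (start A))
         (Node (enc_list enc_nat (finals A)) (enc_list enc_transition (transitions A))))"

definition enc_instance :: "automaton \<Rightarrow> letter list \<Rightarrow> tree" where
  "enc_instance A w = Node (enc_automaton A) (enc_list enc_letter w)"

lemma enc_nat_inject: "enc_nat m = enc_nat n \<longleftrightarrow> m = n"
proof (induction m arbitrary: n)
  case 0 then show ?case by (cases n) auto
next
  case (Suc m) then show ?case by (cases n) auto
qed

lemma enc_list_inject:
  assumes "\<And>x y. f x = f y \<longleftrightarrow> x = y"
  shows "enc_list f xs = enc_list f ys \<longleftrightarrow> xs = ys"
proof (induction xs arbitrary: ys)
  case Nil then show ?case by (cases ys) auto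
next
  case (Cons x xs) then show ?case by (cases ys) (auto simp: assms)
qed

lemma enc_letter_inject: "enc_letter x = enc_letter y \<longleftrightarrow> x = y"
  by (cases x; cases y) (auto simp: enc_nat_inject)

lemma enc_label_inject: "enc_label l = enc_label l' \<longleftrightarrow> l = l'"
proof -
  have "enc_letter x \<noteq> Leaf" "Leaf \<noteq> enc_letter x" for x by (cases x; simp)+
  then show ?thesis by (cases l; cases l') (auto simp: enc_letter_inject)
qed

lemma enc_transition_inject: "enc_transition x = enc_transition y \<longleftrightarrow> x = y"
  by (auto simp: enc_transition_def enc_nat_inject enc_label_inject split: prod.splits)

lemma enc_instance_inject: "enc_instance A w = enc_instance B v \<longleftrightarrow> A = B \<and> w = v"
  by (auto simp: enc_instance_def enc_automaton_def enc_nat_inject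
      enc_list_inject[of enc_nat, OF enc_nat_inject]
      enc_list_inject[of enc_transition, OF enc_transition_inject]
      enc_list_inject[of enc_letter, OF enc_letter_inject])


section \<open>Decision problems and polynomial time Cook reductions\<close>

text \<open>
  A decision problem consists of its sets of yes-instances and of no-instances; all other trees
  are not inputs of the problem.
\<close>

record problem =
  yes :: "tree set"
  no :: "tree set"

text \<open>
  The generating set \<open>gs\<close> matters for a general progressive family \<open>F\<close>: \<open>F\<close> need not be closed
  under subdivision of edges, so a transition labelled by a word cannot always be replaced by
  transitions labelled by letters. For an amalgam over a finite group \<open>C\<close> the elements of \<open>C\<close>
  are therefore included among the letters, next to arbitrary generating sets of the factors.
\<close>

definition uniform_rsmp ::
  "nat pair_pre_digraph set \<Rightarrow> ('a, 'm) monoid_scheme \<Rightarrow> 'a list \<Rightarrow> problem" where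
  "uniform_rsmp F K gs =
     \<lparr>yes = {enc_instance A w | A w.
        wf_automaton (length gs) A \<and> underlying_graph A \<in> F \<and> wf_word (length gs) w \<and>
        word_val K gs w \<in> rational_subset K gs A},
      no = {enc_instance A w | A w.
        wf_automaton (length gs) A \<and> underlying_graph A \<in> F \<and> wf_word (length gs) w \<and>
        word_val K gs w \<notin> rational_subset K gs A}\<rparr>"

lemma uniform_rsmp_disjoint: "yes (uniform_rsmp F K gs) \<inter> no (uniform_rsmp F K gs) = {}"
  by (auto simp: uniform_rsmp_def enc_instance_inject)

text \<open>
  Algorithms are programs of a first-order functional language on binary trees. A program is a
  list of function bodies; \<open>Call i e\<close> calls the \<open>i\<close>-th function with one argument, which its body
  finds as \<open>Var 0\<close>, and \<open>LetE\<close> binds a new \<open>Var 0\<close> (de Bruijn indices). \<open>Query i e\<close> calls the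
  subroutine for the \<open>i\<close>-th given problem. \<^const>\<open>Leaf\<close> is false, all other trees are true.
\<close>

datatype exp =
  Var nat | NilE | ConsE exp exp | HdE exp | TlE exp | IfE exp exp exp | LetE exp exp
| Call nat exp | Query nat exp

text \<open>
  \<open>evals_to Ps prog env e v t\<close>: in the environment \<open>env\<close> the expression \<open>e\<close> evaluates to \<open>v\<close> in time
  \<open>t\<close>. Every step has unit cost, as values can be represented by pointers to shared, immutable
  cells (there is no primitive equality test). A subroutine call in addition costs the number of
  nodes of its argument, for writing it out; thus the time bounds the number of subroutine calls,
  the sizes of their inputs, and the time spent outside of them. The model is
  polynomially equivalent to oracle Turing machines. There is no rule for calling a subroutine on
  a tree that is not an input of its problem: such a call aborts the computation.
\<close>

inductive evals_to ::
  "problem list \<Rightarrow> exp list \<Rightarrow> tree list \<Rightarrow> exp \<Rightarrow> tree \<Rightarrow> nat \<Rightarrow> bool" for Ps prog where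
  eval_Var: "i < length env \<Longrightarrow> evals_to Ps prog env (Var i) (env ! i) 1"
| eval_Nil: "evals_to Ps prog env NilE Leaf 1"
| eval_Cons: "evals_to Ps prog env a u s \<Longrightarrow> evals_to Ps prog env b v t \<Longrightarrow>
    evals_to Ps prog env (ConsE a b) (Node u v) (s + t + 1)"
| eval_Hd: "evals_to Ps prog env e (Node u v) t \<Longrightarrow> evals_to Ps prog env (HdE e) u (t + 1)"
| eval_Hd_Leaf: "evals_to Ps prog env e Leaf t \<Longrightarrow> evals_to Ps prog env (HdE e) Leaf (t + 1)"
| eval_Tl: "evals_to Ps prog env e (Node u v) t \<Longrightarrow> evals_to Ps prog env (TlE e) v (t + 1)"
| eval_Tl_Leaf: "evals_to Ps prog env e Leaf t \<Longrightarrow> evals_to Ps prog env (TlE e) Leaf (t + 1)"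
| eval_If_True: "evals_to Ps prog env c u s \<Longrightarrow> u \<noteq> Leaf \<Longrightarrow> evals_to Ps prog env a v t \<Longrightarrow>
    evals_to Ps prog env (IfE c a b) v (s + t + 1)"
| eval_If_False: "evals_to Ps prog env c Leaf s \<Longrightarrow> evals_to Ps prog env b v t \<Longrightarrow>
    evals_to Ps prog env (IfE c a b) v (s + t + 1)"
| eval_Let: "evals_to Ps prog env a u s \<Longrightarrow> evals_to Ps prog (u # env) b v t \<Longrightarrow>
    evals_to Ps prog env (LetE a b) v (s + t + 1)"
| eval_Call: "i < length prog \<Longrightarrow> evals_to Ps prog env e u s \<Longrightarrow> evals_to Ps prog [u] (prog ! i) v t \<Longrightarrow>
    evals_to Ps prog env (Call i e) v (s + t + 1)"
| eval_Query_yes: "i < length Ps \<Longrightarrow> evals_to Ps prog env e u t \<Longrightarrow> u \<in> yes (Ps ! i) \<Longrightarrow>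
    evals_to Ps prog env (Query i e) (Node Leaf Leaf) (t + size u + 1)"
| eval_Query_no: "i < length Ps \<Longrightarrow> evals_to Ps prog env e u t \<Longrightarrow> u \<in> no (Ps ! i) \<Longrightarrow>
    evals_to Ps prog env (Query i e) Leaf (t + size u + 1)"

inductive_cases eval_elims:
  "evals_to Ps prog env (Var i) v t"
  "evals_to Ps prog env NilE v t"
  "evals_to Ps prog env (ConsE a b) v t"
  "evals_to Ps prog env (HdE e) v t"
  "evals_to Ps prog env (TlE e) v t"
  "evals_to Ps prog env (IfE c a b) v t"
  "evals_to Ps prog env (LetE a b) v t"
  "evals_to Ps prog env (Call i e) v t"

inductive_cases eval_QueryE: "evals_to Ps prog env (Query i e) v t"

lemma eval_deterministic:
  assumes "\<forall>Q\<in>set Ps. yes Q \<inter> no Q = {}"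
    and "evals_to Ps prog env e v t" and "evals_to Ps prog env e v' t'"
  shows "v' = v \<and> t' = t"
  using assms(2,3)
proof (induction arbitrary: v' t' rule: evals_to.induct)
  case (eval_Query_yes i env e u t)
  have "u \<notin> no (Ps ! i)"
    using eval_Query_yes assms(1) nth_mem[of i Ps] by blast
  with eval_Query_yes.prems show ?case
    by (elim eval_QueryE) (auto dest!: eval_Query_yes.IH)
next
  case (eval_Query_no i env e u t)
  have "u \<notin> yes (Ps ! i)"
    using eval_Query_no assms(1) nth_mem[of i Ps] by blast
  with eval_Query_no.prems show ?case
    by (elim eval_QueryE) (auto dest!: eval_Query_no.IH)
next
  case eval_Var
  from eval_Var.prems show ?case by (elim eval_elims) (auto)
next
  case eval_Nil
  from eval_Nil.prems show ?case by (elim eval_elims) (auto)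
next
  case eval_Cons
  from eval_Cons.prems show ?case by (elim eval_elims) (auto dest!: eval_Cons.IH)
next
  case eval_Hd
  from eval_Hd.prems show ?case by (elim eval_elims) (auto dest!: eval_Hd.IH)
next
  case eval_Hd_Leaf
  from eval_Hd_Leaf.prems show ?case by (elim eval_elims) (auto dest!: eval_Hd_Leaf.IH)
next
  case eval_Tl
  from eval_Tl.prems show ?case by (elim eval_elims) (auto dest!: eval_Tl.IH)
next
  case eval_Tl_Leaf
  from eval_Tl_Leaf.prems show ?case by (elim eval_elims) (auto dest!: eval_Tl_Leaf.IH)
next
  case eval_If_True
  from eval_If_True.prems show ?case by (elim eval_elims) (auto simp: eval_If_True.hyps dest!: eval_If_True.IH)
next
  case eval_If_False
  from eval_If_False.prems show ?case by (elim eval_elims) (auto dest!: eval_If_False.IH)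
next
  case eval_Let
  from eval_Let.prems show ?case by (elim eval_elims) (auto dest!: eval_Let.IH)
next
  case eval_Call
  from eval_Call.prems show ?case by (elim eval_elims) (auto dest!: eval_Call.IH)
qed

text \<open>The program and the polynomial depend only on the problems, not on the input.\<close>

definition cook_reducible :: "problem \<Rightarrow> problem list \<Rightarrow> bool" where
  "cook_reducible A Ps \<longleftrightarrow>
     (\<exists>(prog :: exp list) (p :: nat poly). prog \<noteq> [] \<and>
        (\<forall>x \<in> yes A \<union> no A. \<exists>v t. evals_to Ps prog [x] (prog ! 0) v t \<and>
           t \<le> poly p (size x) \<and> (v \<noteq> Leaf \<longleftrightarrow> x \<in> yes A)))"


section \<open>Amalgamated free products\<close>

text \<open>
  The amalgamated free product of \<open>G\<close> and \<open>H\<close> along \<open>\<phi> : C \<rightarrow> G\<close> and \<open>\<psi> : C \<rightarrow> H\<close>: words in the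
  disjoint union of \<open>G\<close> and \<open>H\<close>, modulo the congruence generated by the multiplications of \<open>G\<close>
  and \<open>H\<close> and by \<open>\<phi> c = \<psi> c\<close>.
\<close>

abbreviation amalg_words ::
  "('a, 'm) monoid_scheme \<Rightarrow> ('b, 'n) monoid_scheme \<Rightarrow> ('a + 'b) list set" where
  "amalg_words G H \<equiv> lists (carrier G <+> carrier H)"

inductive amalg_cong ::
  "('a, 'm) monoid_scheme \<Rightarrow> ('b, 'n) monoid_scheme \<Rightarrow> ('c, 'k) monoid_scheme \<Rightarrow>
   ('c \<Rightarrow> 'a) \<Rightarrow> ('c \<Rightarrow> 'b) \<Rightarrow> ('a + 'b) list \<Rightarrow> ('a + 'b) list \<Rightarrow> bool"
  for G H C \<phi> \<psi> where
  refl: "u \<in> amalg_words G H \<Longrightarrow> amalg_cong G H C \<phi> \<psi> u u"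
| sym: "amalg_cong G H C \<phi> \<psi> u v \<Longrightarrow> amalg_cong G H C \<phi> \<psi> v u"
| trans: "amalg_cong G H C \<phi> \<psi> u v \<Longrightarrow> amalg_cong G H C \<phi> \<psi> v w \<Longrightarrow> amalg_cong G H C \<phi> \<psi> u w"
| append: "amalg_cong G H C \<phi> \<psi> u v \<Longrightarrow> amalg_cong G H C \<phi> \<psi> u' v' \<Longrightarrow>
    amalg_cong G H C \<phi> \<psi> (u @ u') (v @ v')"
| mult_l: "a \<in> carrier G \<Longrightarrow> b \<in> carrier G \<Longrightarrow>
    amalg_cong G H C \<phi> \<psi> [Inl a, Inl b] [Inl (a \<otimes>\<^bsub>G\<^esub> b)]"
| mult_r: "a \<in> carrier H \<Longrightarrow> b \<in> carrier H \<Longrightarrow>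
    amalg_cong G H C \<phi> \<psi> [Inr a, Inr b] [Inr (a \<otimes>\<^bsub>H\<^esub> b)]"
| one_l: "amalg_cong G H C \<phi> \<psi> [Inl \<one>\<^bsub>G\<^esub>] []"
| one_r: "amalg_cong G H C \<phi> \<psi> [Inr \<one>\<^bsub>H\<^esub>] []"
| glue: "c \<in> carrier C \<Longrightarrow> amalg_cong G H C \<phi> \<psi> [Inl (\<phi> c)] [Inr (\<psi> c)]"

definition amalg_class ::
  "('a, 'm) monoid_scheme \<Rightarrow> ('b, 'n) monoid_scheme \<Rightarrow> ('c, 'k) monoid_scheme \<Rightarrow>
   ('c \<Rightarrow> 'a) \<Rightarrow> ('c \<Rightarrow> 'b) \<Rightarrow> ('a + 'b) list \<Rightarrow> ('a + 'b) list set" where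
  "amalg_class G H C \<phi> \<psi> u = {v. amalg_cong G H C \<phi> \<psi> u v}"

definition amalgam ::
  "('a, 'm) monoid_scheme \<Rightarrow> ('b, 'n) monoid_scheme \<Rightarrow> ('c, 'k) monoid_scheme \<Rightarrow>
   ('c \<Rightarrow> 'a) \<Rightarrow> ('c \<Rightarrow> 'b) \<Rightarrow> ('a + 'b) list set monoid" where
  "amalgam G H C \<phi> \<psi> =
     \<lparr>carrier = amalg_class G H C \<phi> \<psi> ` amalg_words G H,
      monoid.mult = (\<lambda>U V. \<Union>u\<in>U. \<Union>v\<in>V. amalg_class G H C \<phi> \<psi> (u @ v)),
      one = amalg_class G H C \<phi> \<psi> []\<rparr>"

definition amalg_inl ::
  "('a, 'm) monoid_scheme \<Rightarrow> ('b, 'n) monoid_scheme \<Rightarrow> ('c, 'k) monoid_scheme \<Rightarrow>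
   ('c \<Rightarrow> 'a) \<Rightarrow> ('c \<Rightarrow> 'b) \<Rightarrow> 'a \<Rightarrow> ('a + 'b) list set" where
  "amalg_inl G H C \<phi> \<psi> g = amalg_class G H C \<phi> \<psi> [Inl g]"

definition amalg_inr ::
  "('a, 'm) monoid_scheme \<Rightarrow> ('b, 'n) monoid_scheme \<Rightarrow> ('c, 'k) monoid_scheme \<Rightarrow>
   ('c \<Rightarrow> 'a) \<Rightarrow> ('c \<Rightarrow> 'b) \<Rightarrow> 'b \<Rightarrow> ('a + 'b) list set" where
  "amalg_inr G H C \<phi> \<psi> h = amalg_class G H C \<phi> \<psi> [Inr h]"

locale amalgamation = G: group G + H: group H + C: group C
  for G (structure) and H (structure) and C (structure) +
  fixes \<phi> \<psi>
  assumes phi: "\<phi> \<in> hom C G" and psi: "\<psi> \<in> hom C H"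
begin

abbreviation "W \<equiv> amalg_words G H"
abbreviation "R \<equiv> amalg_cong G H C \<phi> \<psi>"
abbreviation "cl \<equiv> amalg_class G H C \<phi> \<psi>"
abbreviation "P \<equiv> amalgam G H C \<phi> \<psi>"

lemma cong_words: "R u v \<Longrightarrow> u \<in> W \<and> v \<in> W"
proof (induction rule: amalg_cong.induct)
  case (glue c)
  then show ?case using hom_in_carrier[OF phi] hom_in_carrier[OF psi] by auto
qed auto

lemma class_eq_iff: "u \<in> W \<Longrightarrow> cl u = cl v \<longleftrightarrow> R u v"
  unfolding amalg_class_def
  by (auto intro: amalg_cong.sym amalg_cong.trans amalg_cong.refl)

lemma class_mult:
  assumes "u \<in> W" "v \<in> W"
  shows "cl u \<otimes>\<^bsub>P\<^esub> cl v = cl (u @ v)"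
proof -
  have eq: "cl (u' @ v') = cl (u @ v)" if "u' \<in> cl u" "v' \<in> cl v" for u' v'
  proof -
    have "R (u @ v) (u' @ v')" using that by (intro amalg_cong.append) (auto simp: amalg_class_def)
    then show ?thesis using assms class_eq_iff[of "u @ v" "u' @ v'"] by simp
  qed
  have "u \<in> cl u" "v \<in> cl v" using assms by (auto simp: amalg_class_def intro!: amalg_cong.refl)
  then have "(\<Union>u'\<in>cl u. \<Union>v'\<in>cl v. cl (u' @ v')) = cl (u @ v)" using eq by blast
  then show ?thesis by (simp add: amalgam_def)
qed

lemma class_left_inverse:
  assumes "u \<in> W"
  shows "\<exists>v\<in>W. R (v @ u) []"
  using assms
proof (induction u rule: lists.induct)
  case Nil
  show ?case by (auto intro!: bexI[of _ "[]"] amalg_cong.refl)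
next
  case (Cons x u)
  then obtain v where v: "v \<in> W" "R (v @ u) []" by auto
  have "\<exists>y. [y] \<in> W \<and> R [y, x] []"
  proof (cases x)
    case (Inl a)
    then have a: "a \<in> carrier G" using Cons by auto
    have "R [Inl (inv\<^bsub>G\<^esub> a), Inl a] []"
    proof (rule amalg_cong.trans)
      show "R [Inl (inv\<^bsub>G\<^esub> a), Inl a] [Inl (inv\<^bsub>G\<^esub> a \<otimes>\<^bsub>G\<^esub> a)]"
        using a by (intro amalg_cong.mult_l) auto
      show "R [Inl (inv\<^bsub>G\<^esub> a \<otimes>\<^bsub>G\<^esub> a)] []"
        using a by (simp add: amalg_cong.one_l)
    qed
    then show ?thesis using Inl a by (intro exI[of _ "Inl (inv\<^bsub>G\<^esub> a)"]) auto
  next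
    case (Inr a)
    then have a: "a \<in> carrier H" using Cons by auto
    have "R [Inr (inv\<^bsub>H\<^esub> a), Inr a] []"
    proof (rule amalg_cong.trans)
      show "R [Inr (inv\<^bsub>H\<^esub> a), Inr a] [Inr (inv\<^bsub>H\<^esub> a \<otimes>\<^bsub>H\<^esub> a)]"
        using a by (intro amalg_cong.mult_r) auto
      show "R [Inr (inv\<^bsub>H\<^esub> a \<otimes>\<^bsub>H\<^esub> a)] []"
        using a by (simp add: amalg_cong.one_r)
    qed
    then show ?thesis using Inr a by (intro exI[of _ "Inr (inv\<^bsub>H\<^esub> a)"]) auto
  qed
  then obtain y where y: "[y] \<in> W" "R [y, x] []" by auto
  have "u \<in> W" using Cons.hyps by blast
  then have "R ([y, x] @ u) ([] @ u)"
    by (intro amalg_cong.append[OF y(2)] amalg_cong.refl)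
  then have "R (v @ ([y, x] @ u)) (v @ ([] @ u))"
    by (intro amalg_cong.append[OF amalg_cong.refl[OF v(1)]])
  then have "R ((v @ [y]) @ x # u) []"
    using amalg_cong.trans v(2) by auto
  moreover have "v @ [y] \<in> W" using v y by auto
  ultimately show ?case by blast
qed

lemma carrier_amalgam: "carrier P = cl ` W"
  by (simp add: amalgam_def)

lemma group_amalgam: "group P"
proof (rule groupI)
  show "x \<otimes>\<^bsub>P\<^esub> y \<in> carrier P" if xy: "x \<in> carrier P" "y \<in> carrier P" for x y
  proof -
    obtain u v where "u \<in> W" "v \<in> W" "x = cl u" "y = cl v" using xy unfolding carrier_amalgam by blast
    then have "x \<otimes>\<^bsub>P\<^esub> y = cl (u @ v)" "u @ v \<in> W" by (auto simp only: class_mult append_in_lists_conv)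
    then show ?thesis unfolding carrier_amalgam by blast
  qed
  show "\<one>\<^bsub>P\<^esub> \<in> carrier P" by (auto simp: amalgam_def)
  show "x \<otimes>\<^bsub>P\<^esub> y \<otimes>\<^bsub>P\<^esub> z = x \<otimes>\<^bsub>P\<^esub> (y \<otimes>\<^bsub>P\<^esub> z)"
    if xyz: "x \<in> carrier P" "y \<in> carrier P" "z \<in> carrier P" for x y z
  proof -
    obtain u v w where "u \<in> W" "v \<in> W" "w \<in> W" "x = cl u" "y = cl v" "z = cl w"
      using xyz unfolding carrier_amalgam by blast
    moreover from this have "u @ v \<in> W" "v @ w \<in> W" by auto
    ultimately show ?thesis by (simp only: class_mult append_assoc)
  qed
  show "\<one>\<^bsub>P\<^esub> \<otimes>\<^bsub>P\<^esub> x = x" if x: "x \<in> carrier P" for x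
  proof -
    obtain u where "u \<in> W" "x = cl u" using x unfolding carrier_amalgam by blast
    then show ?thesis using class_mult[of "[]" u] by (auto simp: amalgam_def)
  qed
  show "\<exists>y\<in>carrier P. y \<otimes>\<^bsub>P\<^esub> x = \<one>\<^bsub>P\<^esub>" if x: "x \<in> carrier P" for x
  proof -
    obtain u where u: "u \<in> W" "x = cl u" using x unfolding carrier_amalgam by blast
    then obtain v where v: "v \<in> W" "R (v @ u) []" using class_left_inverse by blast
    have "cl v \<otimes>\<^bsub>P\<^esub> x = cl []"
      using u v class_mult class_eq_iff[of "v @ u" "[]"] cong_words by auto
    then show ?thesis using v by (auto simp: amalgam_def)
  qed
qed

lemma amalg_inl_hom: "amalg_inl G H C \<phi> \<psi> \<in> hom G P"
proof (rule homI)
  fix a b assume ab: "a \<in> carrier G" "b \<in> carrier G"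
  then show "amalg_inl G H C \<phi> \<psi> a \<in> carrier P" by (auto simp: amalg_inl_def amalgam_def)
  show "amalg_inl G H C \<phi> \<psi> (a \<otimes> b) = amalg_inl G H C \<phi> \<psi> a \<otimes>\<^bsub>P\<^esub> amalg_inl G H C \<phi> \<psi> b"
  proof -
    have "cl [Inl a, Inl b] = cl [Inl (a \<otimes> b)]"
      using ab by (subst class_eq_iff) (auto intro!: amalg_cong.mult_l)
    then show ?thesis using ab class_mult[of "[Inl a]" "[Inl b]"] by (simp add: amalg_inl_def InlI InrI)
  qed
qed

lemma amalg_inr_hom: "amalg_inr G H C \<phi> \<psi> \<in> hom H P"
proof (rule homI)
  fix a b assume ab: "a \<in> carrier H" "b \<in> carrier H"
  then show "amalg_inr G H C \<phi> \<psi> a \<in> carrier P" by (auto simp: amalg_inr_def amalgam_def)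
  show "amalg_inr G H C \<phi> \<psi> (a \<otimes>\<^bsub>H\<^esub> b) = amalg_inr G H C \<phi> \<psi> a \<otimes>\<^bsub>P\<^esub> amalg_inr G H C \<phi> \<psi> b"
  proof -
    have "cl [Inr a, Inr b] = cl [Inr (a \<otimes>\<^bsub>H\<^esub> b)]"
      using ab by (subst class_eq_iff) (auto intro!: amalg_cong.mult_r)
    then show ?thesis using ab class_mult[of "[Inr a]" "[Inr b]"] by (simp add: amalg_inr_def InlI InrI)
  qed
qed

lemma amalg_inl_inr:
  "c \<in> carrier C \<Longrightarrow> amalg_inl G H C \<phi> \<psi> (\<phi> c) = amalg_inr G H C \<phi> \<psi> (\<psi> c)"
  unfolding amalg_inl_def amalg_inr_def
  using hom_in_carrier[OF phi] by (subst class_eq_iff) (auto intro!: amalg_cong.glue)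

end

end

theory Submission
  imports Defs
begin

text \<open>
  An automaton \<open>A\<close> accepts an element equal to the word \<open>w\<close> if and only if, for some final state \<open>f\<close>,
  the identity is the value of a run from the start to the end of a path that hangs at \<open>f\<close>
  and is labelled by the inverse of \<open>w\<close>. Such a path may be appended in a progressive family, so it
  remains to decide whether the identity is the value of a run between two given states.

  For this purpose the automaton is saturated. Whenever one of the factors, reading only its own
  letters and those of shortcuts, has a run from \<open>p\<close> to \<open>q\<close> whose value is an element \<open>c\<close> of \<open>C\<close>, the shortcut from \<open>p\<close> to \<open>q\<close>
  labelled by \<open>c\<close> is added; from then on it can be read in both factors. Whether there is such a run is
  one question to the subroutine of the factor, about a subgraph of the present graph. Shortcuts do not
  change the values of runs, and there are only polynomially many of them, since \<open>C\<close> is finite.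

  In a saturated automaton, every run whose value lies in \<open>C\<close> can be replaced by a run in \<open>G\<close> with the
  same ends and the same value (\<open>chain_in_C\<close>). Indeed, cut the run into syllables, that is, runs in a
  single factor. By the normal form theorem for amalgamated free products (\<open>reduced_notin_C\<close>) a
  product of alternating syllables outside \<open>C\<close> does not lie in \<open>C\<close>, unless it is empty. So two adjacent
  syllables belong to the same factor and can be merged, or some syllable lies in \<open>C\<close>; the latter can
  be replaced by a shortcut, which is read in the factor of a neighbouring syllable and merged
  with it (\<open>shorten_chain\<close>). Finally a single syllable is left. The normal form theorem itself is
  proved by van der Waerden's method, by an action of the amalgam on the set of normal forms.

  The running time is treated by showing that the functions computable in polynomial time with
  subroutines (\<open>ptime\<close>) are closed under composition, pairing, case distinction, loops whose
  intermediate results have polynomial size, list comprehension, finite tables and subroutine calls.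
  The algorithm is an ordinary function on automata and is shown to be in this class by following its
  definition.
\<close>

section \<open>Normal forms in amalgamated free products\<close>

locale subgroup_transversal = K: group K + C: group C
  for K (structure) and C (structure) +
  fixes \<iota>
  assumes emb: "\<iota> \<in> mon C K"
begin

lemma emb_hom: "\<iota> \<in> hom C K" and emb_inj: "inj_on \<iota> (carrier C)"
  using emb by (auto simp: mon_def)

lemma emb_closed [simp]: "c \<in> carrier C \<Longrightarrow> \<iota> c \<in> carrier K"
  using hom_in_carrier[OF emb_hom] .

lemma emb_mult: "c \<in> carrier C \<Longrightarrow> d \<in> carrier C \<Longrightarrow> \<iota> (c \<otimes>\<^bsub>C\<^esub> d) = \<iota> c \<otimes>\<^bsub>K\<^esub> \<iota> d"
  using hom_mult[OF emb_hom] .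

lemma emb_one [simp]: "\<iota> \<one>\<^bsub>C\<^esub> = \<one>\<^bsub>K\<^esub>"
  using hom_one[OF emb_hom C.is_group K.is_group] .

definition coset :: "'a \<Rightarrow> 'a set" where
  "coset g = (\<lambda>c. \<iota> c \<otimes>\<^bsub>K\<^esub> g) ` carrier C"

text \<open>
  The coset of the identity must be represented by the identity itself, so that an element of the
  amalgamated subgroup leaves no syllable behind.
\<close>

definition rep :: "'a \<Rightarrow> 'a" where
  "rep g = (if g \<in> \<iota> ` carrier C then \<one>\<^bsub>K\<^esub> else (SOME t. t \<in> coset g))"

definition cpart :: "'a \<Rightarrow> 'c" where
  "cpart g = (SOME c. c \<in> carrier C \<and> g = \<iota> c \<otimes>\<^bsub>K\<^esub> rep g)"

lemma coset_translate:
  assumes "g \<in> carrier K" "c \<in> carrier C"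
  shows "coset (\<iota> c \<otimes>\<^bsub>K\<^esub> g) = coset g"
proof
  show "coset (\<iota> c \<otimes>\<^bsub>K\<^esub> g) \<subseteq> coset g"
  proof
    fix t assume "t \<in> coset (\<iota> c \<otimes>\<^bsub>K\<^esub> g)"
    then obtain d where "d \<in> carrier C" "t = \<iota> d \<otimes>\<^bsub>K\<^esub> (\<iota> c \<otimes>\<^bsub>K\<^esub> g)"
      by (auto simp: coset_def)
    then have "t = \<iota> (d \<otimes>\<^bsub>C\<^esub> c) \<otimes>\<^bsub>K\<^esub> g" "d \<otimes>\<^bsub>C\<^esub> c \<in> carrier C"
      using assms by (simp_all add: emb_mult K.m_assoc)
    then show "t \<in> coset g" by (auto simp: coset_def)
  qed
  show "coset g \<subseteq> coset (\<iota> c \<otimes>\<^bsub>K\<^esub> g)"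
  proof
    fix t assume "t \<in> coset g"
    then obtain d where d: "d \<in> carrier C" "t = \<iota> d \<otimes>\<^bsub>K\<^esub> g" by (auto simp: coset_def)
    have "\<iota> (d \<otimes>\<^bsub>C\<^esub> inv\<^bsub>C\<^esub> c) \<otimes>\<^bsub>K\<^esub> (\<iota> c \<otimes>\<^bsub>K\<^esub> g) = \<iota> (d \<otimes>\<^bsub>C\<^esub> inv\<^bsub>C\<^esub> c) \<otimes>\<^bsub>K\<^esub> \<iota> c \<otimes>\<^bsub>K\<^esub> g"
      using d assms by (simp only: K.m_assoc emb_closed C.m_closed C.inv_closed)
    also have "\<dots> = \<iota> (d \<otimes>\<^bsub>C\<^esub> inv\<^bsub>C\<^esub> c \<otimes>\<^bsub>C\<^esub> c) \<otimes>\<^bsub>K\<^esub> g"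
      using d assms by (subst emb_mult[of "d \<otimes>\<^bsub>C\<^esub> inv\<^bsub>C\<^esub> c" c]) simp_all
    also have "\<dots> = t" using d assms by (simp add: C.m_assoc)
    finally show "t \<in> coset (\<iota> c \<otimes>\<^bsub>K\<^esub> g)"
      unfolding coset_def using d assms by (intro image_eqI[of _ _ "d \<otimes>\<^bsub>C\<^esub> inv\<^bsub>C\<^esub> c"]) simp_all
  qed
qed

lemma in_image_translate:
  assumes "g \<in> carrier K" "c \<in> carrier C"
  shows "\<iota> c \<otimes>\<^bsub>K\<^esub> g \<in> \<iota> ` carrier C \<longleftrightarrow> g \<in> \<iota> ` carrier C"
proof
  assume "\<iota> c \<otimes>\<^bsub>K\<^esub> g \<in> \<iota> ` carrier C"
  then obtain d where d: "d \<in> carrier C" "\<iota> c \<otimes>\<^bsub>K\<^esub> g = \<iota> d" by auto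
  have "\<iota> (inv\<^bsub>C\<^esub> c \<otimes>\<^bsub>C\<^esub> d) = \<iota> (inv\<^bsub>C\<^esub> c) \<otimes>\<^bsub>K\<^esub> (\<iota> c \<otimes>\<^bsub>K\<^esub> g)"
    using d assms by (simp add: emb_mult)
  also have "\<dots> = \<iota> (inv\<^bsub>C\<^esub> c \<otimes>\<^bsub>C\<^esub> c) \<otimes>\<^bsub>K\<^esub> g"
    using assms by (simp only: emb_mult K.m_assoc emb_closed C.inv_closed)
  also have "\<dots> = g" using assms by simp
  finally show "g \<in> \<iota> ` carrier C" using assms d by (metis C.inv_closed C.m_closed image_eqI)
next
  assume "g \<in> \<iota> ` carrier C"
  then show "\<iota> c \<otimes>\<^bsub>K\<^esub> g \<in> \<iota> ` carrier C" using assms by (auto simp flip: emb_mult)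
qed

lemma rep_translate [simp]:
  "g \<in> carrier K \<Longrightarrow> c \<in> carrier C \<Longrightarrow> rep (\<iota> c \<otimes>\<^bsub>K\<^esub> g) = rep g"
  by (simp add: rep_def coset_translate in_image_translate)

lemma rep_in_coset:
  assumes "g \<in> carrier K"
  shows "\<exists>c\<in>carrier C. rep g = \<iota> c \<otimes>\<^bsub>K\<^esub> g"
proof (cases "g \<in> \<iota> ` carrier C")
  case True
  then obtain d where d: "d \<in> carrier C" "g = \<iota> d" by auto
  then have "rep g = \<iota> (inv\<^bsub>C\<^esub> d) \<otimes>\<^bsub>K\<^esub> g"
    by (simp add: rep_def flip: emb_mult)
  then show ?thesis using d by blast
next
  case False
  have "g \<in> coset g"
    unfolding coset_def by (rule image_eqI[of _ _ "\<one>\<^bsub>C\<^esub>"]) (use assms in auto)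
  then have "(SOME t. t \<in> coset g) \<in> coset g" by (rule someI)
  then show ?thesis using False by (auto simp: rep_def coset_def)
qed

lemma rep_closed [simp]: "g \<in> carrier K \<Longrightarrow> rep g \<in> carrier K"
  using rep_in_coset[of g] by auto

lemma cpart:
  assumes "g \<in> carrier K"
  shows cpart_closed: "cpart g \<in> carrier C" and decompose: "\<iota> (cpart g) \<otimes>\<^bsub>K\<^esub> rep g = g"
proof -
  obtain c where c: "c \<in> carrier C" "rep g = \<iota> c \<otimes>\<^bsub>K\<^esub> g" using rep_in_coset[OF assms] by auto
  have "\<iota> (inv\<^bsub>C\<^esub> c) \<otimes>\<^bsub>K\<^esub> rep g = \<iota> (inv\<^bsub>C\<^esub> c \<otimes>\<^bsub>C\<^esub> c) \<otimes>\<^bsub>K\<^esub> g"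
    using c assms by (simp only: emb_mult K.m_assoc emb_closed C.inv_closed)
  then have "\<exists>c. c \<in> carrier C \<and> g = \<iota> c \<otimes>\<^bsub>K\<^esub> rep g"
    using c assms by (intro exI[of _ "inv\<^bsub>C\<^esub> c"]) simp
  from someI_ex[OF this] show "cpart g \<in> carrier C" "\<iota> (cpart g) \<otimes>\<^bsub>K\<^esub> rep g = g"
    by (auto simp: cpart_def)
qed

lemma cpart_unique:
  assumes "g \<in> carrier K" "c \<in> carrier C" "g = \<iota> c \<otimes>\<^bsub>K\<^esub> rep g"
  shows "cpart g = c"
proof -
  have "\<iota> (cpart g) \<otimes>\<^bsub>K\<^esub> rep g = \<iota> c \<otimes>\<^bsub>K\<^esub> rep g" using assms decompose[of g] by simp
  then have "\<iota> (cpart g) = \<iota> c"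
    using assms cpart_closed[of g] by (metis K.right_cancel emb_closed rep_closed)
  then show ?thesis using emb_inj assms cpart_closed[of g] by (auto dest: inj_onD)
qed

lemma rep_eq_one_iff:
  assumes "g \<in> carrier K"
  shows "rep g = \<one>\<^bsub>K\<^esub> \<longleftrightarrow> g \<in> \<iota> ` carrier C"
proof
  assume "rep g = \<one>\<^bsub>K\<^esub>"
  then have "g = \<iota> (cpart g)" using decompose[OF assms] cpart_closed[OF assms] by simp
  then show "g \<in> \<iota> ` carrier C" using cpart_closed[OF assms] by blast
qed (simp add: rep_def)

lemma rep_rep [simp]: "g \<in> carrier K \<Longrightarrow> rep (rep g) = rep g"
  by (metis decompose cpart_closed rep_closed rep_translate)

end

text \<open>
  One factor of an amalgam acts on the normal forms \<open>(c, ts)\<close>, where \<open>ts\<close> is a list of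
  syllables, those of this factor being marked by \<open>con\<close>. A normal form whose first syllable is
  \<open>con t\<close> is read as the element \<open>\<iota> c \<otimes> t\<close> of the factor followed by the remaining syllables, any
  other normal form as \<open>\<iota> c\<close> followed by all syllables; this is a bijection, and the factor acts
  by left multiplication on the first component. Thus there are no cases to distinguish in the
  proof that it is an action.
\<close>

locale factor_action = subgroup_transversal K C \<iota>
  for K (structure) and C (structure) and \<iota> +
  fixes con :: "'a \<Rightarrow> 'x" and V :: "'x list set"
  assumes inj_con: "inj con"
    and V_Cons: "con t # ts \<in> V \<longleftrightarrow>
      t \<in> carrier K \<and> rep t = t \<and> t \<noteq> \<one>\<^bsub>K\<^esub> \<and> ts \<in> V \<and> (ts = [] \<or> hd ts \<notin> range con)"
begin

definition others :: "'x list set" where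
  "others = {ts \<in> V. ts = [] \<or> hd ts \<notin> range con}"

definition pop :: "'c \<times> 'x list \<Rightarrow> 'a \<times> 'x list" where
  "pop = (\<lambda>(c, ts). if ts \<noteq> [] \<and> hd ts \<in> range con
     then (\<iota> c \<otimes>\<^bsub>K\<^esub> the_inv con (hd ts), tl ts) else (\<iota> c, ts))"

definition push :: "'a \<times> 'x list \<Rightarrow> 'c \<times> 'x list" where
  "push = (\<lambda>(g, ts). (cpart g, if rep g = \<one>\<^bsub>K\<^esub> then ts else con (rep g) # ts))"

definition act :: "'a \<Rightarrow> 'c \<times> 'x list \<Rightarrow> 'c \<times> 'x list" where
  "act g s = (case pop s of (h, ts) \<Rightarrow> push (g \<otimes>\<^bsub>K\<^esub> h, ts))"

lemma pop_Cons [simp]: "pop (c, con t # ts) = (\<iota> c \<otimes>\<^bsub>K\<^esub> t, ts)"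
  by (simp add: pop_def the_inv_f_f[OF inj_con])

lemma pop_other [simp]: "ts \<in> others \<Longrightarrow> pop (c, ts) = (\<iota> c, ts)"
  by (auto simp: pop_def others_def)

lemma V_cases:
  assumes "ts \<in> V"
  obtains "ts \<in> others"
  | t ts' where "ts = con t # ts'" "t \<in> carrier K" "rep t = t" "t \<noteq> \<one>\<^bsub>K\<^esub>" "ts' \<in> others"
proof (cases "ts = [] \<or> hd ts \<notin> range con")
  case True
  then show ?thesis using assms that by (simp add: others_def)
next
  case False
  then obtain t ts' where "ts = con t # ts'" by (cases ts) auto
  then show ?thesis using assms that V_Cons by (auto simp: others_def)
qed

lemma pop_closed:
  assumes "s \<in> carrier C \<times> V"
  shows "pop s \<in> carrier K \<times> others"
proof -
  obtain c ts where s: "s = (c, ts)" "c \<in> carrier C" "ts \<in> V" using assms by auto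
  from s(3) show ?thesis by (cases rule: V_cases) (use s in auto)
qed

lemma push_closed: "x \<in> carrier K \<times> others \<Longrightarrow> push x \<in> carrier C \<times> V"
  by (auto simp: push_def others_def cpart_closed V_Cons)

lemma pop_push: "x \<in> carrier K \<times> others \<Longrightarrow> pop (push x) = x"
  using decompose cpart_closed by (auto simp: push_def split: if_splits) (metis K.r_one emb_closed)

lemma push_pop:
  assumes "s \<in> carrier C \<times> V"
  shows "push (pop s) = s"
proof -
  obtain c ts where s: "s = (c, ts)" "c \<in> carrier C" "ts \<in> V" using assms by auto
  from s(3) show ?thesis
  proof (cases rule: V_cases)
    case 1
    then show ?thesis using s by (auto simp: push_def rep_def intro!: cpart_unique)
  next
    case (2 t ts')
    then show ?thesis using s by (auto simp: push_def intro!: cpart_unique)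
  qed
qed

lemma act_closed:
  assumes "g \<in> carrier K" "s \<in> carrier C \<times> V"
  shows "act g s \<in> carrier C \<times> V"
  using pop_closed[OF assms(2)] assms(1) by (auto simp: act_def split: prod.splits intro!: push_closed)

lemma act_one: "s \<in> carrier C \<times> V \<Longrightarrow> act \<one>\<^bsub>K\<^esub> s = s"
  using pop_closed[of s] push_pop[of s] by (auto simp: act_def split: prod.splits)

lemma act_mult:
  assumes "g \<in> carrier K" "h \<in> carrier K" "s \<in> carrier C \<times> V"
  shows "act (g \<otimes>\<^bsub>K\<^esub> h) s = act g (act h s)"
proof -
  obtain k ts where k: "pop s = (k, ts)" "k \<in> carrier K" "ts \<in> others"
    using pop_closed[OF assms(3)] by auto
  then have "pop (act h s) = (h \<otimes>\<^bsub>K\<^esub> k, ts)"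
    using assms by (simp add: act_def pop_push)
  then show ?thesis using k assms by (simp add: act_def K.m_assoc)
qed

text \<open>The amalgamated subgroup acts by a formula that does not depend on the factor.\<close>

lemma act_emb:
  assumes "d \<in> carrier C" "c \<in> carrier C" "ts \<in> V"
  shows "act (\<iota> d) (c, ts) = (d \<otimes>\<^bsub>C\<^esub> c, ts)"
proof -
  have "push (pop (d \<otimes>\<^bsub>C\<^esub> c, ts)) = (d \<otimes>\<^bsub>C\<^esub> c, ts)"
    using assms by (intro push_pop) auto
  moreover have "act (\<iota> d) (c, ts) = push (pop (d \<otimes>\<^bsub>C\<^esub> c, ts))"
    using assms(3) by (cases rule: V_cases) (use assms in \<open>auto simp: act_def emb_mult K.m_assoc\<close>)
  ultimately show ?thesis by simp
qed

lemma act_other: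
  "ts \<in> others \<Longrightarrow> c \<in> carrier C \<Longrightarrow> act g (c, ts) = push (g \<otimes>\<^bsub>K\<^esub> \<iota> c, ts)"
  by (simp add: act_def)

lemma act_proper_syllable:
  assumes "g \<in> carrier K" "g \<notin> \<iota> ` carrier C" "c \<in> carrier C" "ts \<in> others"
  shows "\<exists>d t. act g (c, ts) = (d, con t # ts)"
proof -
  have "g \<otimes>\<^bsub>K\<^esub> \<iota> c \<notin> \<iota> ` carrier C"
  proof
    assume "g \<otimes>\<^bsub>K\<^esub> \<iota> c \<in> \<iota> ` carrier C"
    then obtain d where d: "d \<in> carrier C" "g \<otimes>\<^bsub>K\<^esub> \<iota> c = \<iota> d" by auto
    have "g = g \<otimes>\<^bsub>K\<^esub> \<iota> c \<otimes>\<^bsub>K\<^esub> \<iota> (inv\<^bsub>C\<^esub> c)"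
      using assms by (simp add: K.m_assoc flip: emb_mult)
    then have "g = \<iota> (d \<otimes>\<^bsub>C\<^esub> inv\<^bsub>C\<^esub> c)" using d assms by (simp add: emb_mult)
    then show False using d assms by blast
  qed
  then have "rep (g \<otimes>\<^bsub>K\<^esub> \<iota> c) \<noteq> \<one>\<^bsub>K\<^esub>" using assms by (simp add: rep_eq_one_iff)
  then show ?thesis using assms by (auto simp add: act_other push_def)
qed

lemma act_inj:
  assumes "g \<in> carrier K" "h \<in> carrier K" "ts \<in> others"
    and "act g (\<one>\<^bsub>C\<^esub>, ts) = act h (\<one>\<^bsub>C\<^esub>, ts)"
  shows "g = h"
proof -
  have "push (g, ts) = push (h, ts)" using assms by (simp add: act_other)
  then have "pop (push (g, ts)) = pop (push (h, ts))" by simp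
  then show ?thesis using assms by (simp add: pop_push)
qed

end

locale embedded_amalgamation = amalgamation +
  assumes phi_mon: "\<phi> \<in> mon C G" and psi_mon: "\<psi> \<in> mon C H"

sublocale embedded_amalgamation \<subseteq> GT: subgroup_transversal G C \<phi>
  by unfold_locales (rule phi_mon)

sublocale embedded_amalgamation \<subseteq> HT: subgroup_transversal H C \<psi>
  by unfold_locales (rule psi_mon)

context embedded_amalgamation
begin

definition syllables :: "('a + 'c) list set" where
  "syllables = {ts. successively (\<lambda>x y. isl x \<noteq> isl y) ts \<and>
     (\<forall>x\<in>set ts. case x of
        Inl t \<Rightarrow> t \<in> carrier G \<and> GT.rep t = t \<and> t \<noteq> \<one>\<^bsub>G\<^esub>
      | Inr t \<Rightarrow> t \<in> carrier H \<and> HT.rep t = t \<and> t \<noteq> \<one>\<^bsub>H\<^esub>)}"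

definition in_C :: "'a + 'c \<Rightarrow> bool" where
  "in_C x = (case x of Inl g \<Rightarrow> g \<in> \<phi> ` carrier C | Inr h \<Rightarrow> h \<in> \<psi> ` carrier C)"

definition reduced :: "('a + 'c) list \<Rightarrow> bool" where
  "reduced u \<longleftrightarrow> successively (\<lambda>x y. isl x \<noteq> isl y) u \<and> (\<forall>x\<in>set u. \<not> in_C x)"

end

sublocale embedded_amalgamation \<subseteq> GA: factor_action G C \<phi> "Inl :: 'a \<Rightarrow> 'a + 'c" syllables
proof
  show "Inl t # ts \<in> syllables \<longleftrightarrow> t \<in> carrier G \<and> GT.rep t = t \<and> t \<noteq> \<one>\<^bsub>G\<^esub> \<and> ts \<in> syllables \<and>
      (ts = [] \<or> hd ts \<notin> range Inl)" for t ts
    by (cases ts; cases "hd ts") (auto simp: syllables_def)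
qed simp

sublocale embedded_amalgamation \<subseteq> HA: factor_action H C \<psi> "Inr :: 'c \<Rightarrow> 'a + 'c" syllables
proof
  show "Inr t # ts \<in> syllables \<longleftrightarrow> t \<in> carrier H \<and> HT.rep t = t \<and> t \<noteq> \<one>\<^bsub>H\<^esub> \<and> ts \<in> syllables \<and>
      (ts = [] \<or> hd ts \<notin> range Inr)" for t ts
    by (cases ts; cases "hd ts") (auto simp: syllables_def)
qed simp

context embedded_amalgamation
begin

definition letter_act :: "'a + 'c \<Rightarrow> 'e \<times> ('a + 'c) list \<Rightarrow> 'e \<times> ('a + 'c) list" where
  "letter_act x = (case x of Inl g \<Rightarrow> GA.act g | Inr h \<Rightarrow> HA.act h)"

lemma letter_act_closed:
  "x \<in> carrier G <+> carrier H \<Longrightarrow> s \<in> carrier C \<times> syllables \<Longrightarrow> letter_act x s \<in> carrier C \<times> syllables"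
  using GA.act_closed HA.act_closed by (auto simp: letter_act_def)

lemma word_act_closed:
  "u \<in> W \<Longrightarrow> s \<in> carrier C \<times> syllables \<Longrightarrow> foldr letter_act u s \<in> carrier C \<times> syllables"
  by (induction u) (auto simp del: mem_Times_iff intro: letter_act_closed)

text \<open>Both factors act, and the actions agree on \<open>C\<close>; so the amalgam acts.\<close>

lemma cong_act:
  "R u v \<Longrightarrow> s \<in> carrier C \<times> syllables \<Longrightarrow> foldr letter_act u s = foldr letter_act v s"
proof (induction arbitrary: s rule: amalg_cong.induct)
  case (append u v u' v')
  then show ?case using cong_words[of u' v'] word_act_closed[of v' s] by simp
qed (auto simp: letter_act_def GA.act_mult HA.act_mult GA.act_one HA.act_one GA.act_emb HA.act_emb)

lemma others_iff:
  "ts \<in> GA.others \<longleftrightarrow> ts \<in> syllables \<and> (ts = [] \<or> \<not> isl (hd ts))"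
  "ts \<in> HA.others \<longleftrightarrow> ts \<in> syllables \<and> (ts = [] \<or> isl (hd ts))"
  by (cases ts; cases "hd ts"; auto simp: GA.others_def HA.others_def)+

lemma Nil_syllables: "[] \<in> syllables"
  by (simp add: syllables_def)

lemma reduced_act:
  assumes "u \<in> W" "reduced u"
  shows "\<exists>c ts. foldr letter_act u (\<one>\<^bsub>C\<^esub>, []) = (c, ts) \<and> length ts = length u \<and>
    (u \<noteq> [] \<longrightarrow> isl (hd ts) = isl (hd u))"
  using assms
proof (induction u)
  case (Cons x u)
  then have u: "u \<in> W" "reduced u" by (auto simp: reduced_def successively_Cons)
  then obtain c ts where ts: "foldr letter_act u (\<one>\<^bsub>C\<^esub>, []) = (c, ts)" "length ts = length u"
    "u \<noteq> [] \<longrightarrow> isl (hd ts) = isl (hd u)" using Cons.IH by auto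
  have "(c, ts) \<in> carrier C \<times> syllables"
    using word_act_closed[OF u(1), of "(\<one>\<^bsub>C\<^esub>, [])"] ts Nil_syllables by simp
  moreover have "ts = [] \<or> isl (hd ts) \<noteq> isl x"
    using Cons.prems ts by (cases u) (auto simp: reduced_def)
  moreover have x: "x \<in> carrier G <+> carrier H" "\<not> in_C x"
    using Cons by (simp_all add: reduced_def)
  ultimately have "\<exists>d y. letter_act x (c, ts) = (d, y # ts) \<and> isl y = isl x"
    using GA.act_proper_syllable[of _ c ts] HA.act_proper_syllable[of _ c ts]
    by (cases x) (fastforce simp: letter_act_def others_iff in_C_def)+
  then show ?case using ts by auto
qed simp

text \<open>
  The normal form theorem: each syllable of a reduced word puts one more syllable in front of the
  normal form \<open>(\<one>, [])\<close>, whereas an element of \<open>C\<close> changes only the first component.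
\<close>

theorem reduced_notin_C:
  assumes "R u [Inl (\<phi> c)]" "reduced u" "c \<in> carrier C"
  shows "u = []"
proof -
  have "u \<in> W" using cong_words assms(1) by blast
  then show ?thesis
    using reduced_act[OF _ assms(2)] cong_act[OF assms(1), of "(\<one>\<^bsub>C\<^esub>, [])"] assms(3)
    by (auto simp: letter_act_def GA.act_emb Nil_syllables)
qed

text \<open>
  The factor \<open>G\<close> embeds in the amalgam, because the normal form of \<open>g\<close> is its decomposition
  into an element of \<open>C\<close> and a coset representative.
\<close>

theorem amalg_inl_inj:
  assumes "R [Inl g] [Inl h]" shows "g = h"
proof -
  have "g \<in> carrier G" "h \<in> carrier G" using cong_words[OF assms] by auto
  then show ?thesis
    using cong_act[OF assms, of "(\<one>\<^bsub>C\<^esub>, [])"] GA.act_inj[of g h "[]"]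
    by (simp add: letter_act_def others_iff Nil_syllables)
qed

end

section \<open>Functions computable in polynomial time\<close>

definition enc_pair :: "('a \<Rightarrow> tree) \<Rightarrow> ('b \<Rightarrow> tree) \<Rightarrow> 'a \<times> 'b \<Rightarrow> tree" where
  "enc_pair ea eb = (\<lambda>(x, y). Node (ea x) (eb y))"

definition enc_bool :: "bool \<Rightarrow> tree" where
  "enc_bool b = (if b then Node Leaf Leaf else Leaf)"

definition enc_unit :: "unit \<Rightarrow> tree" where
  "enc_unit u = Leaf"

lemma enc_pair_simp [simp]: "enc_pair ea eb (x, y) = Node (ea x) (eb y)"
  by (simp add: enc_pair_def)

definition installed :: "nat \<Rightarrow> exp list \<Rightarrow> exp list \<Rightarrow> bool" where
  "installed n ext prog \<longleftrightarrow> (\<exists>pre post. prog = pre @ ext @ post \<and> length pre = n)"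

lemma installed_append:
  assumes "installed n (ext1 @ ext2) prog"
  shows "installed n ext1 prog" "installed (n + length ext1) ext2 prog"
proof -
  obtain pre post where p: "prog = pre @ (ext1 @ ext2) @ post" "length pre = n"
    using assms by (auto simp: installed_def)
  from p show "installed n ext1 prog" unfolding installed_def by (metis append.assoc)
  from p show "installed (n + length ext1) ext2 prog"
    unfolding installed_def by (intro exI[of _ "pre @ ext1"] exI[of _ post]) simp
qed

lemma installed_Cons:
  assumes "installed n (b # ext) prog"
  shows "n < length prog" "prog ! n = b" "installed (Suc n) ext prog"
proof -
  obtain pre post where p: "prog = pre @ (b # ext) @ post" "length pre = n"
    using assms by (auto simp: installed_def)
  then show "n < length prog" "prog ! n = b" by (auto simp: nth_append)
  from p show "installed (Suc n) ext prog"
    unfolding installed_def by (intro exI[of _ "pre @ [b]"] exI[of _ post]) simp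
qed

text \<open>
  A function is presented by an expression that finds its argument as \<open>Var 0\<close>, together with
  auxiliary functions \<open>ext\<close> placed at position \<open>n\<close> of the program. Since this is required for every
  position \<open>n\<close> and whatever else the program contains, presentations can be combined without
  renumbering calls. The environment behind the argument is arbitrary, so that presentations can be
  used under \<^const>\<open>LetE\<close>. As values are shared, a computation of time \<open>t\<close> may produce a value of size
  exponential in \<open>t\<close>; the size of the result is therefore bounded separately.
\<close>

definition ptime ::
  "problem list \<Rightarrow> ('a \<Rightarrow> tree) \<Rightarrow> ('b \<Rightarrow> tree) \<Rightarrow> 'a set \<Rightarrow> ('a \<Rightarrow> 'b) \<Rightarrow> bool" where
  "ptime Ps ea eb D f \<longleftrightarrow> (\<exists>p :: nat poly. \<forall>n. \<exists>ext e. \<forall>prog env. \<forall>x\<in>D. installed n ext prog \<longrightarrow>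
     size (eb (f x)) \<le> poly p (size (ea x)) \<and>
     (\<exists>t\<le>poly p (size (ea x)). evals_to Ps prog (ea x # env) e (eb (f x)) t))"

lemma ptimeE:
  assumes "ptime Ps ea eb D f"
  obtains p :: "nat poly" where
    "\<And>x. x \<in> D \<Longrightarrow> size (eb (f x)) \<le> poly p (size (ea x))"
    "\<And>n. \<exists>ext e. \<forall>prog env. \<forall>x\<in>D. installed n ext prog \<longrightarrow>
       (\<exists>t\<le>poly p (size (ea x)). evals_to Ps prog (ea x # env) e (eb (f x)) t)"
proof -
  obtain p :: "nat poly" where p: "\<forall>n. \<exists>ext e. \<forall>prog env. \<forall>x\<in>D. installed n ext prog \<longrightarrow>
     size (eb (f x)) \<le> poly p (size (ea x)) \<and>
     (\<exists>t\<le>poly p (size (ea x)). evals_to Ps prog (ea x # env) e (eb (f x)) t)"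
    using assms unfolding ptime_def by blast
  have "size (eb (f x)) \<le> poly p (size (ea x))" if "x \<in> D" for x
  proof -
    obtain ext e where "\<forall>prog env. \<forall>x\<in>D. installed 0 ext prog \<longrightarrow> size (eb (f x)) \<le> poly p (size (ea x))"
      using p by blast
    moreover have "installed 0 ext ext" by (auto simp: installed_def)
    ultimately show ?thesis using that by blast
  qed
  moreover have "\<exists>ext e. \<forall>prog env. \<forall>x\<in>D. installed n ext prog \<longrightarrow>
      (\<exists>t\<le>poly p (size (ea x)). evals_to Ps prog (ea x # env) e (eb (f x)) t)" for n
  proof -
    obtain ext e where "\<forall>prog env. \<forall>x\<in>D. installed n ext prog \<longrightarrow>
     size (eb (f x)) \<le> poly p (size (ea x)) \<and>
     (\<exists>t\<le>poly p (size (ea x)). evals_to Ps prog (ea x # env) e (eb (f x)) t)"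
      using p by blast
    then show ?thesis by (intro exI[of _ ext] exI[of _ e]) blast
  qed
  ultimately show ?thesis by (rule that)
qed

lemma ptime_simple:
  fixes p :: "nat poly"
  assumes "\<And>x. x \<in> D \<Longrightarrow> size (eb (f x)) \<le> poly p (size (ea x))"
    and "\<And>x prog env. x \<in> D \<Longrightarrow> \<exists>t\<le>poly p (size (ea x)). evals_to Ps prog (ea x # env) e (eb (f x)) t"
  shows "ptime Ps ea eb D f"
  unfolding ptime_def
  by (intro exI[of _ p] allI exI[of _ "[]"] exI[of _ e]) (use assms in blast)

lemma poly_mono_nat: "m \<le> n \<Longrightarrow> poly p m \<le> poly (p :: nat poly) n"
  by (induction p) (auto intro!: add_mono mult_mono)

text \<open>Only the encodings of arguments and values matter.\<close>

lemma ptime_recode: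
  assumes "ptime Ps ea eb D f"
    and "\<And>x. x \<in> D' \<Longrightarrow> h x \<in> D \<and> ea (h x) = ea' x \<and> eb' (g x) = eb (f (h x))"
  shows "ptime Ps ea' eb' D' g"
proof -
  obtain p :: "nat poly" where p: "\<forall>n. \<exists>ext e. \<forall>prog env. \<forall>x\<in>D. installed n ext prog \<longrightarrow>
     size (eb (f x)) \<le> poly p (size (ea x)) \<and>
     (\<exists>t\<le>poly p (size (ea x)). evals_to Ps prog (ea x # env) e (eb (f x)) t)"
    using assms(1) unfolding ptime_def by blast
  show ?thesis
    unfolding ptime_def
  proof (intro exI[of _ p] allI)
    fix n
    obtain ext e where e: "\<And>prog env x. x \<in> D \<Longrightarrow> installed n ext prog \<Longrightarrow>
       size (eb (f x)) \<le> poly p (size (ea x)) \<and>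
       (\<exists>t\<le>poly p (size (ea x)). evals_to Ps prog (ea x # env) e (eb (f x)) t)"
      using p by meson
    show "\<exists>ext e. \<forall>prog env. \<forall>x\<in>D'. installed n ext prog \<longrightarrow>
       size (eb' (g x)) \<le> poly p (size (ea' x)) \<and>
       (\<exists>t\<le>poly p (size (ea' x)). evals_to Ps prog (ea' x # env) e (eb' (g x)) t)"
    proof (intro exI[of _ ext] exI[of _ e] allI ballI impI)
      fix prog env x assume "x \<in> D'" "installed n ext prog"
      then show "size (eb' (g x)) \<le> poly p (size (ea' x)) \<and>
         (\<exists>t\<le>poly p (size (ea' x)). evals_to Ps prog (ea' x # env) e (eb' (g x)) t)"
        using assms(2)[of x] e[of "h x" prog env] by simp
    qed
  qed
qed

lemma ptime_subset: "ptime Ps ea eb D f \<Longrightarrow> D' \<subseteq> D \<Longrightarrow> ptime Ps ea eb D' f"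
  by (erule ptime_recode[where h = id]) auto

lemma ptime_cong:
  "ptime Ps ea eb D f \<Longrightarrow> (\<And>x. x \<in> D \<Longrightarrow> g x = f x) \<Longrightarrow> ptime Ps ea eb D g"
  by (erule ptime_recode[where h = id]) auto

lemma eval_arg: "evals_to Ps prog (v # env) (Var 0) v 1"
  using evals_to.eval_Var[of 0 "v # env"] by simp

lemma eval_time: "evals_to Ps prog env e v s \<Longrightarrow> s \<le> t \<Longrightarrow> \<exists>t'\<le>t. evals_to Ps prog env e v t'"
  by blast

lemma ptime_id: "ptime Ps ea ea D (\<lambda>x. x)"
  by (rule ptime_simple[of _ _ _ "[:1, 1:]" _ _ "Var 0"]) (auto intro!: eval_time[OF eval_arg])

primrec quote :: "tree \<Rightarrow> exp" where
  "quote Leaf = NilE"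
| "quote (Node a b) = ConsE (quote a) (quote b)"

lemma quote_time: "evals_to Ps prog env (quote v) v (2 * size v + 1)"
proof (induction v)
  case (Node a b)
  show ?case using evals_to.eval_Cons[OF Node] by (simp add: algebra_simps)
qed (use evals_to.eval_Nil in simp)

lemma ptime_const: "ptime Ps ea eb D (\<lambda>x. c)"
  by (rule ptime_simple[of _ _ _ "[:2 * size (eb c) + 1:]" _ _ "quote (eb c)"])
    (auto intro!: exI[of _ "2 * size (eb c) + 1"] quote_time[simplified])

lemma ptime_comp:
  assumes "ptime Ps ea eb D f" "ptime Ps eb ec D' g" "\<And>x. x \<in> D \<Longrightarrow> f x \<in> D'"
  shows "ptime Ps ea ec D (\<lambda>x. g (f x))"
proof -
  obtain p :: "nat poly" where p: "\<And>x. x \<in> D \<Longrightarrow> size (eb (f x)) \<le> poly p (size (ea x))"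
    "\<And>n. \<exists>ext e. \<forall>prog env. \<forall>x\<in>D. installed n ext prog \<longrightarrow>
       (\<exists>t\<le>poly p (size (ea x)). evals_to Ps prog (ea x # env) e (eb (f x)) t)"
    using assms(1) by (rule ptimeE) blast
  obtain q :: "nat poly" where q: "\<And>x. x \<in> D' \<Longrightarrow> size (ec (g x)) \<le> poly q (size (eb x))"
    "\<And>n. \<exists>ext e. \<forall>prog env. \<forall>x\<in>D'. installed n ext prog \<longrightarrow>
       (\<exists>t\<le>poly q (size (eb x)). evals_to Ps prog (eb x # env) e (ec (g x)) t)"
    using assms(2) by (rule ptimeE) blast
  let ?r = "p + pcompose q p + [:1:]"
  have mono: "poly q (size (eb (f x))) \<le> poly q (poly p (size (ea x)))" if "x \<in> D" for x
    by (rule poly_mono_nat) (rule p(1)[OF that])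
  show ?thesis
    unfolding ptime_def
  proof (intro exI[of _ ?r] allI)
    fix n
    obtain ext1 e1 where e1: "\<And>prog env x. x\<in>D \<Longrightarrow> installed n ext1 prog \<Longrightarrow>
       (\<exists>t\<le>poly p (size (ea x)). evals_to Ps prog (ea x # env) e1 (eb (f x)) t)"
      using p(2) by meson
    obtain ext2 e2 where e2: "\<And>prog env x. x\<in>D' \<Longrightarrow> installed (n + length ext1) ext2 prog \<Longrightarrow>
       (\<exists>t\<le>poly q (size (eb x)). evals_to Ps prog (eb x # env) e2 (ec (g x)) t)"
      using q(2) by meson
    show "\<exists>ext e. \<forall>prog env. \<forall>x\<in>D. installed n ext prog \<longrightarrow>
     size (ec (g (f x))) \<le> poly ?r (size (ea x)) \<and>
     (\<exists>t\<le>poly ?r (size (ea x)). evals_to Ps prog (ea x # env) e (ec (g (f x))) t)"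
    proof (intro exI[of _ "ext1 @ ext2"] exI[of _ "LetE e1 e2"] allI ballI impI conjI)
      fix prog env x assume x: "x \<in> D" and i: "installed n (ext1 @ ext2) prog"
      show "size (ec (g (f x))) \<le> poly ?r (size (ea x))"
        using q(1)[OF assms(3)[OF x]] mono[OF x] by (simp add: poly_pcompose)
      obtain t1 where t1: "t1 \<le> poly p (size (ea x))" "evals_to Ps prog (ea x # env) e1 (eb (f x)) t1"
        using e1[OF x installed_append(1)[OF i]] by blast
      obtain t2 where t2: "t2 \<le> poly q (size (eb (f x)))"
        "evals_to Ps prog (eb (f x) # ea x # env) e2 (ec (g (f x))) t2"
        using e2[OF assms(3)[OF x] installed_append(2)[OF i]] by blast
      show "\<exists>t\<le>poly ?r (size (ea x)). evals_to Ps prog (ea x # env) (LetE e1 e2) (ec (g (f x))) t"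
        using t1(1) t2(1) mono[OF x] evals_to.eval_Let[OF t1(2) t2(2)]
        by (intro exI[of _ "t1 + t2 + 1"]) (auto simp: poly_pcompose)
    qed
  qed
qed

lemma ptime_pair:
  assumes "ptime Ps ea eb D f" "ptime Ps ea ec D g"
  shows "ptime Ps ea (enc_pair eb ec) D (\<lambda>x. (f x, g x))"
proof -
  obtain p :: "nat poly" where p: "\<And>x. x \<in> D \<Longrightarrow> size (eb (f x)) \<le> poly p (size (ea x))"
    "\<And>n. \<exists>ext e. \<forall>prog env. \<forall>x\<in>D. installed n ext prog \<longrightarrow>
       (\<exists>t\<le>poly p (size (ea x)). evals_to Ps prog (ea x # env) e (eb (f x)) t)"
    using assms(1) by (rule ptimeE) blast
  obtain q :: "nat poly" where q: "\<And>x. x \<in> D \<Longrightarrow> size (ec (g x)) \<le> poly q (size (ea x))"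
    "\<And>n. \<exists>ext e. \<forall>prog env. \<forall>x\<in>D. installed n ext prog \<longrightarrow>
       (\<exists>t\<le>poly q (size (ea x)). evals_to Ps prog (ea x # env) e (ec (g x)) t)"
    using assms(2) by (rule ptimeE) blast
  let ?r = "p + q + [:1:]"
  show ?thesis
    unfolding ptime_def
  proof (intro exI[of _ ?r] allI)
    fix n
    obtain ext1 e1 where e1: "\<And>prog env x. x\<in>D \<Longrightarrow> installed n ext1 prog \<Longrightarrow>
       (\<exists>t\<le>poly p (size (ea x)). evals_to Ps prog (ea x # env) e1 (eb (f x)) t)"
      using p(2) by meson
    obtain ext2 e2 where e2: "\<And>prog env x. x\<in>D \<Longrightarrow> installed (n + length ext1) ext2 prog \<Longrightarrow>
       (\<exists>t\<le>poly q (size (ea x)). evals_to Ps prog (ea x # env) e2 (ec (g x)) t)"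
      using q(2) by meson
    show "\<exists>ext e. \<forall>prog env. \<forall>x\<in>D. installed n ext prog \<longrightarrow>
     size (enc_pair eb ec (f x, g x)) \<le> poly ?r (size (ea x)) \<and>
     (\<exists>t\<le>poly ?r (size (ea x)). evals_to Ps prog (ea x # env) e (enc_pair eb ec (f x, g x)) t)"
    proof (intro exI[of _ "ext1 @ ext2"] exI[of _ "ConsE e1 e2"] allI ballI impI conjI)
      fix prog env x assume x: "x \<in> D" and i: "installed n (ext1 @ ext2) prog"
      show "size (enc_pair eb ec (f x, g x)) \<le> poly ?r (size (ea x))"
        using p(1)[OF x] q(1)[OF x] by simp
      obtain t1 where t1: "t1 \<le> poly p (size (ea x))" "evals_to Ps prog (ea x # env) e1 (eb (f x)) t1"
        using e1[OF x installed_append(1)[OF i]] by blast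
      obtain t2 where t2: "t2 \<le> poly q (size (ea x))" "evals_to Ps prog (ea x # env) e2 (ec (g x)) t2"
        using e2[OF x installed_append(2)[OF i]] by blast
      show "\<exists>t\<le>poly ?r (size (ea x)).
          evals_to Ps prog (ea x # env) (ConsE e1 e2) (enc_pair eb ec (f x, g x)) t"
        using t1(1) t2(1) evals_to.eval_Cons[OF t1(2) t2(2)]
        by (intro exI[of _ "t1 + t2 + 1"]) auto
    qed
  qed
qed

lemma ptime_if:
  assumes "ptime Ps ea enc_bool D b" "ptime Ps ea eb {x \<in> D. b x} f" "ptime Ps ea eb {x \<in> D. \<not> b x} g"
  shows "ptime Ps ea eb D (\<lambda>x. if b x then f x else g x)"
proof -
  obtain o' :: "nat poly" where o: "\<And>x. x \<in> D \<Longrightarrow> size (enc_bool (b x)) \<le> poly o' (size (ea x))"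
    "\<And>n. \<exists>ext e. \<forall>prog env. \<forall>x\<in>D. installed n ext prog \<longrightarrow>
       (\<exists>t\<le>poly o' (size (ea x)). evals_to Ps prog (ea x # env) e (enc_bool (b x)) t)"
    using assms(1) by (rule ptimeE) blast
  let ?D = "{x \<in> D. b x}" and ?E = "{x \<in> D. \<not> b x}"
  obtain p :: "nat poly" where p: "\<And>x. x \<in> ?D \<Longrightarrow> size (eb (f x)) \<le> poly p (size (ea x))"
    "\<And>n. \<exists>ext e. \<forall>prog env. \<forall>x\<in>?D. installed n ext prog \<longrightarrow>
       (\<exists>t\<le>poly p (size (ea x)). evals_to Ps prog (ea x # env) e (eb (f x)) t)"
    using assms(2) by (rule ptimeE) blast
  obtain q :: "nat poly" where q: "\<And>x. x \<in> ?E \<Longrightarrow> size (eb (g x)) \<le> poly q (size (ea x))"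
    "\<And>n. \<exists>ext e. \<forall>prog env. \<forall>x\<in>?E. installed n ext prog \<longrightarrow>
       (\<exists>t\<le>poly q (size (ea x)). evals_to Ps prog (ea x # env) e (eb (g x)) t)"
    using assms(3) by (rule ptimeE) blast
  let ?r = "o' + p + q + [:1:]"
  show ?thesis
    unfolding ptime_def
  proof (intro exI[of _ ?r] allI)
    fix n
    obtain ext0 e0 where e0: "\<And>prog env x. x\<in>D \<Longrightarrow> installed n ext0 prog \<Longrightarrow>
       (\<exists>t\<le>poly o' (size (ea x)). evals_to Ps prog (ea x # env) e0 (enc_bool (b x)) t)"
      using o(2) by meson
    obtain ext1 e1 where e1: "\<And>prog env x. x\<in>?D \<Longrightarrow> installed (n + length ext0) ext1 prog \<Longrightarrow>
       (\<exists>t\<le>poly p (size (ea x)). evals_to Ps prog (ea x # env) e1 (eb (f x)) t)"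
      using p(2) by meson
    obtain ext2 e2 where e2: "\<And>prog env x. x\<in>?E \<Longrightarrow> installed (n + length ext0 + length ext1) ext2 prog \<Longrightarrow>
       (\<exists>t\<le>poly q (size (ea x)). evals_to Ps prog (ea x # env) e2 (eb (g x)) t)"
      using q(2) by meson
    show "\<exists>ext e. \<forall>prog env. \<forall>x\<in>D. installed n ext prog \<longrightarrow>
     size (eb (if b x then f x else g x)) \<le> poly ?r (size (ea x)) \<and>
     (\<exists>t\<le>poly ?r (size (ea x)). evals_to Ps prog (ea x # env) e (eb (if b x then f x else g x)) t)"
    proof (intro exI[of _ "ext0 @ ext1 @ ext2"] exI[of _ "IfE e0 e1 e2"] allI ballI impI conjI)
      fix prog env x assume x: "x \<in> D" and i: "installed n (ext0 @ ext1 @ ext2) prog"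
      note i0 = installed_append(1)[OF i] and i' = installed_append(2)[OF i]
      note i1 = installed_append(1)[OF i'] and i2 = installed_append(2)[OF i']
      show "size (eb (if b x then f x else g x)) \<le> poly ?r (size (ea x))"
        using p(1)[of x] q(1)[of x] x by auto
      obtain t0 where t0: "t0 \<le> poly o' (size (ea x))" "evals_to Ps prog (ea x # env) e0 (enc_bool (b x)) t0"
        using e0[OF x i0] by blast
      show "\<exists>t\<le>poly ?r (size (ea x)).
          evals_to Ps prog (ea x # env) (IfE e0 e1 e2) (eb (if b x then f x else g x)) t"
      proof (cases "b x")
        case True
        then have "x \<in> ?D" using x by simp
        then obtain t1 where t1: "t1 \<le> poly p (size (ea x))" "evals_to Ps prog (ea x # env) e1 (eb (f x)) t1"
          using e1[OF _ i1] by blast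
        show ?thesis
          using True t0(1) t1(1) evals_to.eval_If_True[OF t0(2) _ t1(2)]
          by (intro exI[of _ "t0 + t1 + 1"]) (auto simp: enc_bool_def)
      next
        case False
        then have "x \<in> ?E" using x by simp
        then obtain t2 where t2: "t2 \<le> poly q (size (ea x))" "evals_to Ps prog (ea x # env) e2 (eb (g x)) t2"
          using e2[OF _ i2] by blast
        have "evals_to Ps prog (ea x # env) e0 Leaf t0" using t0 False by (simp add: enc_bool_def)
        then show ?thesis
          using False t0(1) t2(1) evals_to.eval_If_False[OF _ t2(2)]
          by (intro exI[of _ "t0 + t2 + 1"]) auto
      qed
    qed
  qed
qed

lemma ptime_fst: "ptime Ps (enc_pair ea eb) ea D fst"
proof (rule ptime_simple[of _ _ _ "[:2, 1:]" _ _ "HdE (Var 0)"])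
  fix x :: "'a \<times> 'b" and prog env
  show "\<exists>t\<le>poly [:2, 1:] (size (enc_pair ea eb x)).
      evals_to Ps prog (enc_pair ea eb x # env) (HdE (Var 0)) (ea (fst x)) t"
    by (cases x) (auto intro!: eval_time[OF evals_to.eval_Hd[OF eval_arg]])
qed (auto simp: enc_pair_def)

lemma ptime_snd: "ptime Ps (enc_pair ea eb) eb D snd"
proof (rule ptime_simple[of _ _ _ "[:2, 1:]" _ _ "TlE (Var 0)"])
  fix x :: "'a \<times> 'b" and prog env
  show "\<exists>t\<le>poly [:2, 1:] (size (enc_pair ea eb x)).
      evals_to Ps prog (enc_pair ea eb x # env) (TlE (Var 0)) (eb (snd x)) t"
    by (cases x) (auto intro!: eval_time[OF evals_to.eval_Tl[OF eval_arg]])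
qed (auto simp: enc_pair_def)

lemma ptime_pred: "ptime Ps enc_nat enc_nat D (\<lambda>n. n - 1)"
proof (rule ptime_simple[of _ _ _ "[:2, 1:]" _ _ "TlE (Var 0)"])
  show "size (enc_nat (n - 1)) \<le> poly [:2, 1:] (size (enc_nat n))" for n
    by (cases n) auto
  show "\<exists>t\<le>poly [:2, 1:] (size (enc_nat n)).
      evals_to Ps prog (enc_nat n # env) (TlE (Var 0)) (enc_nat (n - 1)) t" for n prog env
    by (cases n) (auto intro!: eval_time[OF evals_to.eval_Tl[OF eval_arg]]
        eval_time[OF evals_to.eval_Tl_Leaf[OF eval_arg]])
qed

lemma ptime_nonleaf: "ptime Ps (\<lambda>v. v) enc_bool D (\<lambda>v. v \<noteq> Leaf)"
proof (rule ptime_simple[of _ _ _ "[:5:]" _ _ "IfE (Var 0) (ConsE NilE NilE) NilE"])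
  fix v :: tree and prog env
  note true = evals_to.eval_Cons[OF evals_to.eval_Nil evals_to.eval_Nil]
  show "\<exists>t\<le>poly [:5:] (size v). evals_to Ps prog (v # env) (IfE (Var 0) (ConsE NilE NilE) NilE) (enc_bool (v \<noteq> Leaf)) t"
    by (cases "v = Leaf") (auto simp: enc_bool_def
        intro!: eval_time[OF evals_to.eval_If_False[OF eval_arg evals_to.eval_Nil]]
        eval_time[OF evals_to.eval_If_True[OF eval_arg _ true]])
qed (simp add: enc_bool_def)

text \<open>A subroutine call costs the size of its argument, and its answer has constant size.\<close>

lemma ptime_query:
  assumes "i < length Ps"
    and "\<And>x. x \<in> D \<Longrightarrow> b x \<Longrightarrow> ea x \<in> yes (Ps ! i)"
    and "\<And>x. x \<in> D \<Longrightarrow> \<not> b x \<Longrightarrow> ea x \<in> no (Ps ! i)"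
  shows "ptime Ps ea enc_bool D b"
proof (rule ptime_simple[of _ _ _ "[:2, 1:]" _ _ "Query i (Var 0)"])
  fix x prog env assume x: "x \<in> D"
  show "\<exists>t\<le>poly [:2, 1:] (size (ea x)). evals_to Ps prog (ea x # env) (Query i (Var 0)) (enc_bool (b x)) t"
    using eval_time[OF evals_to.eval_Query_yes[OF assms(1) eval_arg assms(2)[OF x]]]
      eval_time[OF evals_to.eval_Query_no[OF assms(1) eval_arg assms(3)[OF x]]]
    by (cases "b x") (simp_all add: enc_bool_def)
qed (simp add: enc_bool_def)

text \<open>
  The loop. The intermediate results must have polynomial size, since each iteration may by itself
  square the size of the accumulator.
\<close>

lemma ptime_foldl_tuple:
  fixes q :: "nat poly"
  assumes f: "ptime Ps (enc_pair ec (enc_pair ea ex)) ea Df (\<lambda>(c, a, x). f c a x)"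
    and dom: "\<And>c a ys x zs. (c, a, ys @ x # zs) \<in> D \<Longrightarrow> (c, foldl (f c) a ys, x) \<in> Df"
    and bound: "\<And>c a ys zs. (c, a, ys @ zs) \<in> D \<Longrightarrow>
      size (ea (foldl (f c) a ys)) \<le> poly q (size (enc_pair ec (enc_pair ea (enc_list ex)) (c, a, ys @ zs)))"
  shows "ptime Ps (enc_pair ec (enc_pair ea (enc_list ex))) ea D (\<lambda>(c, a, xs). foldl (f c) a xs)"
proof -
  let ?ei = "enc_pair ec (enc_pair ea (enc_list ex))" and ?es = "enc_pair ec (enc_pair ea ex)"
  obtain p :: "nat poly" where p: "\<And>n. \<exists>ext e. \<forall>prog env. \<forall>y\<in>Df. installed n ext prog \<longrightarrow>
       (\<exists>t\<le>poly p (size (?es y)). evals_to Ps prog (?es y # env) e (ea (case y of (c, a, x) \<Rightarrow> f c a x)) t)"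
    using f by (rule ptimeE) blast
  \<comment> \<open>a bound for the size of the arguments of the loop body\<close>
  define B where "B = [:2, 1:] + q"
  define r where "r = q + [:12, 1:] * ([:40:] + pcompose p B) + [:40:]"
  have len: "length xs \<le> size (enc_list ex xs)" for xs by (induction xs) auto
  have elem: "size (ex x) \<le> size (enc_list ex xs)" if "x \<in> set xs" for x xs
    using that by (induction xs) auto
  show ?thesis
    unfolding ptime_def
  proof (intro exI[of _ r] allI)
    fix n
    obtain ext e where e: "\<And>prog env y. y\<in>Df \<Longrightarrow> installed (Suc n) ext prog \<Longrightarrow>
       (\<exists>t\<le>poly p (size (?es y)). evals_to Ps prog (?es y # env) e (ea (case y of (c, a, x) \<Rightarrow> f c a x)) t)"
      using p by meson
    define body where "body =
      IfE (TlE (TlE (Var 0)))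
       (Call n (ConsE (HdE (Var 0)) (ConsE
         (LetE (ConsE (HdE (Var 0)) (ConsE (HdE (TlE (Var 0))) (HdE (TlE (TlE (Var 0)))))) e)
         (TlE (TlE (TlE (Var 0)))))))
       (HdE (TlE (Var 0)))"
    show "\<exists>ext e. \<forall>prog env. \<forall>y\<in>D. installed n ext prog \<longrightarrow>
       size (ea (case y of (c, a, xs) \<Rightarrow> foldl (f c) a xs)) \<le> poly r (size (?ei y)) \<and>
       (\<exists>t\<le>poly r (size (?ei y)). evals_to Ps prog (?ei y # env) e (ea (case y of (c, a, xs) \<Rightarrow> foldl (f c) a xs)) t)"
    proof (intro exI[of _ "body # ext"] exI[of _ "Call n (Var 0)"] allI ballI impI)
      fix prog env y assume y: "y \<in> D" and i: "installed n (body # ext) prog"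
      obtain c a xs where y_eq: "y = (c, a, xs)" by (cases y)
      define S where "S = size (?ei y)"
      define T where "T = poly p (poly B S)"
      note prog = installed_Cons[OF i]
      have loop: "\<exists>t\<le>length zs * (T + 40) + 10.
          evals_to Ps prog [Node (ec c) (Node (ea (foldl (f c) a ys)) (enc_list ex zs))] body
            (ea (foldl (f c) a xs)) t" if "xs = ys @ zs" for ys zs
        using that
      proof (induction zs arbitrary: ys)
        case Nil
        note t1 = evals_to.eval_Tl[OF eval_arg[of Ps prog "Node (ec c) (Node (ea (foldl (f c) a ys)) Leaf)" "[]"]]
        note t2 = evals_to.eval_If_False[OF evals_to.eval_Tl[OF t1] evals_to.eval_Hd[OF t1]]
        show ?case
          unfolding body_def using eval_time[OF t2] Nil by simp
      next
        case (Cons x zs)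
        let ?a = "foldl (f c) a ys"
        let ?env = "[Node (ec c) (Node (ea ?a) (Node (ex x) (enc_list ex zs)))]"
        note v = eval_arg[of Ps prog "Node (ec c) (Node (ea ?a) (Node (ex x) (enc_list ex zs)))" "[]"]
        note t1 = evals_to.eval_Tl[OF v]
        note t2 = evals_to.eval_Tl[OF t1]
        have "(c, ?a, x) \<in> Df" using dom y y_eq Cons.prems by simp
        then obtain t where t: "t \<le> poly p (size (?es (c, ?a, x)))"
          "evals_to Ps prog (?es (c, ?a, x) # ?env) e (ea (f c ?a x)) t"
          using e[OF _ prog(3)] by fastforce
        have "size (ea ?a) \<le> poly q S"
          using bound[of c a ys "x # zs"] y y_eq Cons.prems by (simp add: S_def)
        moreover have "size (ec c) + size (ex x) + 1 \<le> S"
          using elem[of x xs] Cons.prems unfolding S_def y_eq by simp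
        ultimately have "size (?es (c, ?a, x)) \<le> poly B S" by (simp add: B_def)
        then have tT: "t \<le> T" unfolding T_def using t(1) poly_mono_nat le_trans by blast
        have IH: "\<exists>t\<le>length zs * (T + 40) + 10.
          evals_to Ps prog [Node (ec c) (Node (ea (f c ?a x)) (enc_list ex zs))] body
            (ea (foldl (f c) a xs)) t" using Cons.IH[of "ys @ [x]"] Cons.prems by simp
        then obtain t' where t': "t' \<le> length zs * (T + 40) + 10"
          "evals_to Ps prog [Node (ec c) (Node (ea (f c ?a x)) (enc_list ex zs))] (prog ! n)
            (ea (foldl (f c) a xs)) t'" unfolding prog(2) by blast
        note arg = evals_to.eval_Cons[OF evals_to.eval_Hd[OF v]
          evals_to.eval_Cons[OF evals_to.eval_Hd[OF t1] evals_to.eval_Hd[OF t2]]]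
        note step = evals_to.eval_Let[OF arg t(2)[unfolded enc_pair_simp]]
        note call = evals_to.eval_Call[OF prog(1) evals_to.eval_Cons[OF evals_to.eval_Hd[OF v]
          evals_to.eval_Cons[OF step evals_to.eval_Tl[OF t2]]] t'(2)]
        note total = evals_to.eval_If_True[OF t2 tree.distinct(2) call]
        show ?case
          unfolding enc_list.simps body_def
          by (rule exI, rule conjI[OF _ total]) (use tT t'(1) in simp)
      qed
      obtain t where t: "t \<le> length xs * (T + 40) + 10"
        "evals_to Ps prog [?ei y] (prog ! n) (ea (foldl (f c) a xs)) t"
        using loop[of "[]" xs] unfolding prog(2) by (auto simp: y_eq)
      have "length xs \<le> S" using len[of xs] unfolding S_def y_eq by simp
      then have "length xs * (T + 40) \<le> S * (T + 40)" by simp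
      then have "1 + t + 1 \<le> poly r S"
        using t(1) by (simp add: r_def T_def poly_pcompose algebra_simps)
      moreover have "size (ea (foldl (f c) a xs)) \<le> poly r S"
        using bound[of c a xs "[]"] y unfolding y_eq S_def by (simp add: r_def)
      ultimately show "size (ea (case y of (c, a, xs) \<Rightarrow> foldl (f c) a xs)) \<le> poly r (size (?ei y)) \<and>
          (\<exists>t\<le>poly r (size (?ei y)). evals_to Ps prog (?ei y # env) (Call n (Var 0))
            (ea (case y of (c, a, xs) \<Rightarrow> foldl (f c) a xs)) t)"
        using evals_to.eval_Call[OF prog(1) eval_arg t(2)] unfolding S_def y_eq by auto
    qed
  qed
qed

lemma ptime_foldl:
  fixes q :: "nat poly"
  assumes a: "ptime Ps ez ea D a" and xs: "ptime Ps ez (enc_list ex) D xs"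
    and f: "ptime Ps (enc_pair ez (enc_pair ea ex)) ea Df (\<lambda>y. f (fst y) (fst (snd y)) (snd (snd y)))"
    and dom: "\<And>z ys x zs. z \<in> D \<Longrightarrow> xs z = ys @ x # zs \<Longrightarrow> (z, foldl (f z) (a z) ys, x) \<in> Df"
    and bound: "\<And>z ys zs. z \<in> D \<Longrightarrow> xs z = ys @ zs \<Longrightarrow> size (ea (foldl (f z) (a z) ys)) \<le> poly q (size (ez z))"
  shows "ptime Ps ez ea D (\<lambda>z. foldl (f z) (a z) (xs z))"
proof -
  let ?t = "\<lambda>z. (z, a z, xs z)"
  have f': "ptime Ps (enc_pair ez (enc_pair ea ex)) ea Df (\<lambda>(z, b, x). f z b x)"
    using f by (simp add: case_prod_unfold)
  have "ptime Ps (enc_pair ez (enc_pair ea (enc_list ex))) ea (?t ` D) (\<lambda>(c, a, xs). foldl (f c) a xs)"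
  proof (rule ptime_foldl_tuple[OF f'])
    fix c b ys zs assume "(c, b, ys @ zs) \<in> ?t ` D"
    then have "c \<in> D" "xs c = ys @ zs" "b = a c" by auto
    then have "size (ea (foldl (f c) b ys)) \<le> poly q (size (ez c))" using bound by blast
    also have "\<dots> \<le> poly q (size (enc_pair ez (enc_pair ea (enc_list ex)) (c, b, ys @ zs)))"
      by (rule poly_mono_nat) simp
    finally show "size (ea (foldl (f c) b ys))
      \<le> poly q (size (enc_pair ez (enc_pair ea (enc_list ex)) (c, b, ys @ zs)))" .
  next
    fix c b ys x zs assume "(c, b, ys @ x # zs) \<in> ?t ` D"
    then have "c \<in> D" "xs c = ys @ x # zs" "b = a c" by auto
    then show "(c, foldl (f c) b ys, x) \<in> Df" using dom[of c ys x zs] by simp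
  qed
  from ptime_comp[OF ptime_pair[OF ptime_id ptime_pair[OF a xs]] this]
  show ?thesis by simp
qed

lemma ptime_eq_tree: "ptime Ps (\<lambda>v. v) enc_bool UNIV (\<lambda>v. v = w)"
proof (induction w)
  case Leaf
  have "ptime Ps (\<lambda>v. v) enc_bool UNIV (\<lambda>v. if v \<noteq> Leaf then False else True)"
    by (intro ptime_if ptime_nonleaf ptime_const)
  then show ?case by (rule ptime_cong) auto
next
  case (Node a b)
  let ?N = "{v. v \<noteq> Leaf}" and ?split = "\<lambda>v. case v of Node l r \<Rightarrow> (l, r)"
  have "ptime Ps (enc_pair (\<lambda>v. v) (\<lambda>v. v)) enc_bool UNIV (\<lambda>x. if fst x = a then snd x = b else False)"
    by (intro ptime_if ptime_const ptime_comp[OF ptime_fst Node(1)] ptime_comp[OF ptime_snd Node(2)]) auto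
  then have "ptime Ps (\<lambda>v. v) enc_bool ?N (\<lambda>v. v = Node a b)"
    by (rule ptime_recode[where h = ?split]) (auto split: tree.split)
  then have "ptime Ps (\<lambda>v. v) enc_bool UNIV (\<lambda>v. if v \<noteq> Leaf then v = Node a b else False)"
    by (intro ptime_if ptime_nonleaf ptime_const) auto
  then show ?case by (rule ptime_cong) auto
qed

text \<open>
  Finite tables are programs: the argument is compared with the encoding of each element of the
  domain.
\<close>

lemma ptime_finite:
  assumes "finite D" "inj_on ea D"
  shows "ptime Ps ea eb D f"
  using assms
proof (induction D rule: finite_induct)
  case empty
  show ?case by (rule ptime_simple[of _ _ _ 0 _ _ NilE]) auto
next
  case (insert x D)
  then have IH: "ptime Ps ea eb D f" by simp
  have test: "ptime Ps ea enc_bool (insert x D) (\<lambda>y. ea y = ea x)"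
    by (rule ptime_recode[OF ptime_eq_tree[of _ "ea x"], where h = ea]) auto
  have "ptime Ps ea eb (insert x D) (\<lambda>y. if ea y = ea x then f x else f y)"
    by (intro ptime_if test ptime_const ptime_subset[OF IH]) (use insert in auto)
  then show ?case by (rule ptime_cong) (use inj_on_eq_iff[OF insert.prems] in auto)
qed

text \<open>
  The entry point of a program is its function at position \<open>0\<close>, so the auxiliary functions are
  placed from position \<open>1\<close> on.
\<close>

lemma ptime_imp_cook_reducible:
  assumes "ptime Ps ea eb D f" "yes A \<union> no A \<subseteq> ea ` D"
    and "\<And>x. x \<in> D \<Longrightarrow> eb (f x) \<noteq> Leaf \<longleftrightarrow> ea x \<in> yes A"
  shows "cook_reducible A Ps"
proof -
  obtain p :: "nat poly" and ext e where e: "\<And>prog env x. x \<in> D \<Longrightarrow> installed 1 ext prog \<Longrightarrow>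
     \<exists>t\<le>poly p (size (ea x)). evals_to Ps prog (ea x # env) e (eb (f x)) t"
    using assms(1) unfolding ptime_def by meson
  have i: "installed 1 ext (e # ext)"
    unfolding installed_def by (intro exI[of _ "[e]"] exI[of _ "[]"]) simp
  show ?thesis
    unfolding cook_reducible_def
  proof (intro exI[of _ "e # ext"] exI[of _ p] conjI ballI)
    fix v assume "v \<in> yes A \<union> no A"
    then obtain x where x: "x \<in> D" "v = ea x" using assms(2) by blast
    then show "\<exists>u t. evals_to Ps (e # ext) [v] ((e # ext) ! 0) u t \<and> t \<le> poly p (size v) \<and>
        (u \<noteq> Leaf \<longleftrightarrow> v \<in> yes A)"
      using e[OF x(1) i, of "[]"] assms(3)[OF x(1)] by auto
  qed simp
qed

section \<open>Arithmetic and lists in polynomial time\<close>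

lemma size_enc_nat [simp]: "size (enc_nat n) = n"
  by (induction n) auto

lemma enc_nat_eq_Leaf [simp]: "enc_nat n = Leaf \<longleftrightarrow> n = 0"
  by (cases n) auto

lemma enc_nat_conv_units: "enc_nat n = enc_list enc_unit (replicate n ())"
  by (induction n) (auto simp: enc_unit_def)

lemma size_enc_list_append [simp]:
  "size (enc_list e (xs @ ys)) = size (enc_list e xs) + size (enc_list e ys)"
  by (induction xs) auto

lemma size_enc_list_rev [simp]: "size (enc_list e (rev xs)) = size (enc_list e xs)"
  by (induction xs) auto

lemma length_le_size: "length xs \<le> size (enc_list e xs)"
  by (induction xs) auto

lemma elem_size: "x \<in> set xs \<Longrightarrow> size (e x) < size (enc_list e xs)"
  by (induction xs) auto

lemma ptime_Suc:
  assumes "ptime Ps ea enc_nat D f"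
  shows "ptime Ps ea enc_nat D (\<lambda>x. Suc (f x))"
  using ptime_pair[OF ptime_const[of _ _ enc_unit _ "()"] assms]
  by (rule ptime_recode[where h = id]) (auto simp: enc_unit_def)

lemma ptime_Cons:
  assumes "ptime Ps ea eb D f" "ptime Ps ea (enc_list eb) D g"
  shows "ptime Ps ea (enc_list eb) D (\<lambda>x. f x # g x)"
  using ptime_pair[OF assms] by (rule ptime_recode[where h = id]) auto

lemma ptime_nat_as_list:
  "ptime Ps ea enc_nat D f \<Longrightarrow> ptime Ps ea (enc_list enc_unit) D (\<lambda>x. replicate (f x) ())"
  by (erule ptime_recode[where h = id]) (auto simp: enc_nat_conv_units)

lemma ptime_diff:
  assumes "ptime Ps ez enc_nat D f" "ptime Ps ez enc_nat D g"
  shows "ptime Ps ez enc_nat D (\<lambda>z. f z - g z)"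
proof -
  have foldl: "foldl (\<lambda>n _. n - 1) m xs = m - length xs" for m :: nat and xs :: "unit list"
    by (induction xs arbitrary: m) auto
  obtain p :: "nat poly" where p: "\<And>z. z \<in> D \<Longrightarrow> size (enc_nat (f z)) \<le> poly p (size (ez z))"
    using assms(1) by (rule ptimeE) blast
  have "ptime Ps (enc_pair ez (enc_pair enc_nat enc_unit)) enc_nat UNIV (\<lambda>y. fst (snd y) - 1)"
    by (rule ptime_comp[OF ptime_comp[OF ptime_snd ptime_fst] ptime_pred]) auto
  moreover have "size (enc_nat (foldl (\<lambda>n _. n - 1) (f z) ys)) \<le> poly p (size (ez z))" if "z \<in> D" for z and ys :: "unit list"
    using p[OF that] by (simp only: foldl size_enc_nat)
  ultimately have "ptime Ps ez enc_nat D (\<lambda>z. foldl (\<lambda>n _. n - 1) (f z) (replicate (g z) ()))"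
    by (intro ptime_foldl[OF assms(1) ptime_nat_as_list[OF assms(2)]]) auto
  then show ?thesis by (simp only: foldl length_replicate)
qed

lemma ptime_eq_nat:
  assumes "ptime Ps ez enc_nat D f" "ptime Ps ez enc_nat D g"
  shows "ptime Ps ez enc_bool D (\<lambda>z. f z = g z)"
proof -
  have pos: "ptime Ps enc_nat enc_bool UNIV (\<lambda>n. n \<noteq> 0)"
    by (rule ptime_recode[OF ptime_nonleaf[of _ UNIV], where h = enc_nat])
      (auto simp: enc_bool_def)
  have "ptime Ps ez enc_bool D (\<lambda>z. if f z - g z \<noteq> 0 then False else if g z - f z \<noteq> 0 then False else True)"
    by (intro ptime_if ptime_const ptime_comp[OF _ pos] ptime_diff
        assms[THEN ptime_subset]) auto
  then show ?thesis by (rule ptime_cong) auto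
qed

lemma ptime_rev:
  assumes "ptime Ps ez (enc_list ex) D f"
  shows "ptime Ps ez (enc_list ex) D (\<lambda>z. rev (f z))"
proof -
  have foldl: "foldl (\<lambda>a x. x # a) ys xs = rev xs @ ys" for xs ys :: "'b list"
    by (induction xs arbitrary: ys) auto
  obtain p :: "nat poly" where p: "\<And>z. z \<in> D \<Longrightarrow> size (enc_list ex (f z)) \<le> poly p (size (ez z))"
    using assms by (rule ptimeE) blast
  have step: "ptime Ps (enc_pair ez (enc_pair (enc_list ex) ex)) (enc_list ex) UNIV
      (\<lambda>y. snd (snd y) # fst (snd y))"
    by (rule ptime_Cons; rule ptime_comp[OF ptime_snd]; (rule ptime_snd ptime_fst)?) auto
  have "size (enc_list ex (foldl (\<lambda>a x. x # a) [] ys)) \<le> poly p (size (ez z))"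
    if "z \<in> D" "f z = ys @ zs" for z ys zs using p[OF that(1)] that(2) by (simp add: foldl)
  from ptime_foldl[OF ptime_const assms step _ this]
  show ?thesis by (simp add: foldl)
qed

lemma ptime_append:
  assumes "ptime Ps ez (enc_list ex) D f" "ptime Ps ez (enc_list ex) D g"
  shows "ptime Ps ez (enc_list ex) D (\<lambda>z. f z @ g z)"
proof -
  have foldl: "foldl (\<lambda>a x. x # a) ys xs = rev xs @ ys" for xs ys :: "'b list"
    by (induction xs arbitrary: ys) auto
  obtain p :: "nat poly" where p: "\<And>z. z \<in> D \<Longrightarrow> size (enc_list ex (f z)) \<le> poly p (size (ez z))"
    using assms(1) by (rule ptimeE) blast
  obtain q :: "nat poly" where q: "\<And>z. z \<in> D \<Longrightarrow> size (enc_list ex (g z)) \<le> poly q (size (ez z))"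
    using assms(2) by (rule ptimeE) blast
  have step: "ptime Ps (enc_pair ez (enc_pair (enc_list ex) ex)) (enc_list ex) UNIV
      (\<lambda>y. snd (snd y) # fst (snd y))"
    by (rule ptime_Cons; rule ptime_comp[OF ptime_snd]; (rule ptime_snd ptime_fst)?) auto
  have "size (enc_list ex (foldl (\<lambda>a x. x # a) (g z) ys)) \<le> poly (p + q) (size (ez z))"
    if "z \<in> D" "rev (f z) = ys @ zs" for z ys zs
  proof -
    have "size (enc_list ex ys) \<le> size (enc_list ex (rev (f z)))" unfolding that(2) by simp
    then show ?thesis using p[OF that(1)] q[OF that(1)] by (simp add: foldl)
  qed
  from ptime_foldl[OF assms(2) ptime_rev[OF assms(1)] step _ this]
  show ?thesis by (simp add: foldl)
qed

text \<open>List comprehension, with the whole argument \<open>z\<close> available to the inner expression.\<close>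

lemma ptime_concat_map:
  assumes xs: "ptime Ps ez (enc_list ex) D xs"
    and f: "ptime Ps (enc_pair ez ex) (enc_list ey) {y. fst y \<in> D \<and> snd y \<in> set (xs (fst y))}
      (\<lambda>y. f (fst y) (snd y))"
  shows "ptime Ps ez (enc_list ey) D (\<lambda>z. concat (map (f z) (xs z)))"
proof -
  have foldl: "foldl (\<lambda>a x. a @ f z x) ys l = ys @ concat (map (f z) l)" for z ys l
    by (induction l arbitrary: ys) auto
  let ?Df = "{(z, a, x). z \<in> D \<and> x \<in> set (xs z)}"
  obtain p :: "nat poly" where p: "\<And>z. z \<in> D \<Longrightarrow> size (enc_list ex (xs z)) \<le> poly p (size (ez z))"
    using xs by (rule ptimeE) blast
  obtain q :: "nat poly" where q: "\<And>z x. z \<in> D \<Longrightarrow> x \<in> set (xs z) \<Longrightarrow>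
      size (enc_list ey (f z x)) \<le> poly q (size (ez z) + size (ex x) + 1)"
    using f by (rule ptimeE) fastforce
  have step: "ptime Ps (enc_pair ez (enc_pair (enc_list ey) ex)) (enc_list ey) ?Df
      (\<lambda>p. fst (snd p) @ f (fst p) (snd (snd p)))"
  proof (rule ptime_append)
    show "ptime Ps (enc_pair ez (enc_pair (enc_list ey) ex)) (enc_list ey) ?Df (\<lambda>p. fst (snd p))"
      by (rule ptime_comp[OF ptime_snd ptime_fst]) auto
    have "ptime Ps (enc_pair ez (enc_pair (enc_list ey) ex)) (enc_pair ez ex) ?Df (\<lambda>p. (fst p, snd (snd p)))"
      by (intro ptime_pair ptime_fst ptime_comp[OF ptime_snd ptime_snd]) auto
    from ptime_comp[OF this f]
    show "ptime Ps (enc_pair ez (enc_pair (enc_list ey) ex)) (enc_list ey) ?Df (\<lambda>p. f (fst p) (snd (snd p)))"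
      by auto
  qed
  have bound: "size (enc_list ey (foldl (\<lambda>a x. a @ f z x) [] ys)) \<le> poly (p * pcompose q ([:1, 1:] + p)) (size (ez z))"
    if z: "z \<in> D" "xs z = ys @ zs" for z ys zs
  proof -
    let ?b = "poly q (size (ez z) + poly p (size (ez z)) + 1)"
    have x: "size (enc_list ey (f z x)) \<le> ?b" if "x \<in> set ys" for x
    proof -
      have x: "x \<in> set (xs z)" using that z by simp
      have "size (ex x) \<le> poly p (size (ez z))" using elem_size[OF x, of ex] p[OF z(1)] by simp
      then show ?thesis
        using q[OF z(1) x] poly_mono_nat[of "size (ez z) + size (ex x) + 1" "size (ez z) + poly p (size (ez z)) + 1" q]
        by simp
    qed
    have "size (enc_list ey (concat (map (f z) ys))) \<le> length ys * ?b"
      using x by (induction ys) force+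
    also have "length ys \<le> poly p (size (ez z))"
      using p[OF z(1)] length_le_size[of "xs z" ex] z(2) by simp
    finally show ?thesis by (simp add: foldl poly_pcompose algebra_simps)
  qed
  from ptime_foldl[OF ptime_const xs step _ bound]
  show ?thesis by (simp add: foldl)
qed

lemma ptime_map:
  assumes xs: "ptime Ps ez (enc_list ex) D xs"
    and f: "ptime Ps (enc_pair ez ex) ey {y. fst y \<in> D \<and> snd y \<in> set (xs (fst y))} (\<lambda>y. f (fst y) (snd y))"
  shows "ptime Ps ez (enc_list ey) D (\<lambda>z. map (f z) (xs z))"
proof -
  have "concat (map (\<lambda>x. [f z x]) l) = map (f z) l" for z l
    by (induction l) auto
  then show ?thesis
    using ptime_concat_map[OF xs ptime_Cons[OF f ptime_const[of _ _ _ _ "[]"]]] by simp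
qed

lemma ptime_fstI: "ptime Ps ez (enc_pair ea eb) D f \<Longrightarrow> ptime Ps ez ea D (\<lambda>z. fst (f z))"
  by (rule ptime_comp[OF _ ptime_fst[of _ _ _ UNIV]]) auto

lemma ptime_sndI: "ptime Ps ez (enc_pair ea eb) D f \<Longrightarrow> ptime Ps ez eb D (\<lambda>z. snd (f z))"
  by (rule ptime_comp[OF _ ptime_snd[of _ _ _ UNIV]]) auto

lemma ptime_disj:
  assumes "ptime Ps ez enc_bool D f" "ptime Ps ez enc_bool D g"
  shows "ptime Ps ez enc_bool D (\<lambda>z. f z \<or> g z)"
proof -
  have "ptime Ps ez enc_bool D (\<lambda>z. if f z then True else g z)"
    by (intro ptime_if assms(1) ptime_const ptime_subset[OF assms(2)]) auto
  then show ?thesis by (rule ptime_cong) auto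
qed

lemma ptime_upt:
  assumes "ptime Ps ez enc_nat D f"
  shows "ptime Ps ez (enc_list enc_nat) D (\<lambda>z. rev [0..<f z])"
proof -
  let ?h = "\<lambda>a (_ :: unit). (Suc (fst a), fst a # snd a)"
  have foldl: "foldl ?h (0, []) us = (length us, rev [0..<length us])" for us
    by (induction us rule: rev_induct) auto
  obtain p :: "nat poly" where p: "\<And>z. z \<in> D \<Longrightarrow> size (enc_nat (f z)) \<le> poly p (size (ez z))"
    using assms by (rule ptimeE) blast
  have size: "size (enc_list enc_nat [0..<k]) \<le> k * k" for k
    by (induction k) auto
  have step: "ptime Ps (enc_pair ez (enc_pair (enc_pair enc_nat (enc_list enc_nat)) enc_unit))
      (enc_pair enc_nat (enc_list enc_nat)) UNIV (\<lambda>y. ?h (fst (snd y)) (snd (snd y)))"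
    by (intro ptime_pair ptime_Suc ptime_Cons ptime_comp[OF ptime_snd ptime_fst]
        ptime_comp[OF ptime_comp[OF ptime_snd ptime_fst], OF _ ptime_fst]
        ptime_comp[OF ptime_comp[OF ptime_snd ptime_fst], OF _ ptime_snd]) auto
  have bound: "size (enc_pair enc_nat (enc_list enc_nat) (foldl ?h (0, []) ys)) \<le> poly (p * p + p + [:1:]) (size (ez z))"
    if "z \<in> D" "replicate (f z) () = ys @ zs" for z ys zs
  proof -
    have "length ys \<le> poly p (size (ez z))"
      using p[OF that(1)] arg_cong[OF that(2), of length] by simp
    then have "length ys * length ys \<le> poly p (size (ez z)) * poly p (size (ez z))" by (intro mult_mono) auto
    then show ?thesis using size[of "length ys"] \<open>length ys \<le> _\<close> by (simp add: foldl)
  qed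
  have "ptime Ps ez (enc_pair enc_nat (enc_list enc_nat)) D (\<lambda>z. foldl ?h (0, []) (replicate (f z) ()))"
    by (rule ptime_foldl[OF ptime_const ptime_nat_as_list[OF assms] step _ bound]) auto
  from ptime_comp[OF this ptime_snd[where D = UNIV]] show ?thesis by (simp add: foldl)
qed

section \<open>Values of runs\<close>

definition label_val :: "('a, 'm) monoid_scheme \<Rightarrow> 'a list \<Rightarrow> letter option \<Rightarrow> 'a" where
  "label_val K gs l = (case l of None \<Rightarrow> \<one>\<^bsub>K\<^esub> | Some x \<Rightarrow> letter_val K gs x)"

lemma label_val_simps [simp]:
  "label_val K gs None = \<one>\<^bsub>K\<^esub>"
  "label_val K gs (Some x) = letter_val K gs x"
  by (simp_all add: label_val_def)

definition wf_label :: "nat \<Rightarrow> letter option \<Rightarrow> bool" where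
  "wf_label m l \<longleftrightarrow> (\<forall>x. l = Some x \<longrightarrow> letter_index x < m)"

inductive reach ::
  "('a, 'm) monoid_scheme \<Rightarrow> ('l \<Rightarrow> 'a) \<Rightarrow> (nat \<times> 'l \<times> nat) set \<Rightarrow> nat \<Rightarrow> 'a \<Rightarrow> nat \<Rightarrow> bool"
  for K val T where
  reach_refl: "reach K val T p \<one>\<^bsub>K\<^esub> p"
| reach_step: "(p, l, q) \<in> T \<Longrightarrow> reach K val T q g r \<Longrightarrow> reach K val T p (val l \<otimes>\<^bsub>K\<^esub> g) r"

lemma reach_mono: "reach K val T p g q \<Longrightarrow> T \<subseteq> T' \<Longrightarrow> reach K val T' p g q"
  by (induction rule: reach.induct) (auto intro: reach.intros)

lemma reach_verts:
  "reach K val T p g q \<Longrightarrow> (\<And>p l q. (p, l, q) \<in> T \<Longrightarrow> q < N) \<Longrightarrow> p < (N :: nat) \<Longrightarrow> q < N"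
  by (induction rule: reach.induct) auto

lemma reach_trancl:
  assumes "reach K val T p g q" "p \<noteq> q \<or> g \<noteq> \<one>\<^bsub>K\<^esub>"
  shows "(p, q) \<in> {(p, q). \<exists>l. (p, l, q) \<in> T}\<^sup>+"
proof -
  have "(q, r) \<in> {(p, q). \<exists>l. (p, l, q) \<in> T}\<^sup>*" if "reach K val T q g r" for q g r
    using that by (induction rule: reach.induct) (auto intro: converse_rtrancl_into_rtrancl)
  with assms show ?thesis
    by (cases rule: reach.cases) (auto intro: rtrancl_into_trancl2)
qed

context group
begin

lemma letter_val_closed:
  "set gs \<subseteq> carrier G \<Longrightarrow> letter_index x < length gs \<Longrightarrow> letter_val G gs x \<in> carrier G"
  by (cases x) (auto dest: nth_mem)

lemma label_val_closed:
  "set gs \<subseteq> carrier G \<Longrightarrow> wf_label (length gs) l \<Longrightarrow> label_val G gs l \<in> carrier G"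
  by (auto simp: label_val_def wf_label_def letter_val_closed split: option.split)

lemma word_val_closed:
  "set gs \<subseteq> carrier G \<Longrightarrow> wf_word (length gs) w \<Longrightarrow> word_val G gs w \<in> carrier G"
  by (induction w) (auto simp: wf_word_def letter_val_closed)

lemma word_val_append:
  "set gs \<subseteq> carrier G \<Longrightarrow> wf_word (length gs) u \<Longrightarrow> wf_word (length gs) w \<Longrightarrow>
    word_val G gs (u @ w) = word_val G gs u \<otimes> word_val G gs w"
proof (induction u)
  case (Cons x u)
  then show ?case
    using letter_val_closed[of gs x] word_val_closed[of gs u] word_val_closed[of gs w]
    by (simp add: wf_word_def m_assoc)
qed (simp add: word_val_closed)

lemma reach_closed:
  "reach G val T p g q \<Longrightarrow> (\<And>p l q. (p, l, q) \<in> T \<Longrightarrow> val l \<in> carrier G) \<Longrightarrow> g \<in> carrier G"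
  by (induction rule: reach.induct) auto

lemma reach_trans:
  assumes "reach G val T p g q" "reach G val T q h r" "\<And>p l q. (p, l, q) \<in> T \<Longrightarrow> val l \<in> carrier G"
  shows "reach G val T p (g \<otimes> h) r"
  using assms
proof (induction rule: reach.induct)
  case (reach_refl p)
  then show ?case using reach_closed[OF reach_refl(1)] by simp
next
  case (reach_step p l q g r')
  have "reach G val T p (val l \<otimes> (g \<otimes> h)) r"
    using reach_step by (intro reach.reach_step) auto
  then show ?case
    using reach_step reach_closed[OF reach_step(2)] reach_closed[OF reach_step.prems(1)]
    by (simp add: m_assoc)
qed

lemma reach_edge:
  assumes "(p, l, q) \<in> T" "val l \<in> carrier G"
  shows "reach G val T p (val l) q"
  using reach.reach_step[OF assms(1) reach.reach_refl, of G val] assms(2) by simp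

text \<open>
  The common argument for two facts: with \<open>h\<close> the map of a factor into the amalgam, a run of the factor
  is a run of the amalgam; with \<open>h\<close> the identity, shortcuts do not change the values of runs.
\<close>

lemma reach_simulate:
  assumes "group K" "h \<in> hom G K"
    and "\<And>p l q. (p, l, q) \<in> T \<Longrightarrow> val l \<in> carrier G \<and> reach K val' T' p (h (val l)) q"
    and "\<And>p l q. (p, l, q) \<in> T' \<Longrightarrow> val' l \<in> carrier K"
    and "reach G val T p g q"
  shows "reach K val' T' p (h g) q"
  using assms(5)
proof (induction rule: reach.induct)
  case (reach_refl p)
  show ?case
    using reach.reach_refl[of K val' T' p] hom_one[OF assms(2) is_group assms(1)] by simp
next
  case (reach_step p l q g r)
  have "g \<in> carrier G" using reach_closed[OF reach_step(2)] assms(3) by blast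
  then show ?case
    using group.reach_trans[OF assms(1) _ reach_step.IH assms(4)] assms(3)[OF reach_step(1)]
      hom_mult[OF assms(2)] by auto
qed

lemma run_imp_reach:
  "run A p w q \<Longrightarrow> set gs \<subseteq> carrier G \<Longrightarrow>
    (\<And>p l q. (p, l, q) \<in> set (transitions A) \<Longrightarrow> wf_label (length gs) l) \<Longrightarrow>
    reach G (label_val G gs) (set (transitions A)) p (word_val G gs w) q"
proof (induction rule: run.induct)
  case (run_eps p q w r)
  then have r: "reach G (label_val G gs) (set (transitions A)) q (word_val G gs w) r" by blast
  have "word_val G gs w \<in> carrier G"
    by (rule reach_closed[OF r]) (use run_eps label_val_closed in blast)
  then show ?case using reach.reach_step[OF run_eps(1) r] by simp
next
  case (run_letter p x q w r)
  then show ?case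
    using reach.reach_step[of p "Some x" q "set (transitions A)" G "label_val G gs" "word_val G gs w" r]
    by simp
qed (auto intro: reach.reach_refl)

lemma reach_imp_run:
  "reach G (label_val G gs) (set (transitions A)) p g q \<Longrightarrow> set gs \<subseteq> carrier G \<Longrightarrow>
    (\<And>p l q. (p, l, q) \<in> set (transitions A) \<Longrightarrow> wf_label (length gs) l) \<Longrightarrow>
    \<exists>w. run A p w q \<and> word_val G gs w = g"
proof (induction rule: reach.induct)
  case (reach_refl p)
  show ?case by (rule exI[of _ "[]"]) (simp add: run_refl)
next
  case (reach_step p l q g r)
  then obtain w where w: "run A q w r" "word_val G gs w = g" by blast
  have "g \<in> carrier G"
    by (rule reach_closed[OF reach_step(2)]) (use reach_step label_val_closed in blast)
  then show ?case
  proof (cases l)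
    case None
    then show ?thesis
      using run_eps[of p q A w r] reach_step(1) w \<open>g \<in> carrier G\<close> by auto
  next
    case (Some x)
    then show ?thesis
      using run_letter[of p x q A w r] reach_step(1) w by auto
  qed
qed

lemma rational_subset_reach:
  assumes "set gs \<subseteq> carrier G" "wf_automaton (length gs) A"
  shows "g \<in> rational_subset G gs A \<longleftrightarrow>
    (\<exists>f\<in>set (finals A). reach G (label_val G gs) (set (transitions A)) (start A) g f)"
proof -
  have "wf_label (length gs) l" if "(p, l, q) \<in> set (transitions A)" for p l q
    using that assms(2) by (auto simp: wf_automaton_def wf_label_def)
  with run_imp_reach[OF _ assms(1)] reach_imp_run[OF _ assms(1)] show ?thesis
    unfolding rational_subset_def accepts_def by blast
qed

end

section \<open>Automata over one factor\<close>

text \<open>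
  \<open>tr l\<close> lists the labels of a factor into which the label \<open>l\<close> of the amalgam can be
  translated.
\<close>

definition factor_part ::
  "(letter option \<Rightarrow> letter option list) \<Rightarrow> (nat \<times> letter option \<times> nat) list \<Rightarrow>
    (nat \<times> letter option \<times> nat) list" where
  "factor_part tr T = concat (map (\<lambda>t. map (\<lambda>l'. (fst t, l', snd (snd t))) (tr (fst (snd t)))) T)"

lemma set_factor_part: "set (factor_part tr T) = {(p, l', q) | p l l' q. (p, l, q) \<in> set T \<and> l' \<in> set (tr l)}"
  by (force simp: factor_part_def)

definition graph_of :: "nat \<Rightarrow> (nat \<times> letter option \<times> nat) set \<Rightarrow> nat pair_pre_digraph" where
  "graph_of N T = \<lparr>pverts = {..<N}, parcs = {(p, q). \<exists>l. (p, l, q) \<in> T}\<rparr>"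

definition valid ::
  "nat pair_pre_digraph set \<Rightarrow> nat \<Rightarrow> nat \<Rightarrow> (nat \<times> letter option \<times> nat) list \<Rightarrow> bool" where
  "valid F m N T \<longleftrightarrow> (\<forall>(p, l, q)\<in>set T. p < N \<and> q < N \<and> wf_label m l) \<and> graph_of N (set T) \<in> F"

text \<open>
  The answer of the subroutine for the factor \<open>K\<close> to the question whether the value of \<open>w\<close> is
  the value of a run from \<open>p\<close> to \<open>q\<close> that reads only labels of this factor.
\<close>

definition oracle_answer ::
  "('a, 'm) monoid_scheme \<Rightarrow> 'a list \<Rightarrow> (letter option \<Rightarrow> letter option list) \<Rightarrow>
    nat \<Rightarrow> (nat \<times> letter option \<times> nat) list \<Rightarrow> nat \<Rightarrow> nat \<Rightarrow> letter list \<Rightarrow> bool" where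
  "oracle_answer K gs tr N T p q w \<longleftrightarrow> word_val K gs w \<in> rational_subset K gs
     \<lparr>num_states = N, start = p, finals = [q], transitions = factor_part tr T\<rparr>"

lemma valid_bounds:
  "valid F m N T \<Longrightarrow> (p, l, q) \<in> set T \<Longrightarrow> p < N \<and> q < N \<and> wf_label m l"
  by (auto simp: valid_def)

lemma progressiveD:
  assumes "progressive F"
  shows "D \<in> F \<Longrightarrow> pair_fin_digraph D"
    and "D \<in> F \<Longrightarrow> subgraph (with_proj D') (with_proj D) \<Longrightarrow> D' \<in> F"
    and "D \<in> F \<Longrightarrow> u \<rightarrow>\<^sup>+\<^bsub>with_proj D\<^esub> v \<Longrightarrow> add_edge u v D \<in> F"
    and "D \<in> F \<Longrightarrow> v \<in> pverts D \<Longrightarrow> distinct vs \<Longrightarrow> set vs \<inter> pverts D = {} \<Longrightarrow> append_path v vs D \<in> F"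
  using assms unfolding progressive_def by blast+

text \<open>
  Keeping the letters of one factor is closure under subgraphs; the next two lemmas are closure
  under shortcuts and under appending a path of length one.
\<close>

lemma valid_factor_part:
  assumes "progressive F" "valid F m N T" "\<And>l. wf_label m l \<Longrightarrow> list_all (wf_label m') (tr l)"
  shows "valid F m' N (factor_part tr T)"
proof -
  have wf: "p < N \<and> q < N" if "(p, l, q) \<in> set T" for p l q
    using assms(2) that by (auto simp: valid_def)
  have "subgraph (with_proj (graph_of N (set (factor_part tr T)))) (with_proj (graph_of N (set T)))"
    unfolding subgraph_def
    by (auto simp: graph_of_def set_factor_part wf_digraph_def compatible_def dest: wf)
  then have "graph_of N (set (factor_part tr T)) \<in> F"
    using progressiveD(2)[OF assms(1)] assms(2) by (auto simp: valid_def)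
  moreover have "p < N \<and> q < N \<and> wf_label m' l'" if t: "(p, l', q) \<in> set (factor_part tr T)" for p l' q
  proof -
    obtain l where "(p, l, q) \<in> set T" "l' \<in> set (tr l)" using t by (auto simp: set_factor_part)
    then show ?thesis
      using valid_bounds[OF assms(2)] assms(3)[of l] by (auto simp: list_all_iff)
  qed
  ultimately show ?thesis by (auto simp: valid_def)
qed

lemma valid_automaton:
  assumes "valid F m N T" "p < N" "q < N"
  shows "wf_automaton m \<lparr>num_states = N, start = p, finals = [q], transitions = T\<rparr>"
    and "underlying_graph \<lparr>num_states = N, start = p, finals = [q], transitions = T\<rparr> \<in> F"
  using assms by (auto simp: valid_def wf_automaton_def wf_label_def underlying_graph_def graph_of_def)

lemma oracle_answer_iff:
  assumes "group K" "set gs \<subseteq> carrier K" "progressive F" "valid F m N T" "p < N" "q < N"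
    and "\<And>l. wf_label m l \<Longrightarrow> list_all (wf_label (length gs)) (tr l)"
  shows "oracle_answer K gs tr N T p q w \<longleftrightarrow>
    reach K (label_val K gs) (set (factor_part tr T)) p (word_val K gs w) q"
  unfolding oracle_answer_def
  by (subst group.rational_subset_reach[OF assms(1,2)])
    (use valid_automaton(1)[OF valid_factor_part[OF assms(3,4,7)] assms(5,6)] in auto)

lemma valid_Cons:
  assumes "progressive F" "valid F m N T" "p < N" "q < N" "wf_label m l"
    and "(p, q) \<in> {(p, q). \<exists>l. (p, l, q) \<in> set T}\<^sup>+"
  shows "valid F m N ((p, l, q) # T)"
proof -
  have "add_edge p q (graph_of N (set T)) \<in> F"
    using assms(2,6) by (intro progressiveD(3)[OF assms(1)]) (auto simp: valid_def graph_of_def)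
  also have "add_edge p q (graph_of N (set T)) = graph_of N (set ((p, l, q) # T))"
    by (auto simp: add_edge_def graph_of_def)
  finally show ?thesis using assms by (auto simp: valid_def)
qed

lemma valid_append_vertex:
  assumes "progressive F" "valid F m N T" "f < N" "wf_label m l"
  shows "valid F m (Suc N) ((f, l, N) # T)"
proof -
  have "append_path f [N] (graph_of N (set T)) \<in> F"
    using assms(2,3) by (intro progressiveD(4)[OF assms(1)]) (auto simp: valid_def graph_of_def)
  also have "append_path f [N] (graph_of N (set T)) = graph_of (Suc N) (set ((f, l, N) # T))"
    by (auto simp: append_path_def graph_of_def lessThan_Suc)
  finally show ?thesis using assms by (force simp: valid_def)
qed

section \<open>Appending the inverse of the given word\<close>

text \<open>
  The path is appended letter by letter; the state consists of the number of states, the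
  current end of the path, and the transitions.
\<close>

definition append_letter ::
  "nat \<times> nat \<times> (nat \<times> letter option \<times> nat) list \<Rightarrow> letter \<Rightarrow>
    nat \<times> nat \<times> (nat \<times> letter option \<times> nat) list" where
  "append_letter B x = (Suc (fst B), fst B, (fst (snd B), Some x, fst B) # snd (snd B))"

lemma append_letter_simp: "append_letter (N, f, T) x = (Suc N, N, (f, Some x, N) # T)"
  by (simp add: append_letter_def)

primrec flip :: "letter \<Rightarrow> letter" where
  "flip (Gen i) = Inv i"
| "flip (Inv i) = Gen i"

context group
begin

lemma reach_append_letter:
  assumes "\<And>p l q. (p, l, q) \<in> T \<Longrightarrow> p < N \<and> q < N \<and> val l \<in> carrier G" "f < N" "val a \<in> carrier G" "p < N"
  shows "reach G val (insert (f, a, N) T) p g N \<longleftrightarrow> (\<exists>h. reach G val T p h f \<and> g = h \<otimes> val a)"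
proof
  assume "\<exists>h. reach G val T p h f \<and> g = h \<otimes> val a"
  then obtain h where "reach G val T p h f" "g = h \<otimes> val a" by blast
  then show "reach G val (insert (f, a, N) T) p g N"
    using assms by (auto intro!: reach_trans reach_edge elim: reach_mono)
next
  assume "reach G val (insert (f, a, N) T) p g N"
  moreover have "(r < N \<longrightarrow> reach G val T p g r) \<and>
      (r = N \<longrightarrow> (\<exists>h. reach G val T p h f \<and> g = h \<otimes> val a))"
    if "reach G val (insert (f, a, N) T) p g r" "p < N" for p g r
    using that
  proof (induction rule: reach.induct)
    case (reach_refl p)
    then show ?case by (auto intro: reach.reach_refl)
  next
    case (reach_step p l q g r)
    show ?case
    proof (cases "(p, l, q) \<in> T")
      case True
      have "val l \<in> carrier G" "q < N" using assms(1)[OF True] by auto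
      have "\<exists>h. reach G val T p h f \<and> val l \<otimes> g = h \<otimes> val a" if "r = N"
      proof -
        obtain h where h: "reach G val T q h f" "g = h \<otimes> val a"
          using reach_step.IH \<open>q < N\<close> \<open>r = N\<close> by blast
        have "h \<in> carrier G" using reach_closed[OF h(1)] assms(1) by blast
        then show ?thesis
          using reach.reach_step[OF True h(1)] h(2) \<open>val l \<in> carrier G\<close> assms(3)
          by (intro exI[of _ "val l \<otimes> h"]) (simp add: m_assoc)
      qed
      then show ?thesis
        using reach_step.IH \<open>q < N\<close> reach.reach_step[OF True, of G val g r] by blast
    next
      case False
      then have new: "p = f" "l = a" "q = N" using reach_step(1) by auto
      \<comment> \<open>no transition leaves the new state\<close>
      have "r = N \<and> g = \<one>"
        using reach_step(2) unfolding new
        by (cases rule: reach.cases) (use assms(1,2) in auto)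
      then show ?thesis
        using new assms(3) reach.reach_refl[of G val T f] by auto
    qed
  qed
  ultimately show "\<exists>h. reach G val T p h f \<and> g = h \<otimes> val a" using assms(4) by blast
qed

lemma word_val_flip:
  assumes "set gs \<subseteq> carrier G" "wf_word (length gs) w"
  shows "word_val G gs (map flip (rev w)) = inv (word_val G gs w)"
  using assms(2)
proof (induction w)
  case (Cons x w)
  then have x: "letter_index x < length gs" and w: "wf_word (length gs) w" by (auto simp: wf_word_def)
  have flip_index: "letter_index (flip y) = letter_index y" for y by (cases y) auto
  have "wf_word (length gs) (map flip (rev w))" "wf_word (length gs) [flip x]"
    using x w by (auto simp: wf_word_def flip_index)
  then have "word_val G gs (map flip (rev (x # w))) = inv (word_val G gs w) \<otimes> letter_val G gs (flip x)"
    using Cons.IH w letter_val_closed[OF assms(1), of "flip x"] x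
    by (simp add: word_val_append[OF assms(1)] flip_index)
  also have "letter_val G gs (flip x) = inv (letter_val G gs x)"
    using x assms(1) by (cases x) (auto dest: nth_mem)
  finally show ?case
    using x w word_val_closed[OF assms(1)] letter_val_closed[OF assms(1)] by (simp add: inv_mult_group)
qed simp

text \<open>
  A run to the end \<open>e\<close> of the appended path must pass through \<open>f\<close> and then follow the whole path,
  because the path hangs: no transition leads back from it.
\<close>

lemma append_word:
  assumes gs: "set gs \<subseteq> carrier G" and F: "progressive F"
  shows "valid F (length gs) N T \<Longrightarrow> f < N \<Longrightarrow> p < N \<Longrightarrow> wf_word (length gs) w \<Longrightarrow>
    foldl append_letter (N, f, T) w = (N', e, T') \<Longrightarrow>
    valid F (length gs) N' T' \<and> p < N' \<and> e < N' \<and>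
    (reach G (label_val G gs) (set T') p g e \<longleftrightarrow>
      (\<exists>h. reach G (label_val G gs) (set T) p h f \<and> g = h \<otimes> word_val G gs w))"
proof (induction w arbitrary: N f T)
  case Nil
  have "h \<in> carrier G" if "reach G (label_val G gs) (set T) p h f" for h
    by (rule reach_closed[OF that]) (use Nil valid_bounds label_val_closed[OF gs] in blast)
  then show ?case using Nil by auto
next
  case (Cons x w)
  let ?v = "label_val G gs"
  have x: "wf_label (length gs) (Some x)" "wf_word (length gs) w"
    using Cons.prems by (auto simp: wf_word_def wf_label_def)
  have closed: "p < N \<and> q < N \<and> ?v l \<in> carrier G" if "(p, l, q) \<in> set T" for p l q
    using valid_bounds[OF Cons.prems(1) that] label_val_closed[OF gs] by blast
  have vx: "?v (Some x) \<in> carrier G" "?v (Some x) = letter_val G gs x"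
    using label_val_closed[OF gs x(1)] by auto
  have vw: "word_val G gs w \<in> carrier G" using x word_val_closed[OF gs] by blast
  have "foldl append_letter (Suc N, N, (f, Some x, N) # T) w = (N', e, T')"
    using Cons.prems(5)
    by (simp only: foldl.simps append_letter_simp)
  from Cons.IH[OF valid_append_vertex[OF F Cons.prems(1,2) x(1)] _ _ x(2) this] Cons.prems(3)
  have IH: "valid F (length gs) N' T'" "p < N'" "e < N'"
    "reach G ?v (set T') p g e \<longleftrightarrow>
      (\<exists>h. reach G ?v (insert (f, Some x, N) (set T)) p h N \<and> g = h \<otimes> word_val G gs w)"
    by auto
  have "h \<in> carrier G" if "reach G ?v (set T) p h f" for h
    using reach_closed[OF that] closed by blast
  moreover have "reach G ?v (insert (f, Some x, N) (set T)) p h N \<longleftrightarrow>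
      (\<exists>k. reach G ?v (set T) p k f \<and> h = k \<otimes> ?v (Some x))" for h
    using closed by (intro reach_append_letter Cons.prems(2,3) vx(1))
  ultimately have "reach G ?v (set T') p g e \<longleftrightarrow>
      (\<exists>h. reach G ?v (set T) p h f \<and> g = h \<otimes> word_val G gs (x # w))"
    unfolding IH(4) using vx vw by (auto simp: m_assoc)
  then show ?case using IH by blast
qed

end

section \<open>Saturation\<close>

locale amalgam_membership = embedded_amalgamation +
  fixes F and xs :: "'a list" and ys :: "'c list" and cs :: "'e list"
  assumes progressive: "progressive F"
    and xs: "set xs \<subseteq> carrier G" and ys: "set ys \<subseteq> carrier H" and cs: "set cs = carrier C"

sublocale amalgam_membership \<subseteq> PG: group P
  by (rule group_amalgam)

context amalgam_membership
begin

abbreviation "inl \<equiv> amalg_inl G H C \<phi> \<psi>"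
abbreviation "inr \<equiv> amalg_inr G H C \<phi> \<psi>"
definition gsG :: "'a list" where "gsG = xs @ map \<phi> cs"
definition gsH :: "'c list" where "gsH = ys @ map \<psi> cs"
definition gsP :: "('a + 'c) list set list" where "gsP = map inl gsG @ map inr gsH"
abbreviation "valG \<equiv> label_val G gsG"
abbreviation "valH \<equiv> label_val H gsH"
abbreviation "valP \<equiv> label_val P gsP"
abbreviation "m \<equiv> length gsP"

lemma length_gsG: "length gsG = length xs + length cs"
  and length_gsH: "length gsH = length ys + length cs"
  and length_gsP: "length gsP = length gsG + length gsH"
  by (simp_all add: gsG_def gsH_def gsP_def)

definition C_label :: "nat \<Rightarrow> letter option" where
  "C_label i = Some (Gen (length xs + i))"

text \<open>
  Saturation adds transitions labelled by the letters \<^const>\<open>C_label\<close> only, so these letters are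
  read in both factors; every other letter is read in the factor that it comes from.
\<close>

definition trG :: "letter option \<Rightarrow> letter option list" where
  "trG l = (case l of None \<Rightarrow> [None]
    | Some x \<Rightarrow> if letter_index x < length gsG then [Some x] else [])"

definition trH :: "letter option \<Rightarrow> letter option list" where
  "trH l = (case l of None \<Rightarrow> [None]
    | Some (Gen i) \<Rightarrow> if length gsG \<le> i then [Some (Gen (i - length gsG))]
        else if length xs \<le> i then [Some (Gen (length ys + (i - length xs)))] else []
    | Some (Inv i) \<Rightarrow> if length gsG \<le> i then [Some (Inv (i - length gsG))] else [])"

lemma phi_closed [simp]: "c \<in> carrier C \<Longrightarrow> \<phi> c \<in> carrier G"
  and psi_closed [simp]: "c \<in> carrier C \<Longrightarrow> \<psi> c \<in> carrier H"
  using hom_in_carrier[OF phi] hom_in_carrier[OF psi] by auto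

lemma cs_nth [simp]: "i < length cs \<Longrightarrow> cs ! i \<in> carrier C"
  using cs nth_mem by blast

lemma gsG_closed: "set gsG \<subseteq> carrier G" and gsH_closed: "set gsH \<subseteq> carrier H"
  using xs ys cs by (auto simp: gsG_def gsH_def)

lemma gsP_closed: "set gsP \<subseteq> carrier P"
proof -
  have "inl ` set gsG \<subseteq> carrier P" "inr ` set gsH \<subseteq> carrier P"
    using gsG_closed gsH_closed hom_in_carrier[OF amalg_inl_hom] hom_in_carrier[OF amalg_inr_hom]
    by blast+
  then show ?thesis by (auto simp: gsP_def)
qed

lemma inl_inv: "g \<in> carrier G \<Longrightarrow> inl (inv\<^bsub>G\<^esub> g) = inv\<^bsub>P\<^esub> (inl g)"
  by (rule group_hom.hom_inv) (unfold_locales, rule amalg_inl_hom)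

lemma inr_inv: "h \<in> carrier H \<Longrightarrow> inr (inv\<^bsub>H\<^esub> h) = inv\<^bsub>P\<^esub> (inr h)"
  by (rule group_hom.hom_inv) (unfold_locales, rule amalg_inr_hom)

lemma inl_one: "inl \<one>\<^bsub>G\<^esub> = \<one>\<^bsub>P\<^esub>" and inr_one: "inr \<one>\<^bsub>H\<^esub> = \<one>\<^bsub>P\<^esub>"
  using hom_one[OF amalg_inl_hom G.is_group PG.is_group]
    hom_one[OF amalg_inr_hom H.is_group PG.is_group] by auto

lemma gsP_nth:
  "i < length gsG \<Longrightarrow> gsP ! i = inl (gsG ! i)"
  "length gsG \<le> i \<Longrightarrow> i < m \<Longrightarrow> gsP ! i = inr (gsH ! (i - length gsG))"
  by (simp_all add: gsP_def nth_append)

lemma trG_wf: "wf_label m l \<Longrightarrow> list_all (wf_label (length gsG)) (trG l)"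
  by (auto simp: trG_def wf_label_def split: option.split)

lemma trH_wf: "wf_label m l \<Longrightarrow> list_all (wf_label (length gsH)) (trH l)"
  by (auto simp: trH_def wf_label_def length_gsG length_gsH length_gsP split: option.split letter.split)

lemma trG_sound:
  assumes "wf_label m l" "l' \<in> set (trG l)"
  shows "inl (valG l') = valP l"
proof (cases l)
  case None
  then show ?thesis using assms by (auto simp: trG_def inl_one)
next
  case (Some x)
  then have x: "letter_index x < length gsG" "l' = Some x"
    using assms by (auto simp: trG_def split: if_splits)
  then have "gsG ! letter_index x \<in> carrier G" using gsG_closed nth_mem by blast
  then show ?thesis
    using x Some gsP_nth(1)[OF x(1)] by (cases x) (simp_all add: inl_inv)
qed

lemma trH_sound:
  assumes "wf_label m l" "l' \<in> set (trH l)"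
  shows "inr (valH l') = valP l"
proof (cases l)
  case None
  then show ?thesis using assms by (auto simp: trH_def inr_one)
next
  case (Some x)
  show ?thesis
  proof (cases "length gsG \<le> letter_index x")
    case True
    have x: "letter_index x < m" using assms(1) Some by (simp add: wf_label_def)
    then have "letter_index x - length gsG < length gsH" using True by (simp add: length_gsP)
    then have "gsH ! (letter_index x - length gsG) \<in> carrier H" using gsH_closed nth_mem by blast
    then show ?thesis
      using True Some assms(2) gsP_nth(2)[OF True x]
      by (cases x) (auto simp: trH_def inr_inv)
  next
    case False
    then obtain i where i: "x = Gen i" "length xs \<le> i" "i < length gsG"
      "l' = Some (Gen (length ys + (i - length xs)))"
      using Some assms(2) by (auto simp: trH_def split: letter.splits if_splits)
    define j where "j = i - length xs"
    then have j: "i = length xs + j" "j < length cs" using i by (auto simp: length_gsG)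
    then have "gsG ! i = \<phi> (cs ! j)" "gsH ! (length ys + j) = \<psi> (cs ! j)"
      by (simp_all add: gsG_def gsH_def nth_append)
    then show ?thesis
      using i Some gsP_nth(1)[OF i(3)] amalg_inl_inr[of "cs ! j"] j(2) by (simp flip: j_def)
  qed
qed

lemma tr_cases:
  assumes "wf_label m l"
  obtains l' where "l' \<in> set (trG l)" | l' where "l' \<in> set (trH l)"
proof (cases l)
  case None
  then show ?thesis using that by (auto simp: trG_def)
next
  case (Some x)
  show ?thesis
  proof (cases "letter_index x < length gsG")
    case True
    then show ?thesis using that(1)[of l] Some by (simp add: trG_def)
  next
    case False
    then show ?thesis using that(2) Some by (cases x) (auto simp: trH_def)
  qed
qed

lemma C_label_wf: "i < length cs \<Longrightarrow> wf_label m (C_label i)"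
  by (simp add: C_label_def wf_label_def length_gsG length_gsP)

lemma trG_C_label: "i < length cs \<Longrightarrow> trG (C_label i) = [C_label i]"
  by (simp add: C_label_def trG_def length_gsG)

lemma trH_C_label: "i < length cs \<Longrightarrow> trH (C_label i) = [Some (Gen (length ys + i))]"
  by (simp add: C_label_def trH_def length_gsG)

lemma val_C_label:
  assumes "i < length cs"
  shows "valG (C_label i) = \<phi> (cs ! i)" "valH (Some (Gen (length ys + i))) = \<psi> (cs ! i)"
    "valP (C_label i) = inl (\<phi> (cs ! i))"
proof -
  show *: "valG (C_label i) = \<phi> (cs ! i)" "valH (Some (Gen (length ys + i))) = \<psi> (cs ! i)"
    using assms by (simp_all add: C_label_def gsG_def gsH_def nth_append)
  show "valP (C_label i) = inl (\<phi> (cs ! i))"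
    using trG_sound[OF C_label_wf[OF assms]] assms * by (simp add: trG_C_label)
qed

subsection \<open>Runs as chains of syllables\<close>

definition segment ::
  "(nat \<times> letter option \<times> nat) list \<Rightarrow> nat \<Rightarrow> 'a + 'c \<Rightarrow> nat \<Rightarrow> bool" where
  "segment T p x q = (case x of
     Inl g \<Rightarrow> reach G valG (set (factor_part trG T)) p g q
   | Inr h \<Rightarrow> reach H valH (set (factor_part trH T)) p h q)"

primrec chain ::
  "(nat \<times> letter option \<times> nat) list \<Rightarrow> nat \<Rightarrow> ('a + 'c) list \<Rightarrow> nat \<Rightarrow> bool" where
  "chain T p [] q \<longleftrightarrow> p = q"
| "chain T p (x # u) q \<longleftrightarrow> (\<exists>r. segment T p x r \<and> chain T r u q)"

lemma chain_append: "chain T p (u @ v) q \<longleftrightarrow> (\<exists>r. chain T p u r \<and> chain T r v q)"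
  by (induction u arbitrary: p) auto

lemma factor_part_closed:
  assumes "valid F m N T"
  shows "(p, l, q) \<in> set (factor_part trG T) \<Longrightarrow> q < N \<and> valG l \<in> carrier G"
    and "(p, l, q) \<in> set (factor_part trH T) \<Longrightarrow> q < N \<and> valH l \<in> carrier H"
proof -
  show "(p, l, q) \<in> set (factor_part trG T) \<Longrightarrow> q < N \<and> valG l \<in> carrier G"
    using valid_bounds[OF valid_factor_part[where tr = trG, OF progressive assms trG_wf]] G.label_val_closed[OF gsG_closed]
    by blast
  show "(p, l, q) \<in> set (factor_part trH T) \<Longrightarrow> q < N \<and> valH l \<in> carrier H"
    using valid_bounds[OF valid_factor_part[where tr = trH, OF progressive assms trH_wf]] H.label_val_closed[OF gsH_closed]
    by blast
qed

lemma segment_closed: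
  assumes "valid F m N T" "segment T p x q"
  shows "x \<in> carrier G <+> carrier H"
  using assms(2) G.reach_closed[of valG "set (factor_part trG T)"] H.reach_closed[of valH "set (factor_part trH T)"]
    factor_part_closed[OF assms(1)]
  by (cases x) (force simp: segment_def)+

lemma segment_verts:
  assumes "valid F m N T" "segment T p x q" "p < N"
  shows "q < N"
proof (cases x)
  case (Inl g)
  then have "reach G valG (set (factor_part trG T)) p g q" using assms(2) by (simp add: segment_def)
  then show ?thesis by (rule reach_verts) (use factor_part_closed[OF assms(1)] assms(3) in auto)
next
  case (Inr h)
  then have "reach H valH (set (factor_part trH T)) p h q" using assms(2) by (simp add: segment_def)
  then show ?thesis by (rule reach_verts) (use factor_part_closed[OF assms(1)] assms(3) in auto)
qed

lemma segment_mult: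
  assumes "valid F m N T"
  shows "segment T p (Inl a) q \<Longrightarrow> segment T q (Inl b) r \<Longrightarrow> segment T p (Inl (a \<otimes>\<^bsub>G\<^esub> b)) r"
    and "segment T p (Inr c) q \<Longrightarrow> segment T q (Inr d) r \<Longrightarrow> segment T p (Inr (c \<otimes>\<^bsub>H\<^esub> d)) r"
  using factor_part_closed[OF assms] unfolding segment_def sum.case
  by (blast intro: G.reach_trans H.reach_trans)+

text \<open>
  A path of one factor is a path of the amalgam, as each translated label has the value of the
  label that it comes from.
\<close>

lemma segment_sound:
  assumes "valid F m N T" "segment T p x q"
  shows "reach P valP (set T) p (cl [x]) q"
proof -
  have edge: "reach P valP (set T) p (valP l) q" "valP l \<in> carrier P" "wf_label m l" if "(p, l, q) \<in> set T" for p l q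
  proof -
    show "wf_label m l" using valid_bounds[OF assms(1) that] by blast
    then show "valP l \<in> carrier P" using PG.label_val_closed[OF gsP_closed] by simp
    with that show "reach P valP (set T) p (valP l) q" by (rule PG.reach_edge)
  qed
  show ?thesis
  proof (cases x)
    case (Inl g)
    have "reach P valP (set T) p (inl g) q"
    proof (rule G.reach_simulate[OF PG.is_group amalg_inl_hom])
      show "valG l' \<in> carrier G \<and> reach P valP (set T) p (inl (valG l')) q"
        if l': "(p, l', q) \<in> set (factor_part trG T)" for p l' q
      proof -
        obtain l where l: "(p, l, q) \<in> set T" "l' \<in> set (trG l)" using l' by (auto simp: set_factor_part)
        then show ?thesis
          using edge[OF l(1)] trG_sound[OF _ l(2)] factor_part_closed(1)[OF assms(1) l'] by simp
      qed
      show "reach G valG (set (factor_part trG T)) p g q" using assms(2) Inl by (simp add: segment_def)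
    qed (rule edge)
    then show ?thesis using Inl by (simp add: amalg_inl_def)
  next
    case (Inr h)
    have "reach P valP (set T) p (inr h) q"
    proof (rule H.reach_simulate[OF PG.is_group amalg_inr_hom])
      show "valH l' \<in> carrier H \<and> reach P valP (set T) p (inr (valH l')) q"
        if l': "(p, l', q) \<in> set (factor_part trH T)" for p l' q
      proof -
        obtain l where l: "(p, l, q) \<in> set T" "l' \<in> set (trH l)" using l' by (auto simp: set_factor_part)
        then show ?thesis
          using edge[OF l(1)] trH_sound[OF _ l(2)] factor_part_closed(2)[OF assms(1) l'] by simp
      qed
      show "reach H valH (set (factor_part trH T)) p h q" using assms(2) Inr by (simp add: segment_def)
    qed (rule edge)
    then show ?thesis using Inr by (simp add: amalg_inr_def)
  qed
qed

lemma chain_words: "valid F m N T \<Longrightarrow> chain T p u q \<Longrightarrow> u \<in> W"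
  by (induction u arbitrary: p) (auto dest!: segment_closed)

lemma chain_verts: "valid F m N T \<Longrightarrow> chain T p u q \<Longrightarrow> p < N \<Longrightarrow> q < N"
  by (induction u arbitrary: p) (auto dest!: segment_verts)

lemma reach_imp_chain:
  assumes "valid F m N T" "reach P valP (set T) p g q"
  shows "\<exists>u. chain T p u q \<and> g = cl u"
  using assms(2)
proof (induction rule: reach.induct)
  case (reach_refl p)
  show ?case by (rule exI[of _ "[]"]) (simp add: amalgam_def)
next
  case (reach_step p l q g r)
  then obtain u where u: "chain T q u r" "g = cl u" by blast
  have l: "wf_label m l" using valid_bounds[OF assms(1) reach_step(1)] by blast
  have "\<exists>x. segment T p x q \<and> valP l = cl [x]"
  proof (cases rule: tr_cases[OF l])
    case (1 l')
    then have "(p, l', q) \<in> set (factor_part trG T)" using reach_step(1) by (auto simp: set_factor_part)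
    then have "segment T p (Inl (valG l')) q"
      using factor_part_closed(1)[OF assms(1)] by (auto simp: segment_def intro!: G.reach_edge)
    then show ?thesis using trG_sound[OF l 1] by (auto simp: amalg_inl_def)
  next
    case (2 l')
    then have "(p, l', q) \<in> set (factor_part trH T)" using reach_step(1) by (auto simp: set_factor_part)
    then have "segment T p (Inr (valH l')) q"
      using factor_part_closed(2)[OF assms(1)] by (auto simp: segment_def intro!: H.reach_edge)
    then show ?thesis using trH_sound[OF l 2] by (auto simp: amalg_inr_def)
  qed
  then obtain x where x: "segment T p x q" "valP l = cl [x]" by blast
  have "chain T p (x # u) r" using x u by auto
  moreover have "valP l \<otimes>\<^bsub>P\<^esub> g = cl (x # u)"
    using x u class_mult[of "[x]" u] segment_closed[OF assms(1) x(1)] chain_words[OF assms(1) u(1)] by simp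
  ultimately show ?case by blast
qed

subsection \<open>Saturated sets of transitions\<close>

text \<open>
  One of the factors has a run with the ends and the value of the candidate transition \<open>t\<close>.
\<close>

definition test :: "nat \<Rightarrow> (nat \<times> letter option \<times> nat) list \<Rightarrow> nat \<times> letter option \<times> nat \<Rightarrow> bool" where
  "test N T t \<longleftrightarrow>
     oracle_answer G gsG trG N T (fst t) (snd (snd t)) (map the (trG (fst (snd t)))) \<or>
     oracle_answer H gsH trH N T (fst t) (snd (snd t)) (map the (trH (fst (snd t))))"

text \<open>
  The empty path from a state to itself has the identity as its value, but it has no shortcut; so
  saturation adds no loop labelled by the identity.
\<close>

definition candidates :: "nat \<Rightarrow> (nat \<times> letter option \<times> nat) list" where
  "candidates N = concat (map (\<lambda>p. concat (map (\<lambda>q. map (\<lambda>l. (p, l, q))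
     (if p = q then map C_label (filter (\<lambda>i. cs ! i \<noteq> \<one>\<^bsub>C\<^esub>) [0..<length cs])
      else map C_label [0..<length cs]))
     (rev [0..<N]))) (rev [0..<N]))"

definition saturated :: "nat \<Rightarrow> (nat \<times> letter option \<times> nat) list \<Rightarrow> bool" where
  "saturated N T \<longleftrightarrow> (\<forall>t\<in>set (candidates N). test N T t \<longrightarrow> t \<in> set T)"

lemma candidates_iff:
  "t \<in> set (candidates N) \<longleftrightarrow> (\<exists>p q i. t = (p, C_label i, q) \<and> p < N \<and> q < N \<and> i < length cs \<and>
     (p = q \<longrightarrow> cs ! i \<noteq> \<one>\<^bsub>C\<^esub>))"
proof -
  have "set (if p = q then map C_label (filter (\<lambda>i. cs ! i \<noteq> \<one>\<^bsub>C\<^esub>) [0..<length cs])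
      else map C_label [0..<length cs]) = {C_label i | i. i < length cs \<and> (p = q \<longrightarrow> cs ! i \<noteq> \<one>\<^bsub>C\<^esub>)}" for p q :: nat
    by auto
  then have "set (candidates N) = (\<Union>p\<in>{..<N}. \<Union>q\<in>{..<N}. (\<lambda>l. (p, l, q)) `
      {C_label i | i. i < length cs \<and> (p = q \<longrightarrow> cs ! i \<noteq> \<one>\<^bsub>C\<^esub>)})"
    unfolding candidates_def set_concat set_map image_image set_rev set_upt by (simp add: lessThan_atLeast0)
  then show ?thesis by auto
qed

lemma test_iff:
  assumes "valid F m N T" "p < N" "q < N" "i < length cs"
  shows "test N T (p, C_label i, q) \<longleftrightarrow>
    segment T p (Inl (\<phi> (cs ! i))) q \<or> segment T p (Inr (\<psi> (cs ! i))) q"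
proof -
  have "word_val G gsG (map the (trG (C_label i))) = \<phi> (cs ! i)"
    using val_C_label(1)[OF assms(4)] assms(4) by (simp add: trG_C_label) (simp add: C_label_def)
  moreover have "word_val H gsH (map the (trH (C_label i))) = \<psi> (cs ! i)"
    using val_C_label(2)[OF assms(4)] assms(4) by (simp add: trH_C_label)
  ultimately show ?thesis
    using oracle_answer_iff[where tr = trG, OF G.is_group gsG_closed progressive assms(1-3) trG_wf]
      oracle_answer_iff[where tr = trH, OF H.is_group gsH_closed progressive assms(1-3) trH_wf]
    by (simp add: test_def segment_def)
qed

lemma segment_mono: "set T \<subseteq> set T' \<Longrightarrow> segment T p x q \<Longrightarrow> segment T' p x q"
  unfolding segment_def
  by (cases x) (simp_all, (erule reach_mono, fastforce simp: set_factor_part)+)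

lemma test_mono:
  assumes "valid F m N T" "valid F m N T'" "set T \<subseteq> set T'" "t \<in> set (candidates N)" "test N T t"
  shows "test N T' t"
  using assms test_iff segment_mono[OF assms(3)] by (auto simp: candidates_iff)

text \<open>
  The shortcut for a syllable in \<open>C\<close> is present, and its label is translated into both factors. The
  only syllable without a shortcut is the empty path, which exists in both factors anyway.
\<close>

lemma saturated_segment:
  assumes "valid F m N T" "saturated N T" "p < N" "segment T p x q" "in_C x"
  obtains c where "c \<in> carrier C" "segment T p (Inl (\<phi> c)) q" "segment T p (Inr (\<psi> c)) q"
    "x = Inl (\<phi> c) \<or> x = Inr (\<psi> c)"
proof -
  obtain c where c: "c \<in> carrier C" "x = Inl (\<phi> c) \<or> x = Inr (\<psi> c)"
    using assms(5) by (auto simp: in_C_def split: sum.splits)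
  have "segment T p (Inl (\<phi> c)) q \<and> segment T p (Inr (\<psi> c)) q"
  proof (cases "p = q \<and> c = \<one>\<^bsub>C\<^esub>")
    case True
    then show ?thesis by (auto simp: segment_def intro: reach.reach_refl)
  next
    case False
    obtain i where i: "i < length cs" "c = cs ! i" using c(1) cs by (metis in_set_conv_nth)
    have q: "q < N" using segment_verts[OF assms(1,4,3)] .
    have "(p, C_label i, q) \<in> set (candidates N)" using False i assms(3) q by (auto simp: candidates_iff)
    moreover have "test N T (p, C_label i, q)"
      using test_iff[OF assms(1,3) q i(1)] assms(4) c(2) i by auto
    ultimately have t: "(p, C_label i, q) \<in> set T" using assms(2) by (auto simp: saturated_def)
    have "(p, C_label i, q) \<in> set (factor_part trG T)" "(p, Some (Gen (length ys + i)), q) \<in> set (factor_part trH T)"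
      using t trG_C_label[OF i(1)] trH_C_label[OF i(1)] by (auto simp: set_factor_part)
    from G.reach_edge[where val = valG, OF this(1)] H.reach_edge[where val = valH, OF this(2)] show ?thesis
      unfolding val_C_label(1,2)[OF i(1)] using c(1) i by (simp add: segment_def)
  qed
  then show ?thesis using that c by blast
qed

lemma merge_segments:
  assumes "valid F m N T" "chain T p (u @ [x, y] @ v) q" "isl x = isl y"
  shows "\<exists>z. chain T p (u @ [z] @ v) q \<and> R (u @ [x, y] @ v) (u @ [z] @ v)"
proof -
  obtain r s t where r: "chain T p u r" "segment T r x s" "segment T s y t" "chain T t v q"
    using assms(2) by (auto simp: chain_append)
  have words: "u \<in> W" "v \<in> W" "x \<in> carrier G <+> carrier H" "y \<in> carrier G <+> carrier H"
    using r chain_words[OF assms(1)] segment_closed[OF assms(1)] by auto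
  have "\<exists>z. segment T r z t \<and> R [x, y] [z]"
  proof (cases x)
    case (Inl a)
    then obtain b where "y = Inl b" using assms(3) by (cases y) auto
    then show ?thesis
      using Inl r words segment_mult(1)[OF assms(1)]
      by (intro exI[of _ "Inl (a \<otimes>\<^bsub>G\<^esub> b)"]) (auto intro!: amalg_cong.mult_l)
  next
    case (Inr a)
    then obtain b where "y = Inr b" using assms(3) by (cases y) auto
    then show ?thesis
      using Inr r words segment_mult(2)[OF assms(1)]
      by (intro exI[of _ "Inr (a \<otimes>\<^bsub>H\<^esub> b)"]) (auto intro!: amalg_cong.mult_r)
  qed
  then obtain z where z: "segment T r z t" "R [x, y] [z]" by blast
  have "chain T p (u @ [z] @ v) q" using r z by (auto simp: chain_append)
  moreover have "R (u @ [x, y] @ v) (u @ [z] @ v)"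
    using z words by (intro amalg_cong.append amalg_cong.refl)
  ultimately show ?thesis by blast
qed

lemma switch_factor:
  assumes "valid F m N T" "saturated N T" "p < N" "chain T p (u @ [x] @ v) q" "in_C x"
  shows "\<exists>z. isl z = b \<and> chain T p (u @ [z] @ v) q \<and> R (u @ [x] @ v) (u @ [z] @ v)"
proof -
  obtain r s where r: "chain T p u r" "segment T r x s" "chain T s v q"
    using assms(4) by (auto simp: chain_append)
  have words: "u \<in> W" "v \<in> W" using r chain_words[OF assms(1)] by auto
  have "r < N" using chain_verts[OF assms(1) r(1) assms(3)] .
  then obtain c where c: "c \<in> carrier C" "segment T r (Inl (\<phi> c)) s" "segment T r (Inr (\<psi> c)) s"
    "x = Inl (\<phi> c) \<or> x = Inr (\<psi> c)"
    using saturated_segment[OF assms(1,2) _ r(2) assms(5)] by blast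
  let ?z = "if b then Inl (\<phi> c) else Inr (\<psi> c)"
  have "R [Inl (\<phi> c)] [Inl (\<phi> c)]" "R [Inr (\<psi> c)] [Inr (\<psi> c)]"
    using c(1) by (auto intro!: amalg_cong.refl)
  then have "R [x] [?z]"
    using c amalg_cong.glue[OF c(1), of G H \<phi> \<psi>] by (auto intro: amalg_cong.sym)
  then have "R (u @ [x] @ v) (u @ [?z] @ v)"
    using words by (intro amalg_cong.append amalg_cong.refl)
  moreover have "chain T p (u @ [?z] @ v) q" using r c by (auto simp: chain_append)
  ultimately show ?thesis by (intro exI[of _ ?z]) auto
qed

lemma not_successively_split:
  "\<not> successively Q u \<Longrightarrow> \<exists>v x y w. u = v @ [x, y] @ w \<and> \<not> Q x y"
proof (induction u rule: induct_list012)
  case (3 x y zs)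
  show ?case
  proof (cases "Q x y")
    case True
    then obtain v x' y' w where "y # zs = v @ [x', y'] @ w" "\<not> Q x' y'" using 3 by auto
    then show ?thesis by (intro exI[of _ "x # v"]) auto
  next
    case False
    then show ?thesis by (intro exI[of _ "[]"]) auto
  qed
qed auto

text \<open>
  Two adjacent syllables of the same factor are multiplied; a syllable in \<open>C\<close> can be moved to the
  factor of a neighbour and then multiplied with it.
\<close>

lemma shorten_chain:
  assumes T: "valid F m N T" "saturated N T" "p < N" and u: "chain T p u q"
    and "\<not> reduced u" "length u \<noteq> 1"
  shows "\<exists>v. length v < length u \<and> chain T p v q \<and> R u v"
proof (cases "successively (\<lambda>x y. isl x \<noteq> isl y) u")
  case False
  then obtain v x y w where "u = v @ [x, y] @ w" "isl x = isl y"
    using not_successively_split by fast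
  then show ?thesis using merge_segments[OF T(1), of p v x y w q] u by force
next
  case True
  then obtain x where x: "x \<in> set u" "in_C x" using assms(5) by (auto simp: reduced_def)
  then obtain v w where vw: "u = v @ [x] @ w" by (metis append_Cons append_Nil in_set_conv_decomp)
  consider y w' where "w = y # w'" | y v' where "v = v' @ [y]"
    using vw assms(6) by (cases w; cases v rule: rev_cases) auto
  then show ?thesis
  proof cases
    case (1 y w')
    obtain z where z: "isl z = isl y" "chain T p (v @ [z] @ w) q" "R u (v @ [z] @ w)"
      using switch_factor[OF T _ x(2)] u vw by blast
    then obtain z' where "chain T p (v @ [z'] @ w') q" "R (v @ [z] @ w) (v @ [z'] @ w')"
      using merge_segments[OF T(1), of p v z y w' q] 1 by auto
    then show ?thesis
      using vw 1 amalg_cong.trans[OF z(3)] by (intro exI[of _ "v @ [z'] @ w'"]) auto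
  next
    case (2 y v')
    obtain z where z: "isl z = isl y" "chain T p (v @ [z] @ w) q" "R u (v @ [z] @ w)"
      using switch_factor[OF T _ x(2)] u vw by blast
    then obtain z' where "chain T p (v' @ [z'] @ w) q" "R (v @ [z] @ w) (v' @ [z'] @ w)"
      using merge_segments[OF T(1), of p v' y z w q] 2 by auto
    then show ?thesis
      using vw 2 amalg_cong.trans[OF z(3)] by (intro exI[of _ "v' @ [z'] @ w"]) auto
  qed
qed

text \<open>
  A shortest chain with a value in \<open>C\<close> has at most one syllable: if it is longer, then by the normal
  form theorem it is not reduced, and so it can be shortened. As \<open>G\<close> embeds in the amalgam, the
  single syllable is the given element of \<open>C\<close> and not merely equal to it in the amalgam.
\<close>

lemma chain_in_C:
  assumes T: "valid F m N T" "saturated N T" "p < N" and c: "c \<in> carrier C"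
  shows "chain T p u q \<Longrightarrow> R u [Inl (\<phi> c)] \<Longrightarrow> segment T p (Inl (\<phi> c)) q"
proof (induction u rule: length_induct)
  case (1 u)
  consider "\<not> reduced u" "length u \<noteq> 1" | "reduced u" | x where "u = [x]" "\<not> reduced u"
    by (auto simp: length_Suc_conv)
  then show ?case
  proof cases
    case 1
    then obtain v where "length v < length u" "chain T p v q" "R u v"
      using shorten_chain[OF T] "1.prems"(1) by blast
    then show ?thesis using "1.IH" "1.prems" amalg_cong.trans[OF amalg_cong.sym] by blast
  next
    case 2
    then have u: "u = []" using reduced_notin_C[OF "1.prems"(2) _ c] by blast
    have "R [Inl \<one>\<^bsub>G\<^esub>] [Inl (\<phi> c)]"
      using amalg_cong.trans[OF amalg_cong.one_l] "1.prems"(2) u by blast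
    then have "\<phi> c = \<one>\<^bsub>G\<^esub>" using amalg_inl_inj by metis
    then show ?thesis using "1.prems"(1) u by (auto simp: segment_def intro: reach.reach_refl)
  next
    case (3 x)
    then have x: "segment T p x q" "in_C x" using "1.prems" by (auto simp: reduced_def)
    obtain d where d: "d \<in> carrier C" "segment T p (Inl (\<phi> d)) q" "x = Inl (\<phi> d) \<or> x = Inr (\<psi> d)"
      using saturated_segment[OF T x] by metis
    have "R [Inl (\<phi> d)] [Inl (\<phi> d)]" using d(1) by (auto intro!: amalg_cong.refl)
    then have "R [Inl (\<phi> d)] [x]"
      using d amalg_cong.glue[OF d(1), of G H \<phi> \<psi>] by auto
    then have "R [Inl (\<phi> d)] [Inl (\<phi> c)]" using amalg_cong.trans "1.prems"(2) 3 by blast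
    then have "\<phi> d = \<phi> c" by (rule amalg_inl_inj)
    then show ?thesis using d(2) by simp
  qed
qed

text \<open>
  One question to the subroutine for \<open>G\<close> suffices: what a run of \<open>H\<close> contributes in \<open>C\<close> is present
  as a shortcut that \<open>G\<close> can read.
\<close>

theorem saturated_reach_one:
  assumes "valid F m N T" "saturated N T" "p < N" "q < N"
  shows "oracle_answer G gsG trG N T p q [] \<longleftrightarrow> reach P valP (set T) p \<one>\<^bsub>P\<^esub> q"
proof -
  have *: "oracle_answer G gsG trG N T p q [] \<longleftrightarrow> segment T p (Inl \<one>\<^bsub>G\<^esub>) q"
    using oracle_answer_iff[where tr = trG, OF G.is_group gsG_closed progressive assms(1,3,4) trG_wf]
    by (simp add: segment_def)
  show ?thesis
    unfolding *
  proof
    assume "segment T p (Inl \<one>\<^bsub>G\<^esub>) q"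
    from segment_sound[OF assms(1) this] show "reach P valP (set T) p \<one>\<^bsub>P\<^esub> q"
      using inl_one by (simp add: amalg_inl_def)
  next
    assume "reach P valP (set T) p \<one>\<^bsub>P\<^esub> q"
    then obtain u where u: "chain T p u q" "\<one>\<^bsub>P\<^esub> = cl u" using reach_imp_chain[OF assms(1)] by blast
    have "cl u = cl [Inl \<one>\<^bsub>G\<^esub>]" using u(2) inl_one by (simp add: amalg_inl_def)
    then have "R u [Inl (\<phi> \<one>\<^bsub>C\<^esub>)]"
      using class_eq_iff[OF chain_words[OF assms(1) u(1)]] GT.emb_one by simp
    then show "segment T p (Inl \<one>\<^bsub>G\<^esub>) q"
      using chain_in_C[OF assms(1-3) _ u(1)] GT.emb_one by fastforce
  qed
qed

subsection \<open>The saturation procedure\<close>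

definition step ::
  "nat \<Rightarrow> (nat \<times> letter option \<times> nat) list \<Rightarrow> nat \<times> letter option \<times> nat \<Rightarrow>
    (nat \<times> letter option \<times> nat) list" where
  "step N T t = (if test N T t then t # T else T)"

definition pass :: "nat \<Rightarrow> (nat \<times> letter option \<times> nat) list \<Rightarrow> (nat \<times> letter option \<times> nat) list" where
  "pass N T = foldl (step N) T (candidates N)"

text \<open>
  The list over which \<open>saturate\<close> folds only counts the passes.
\<close>

definition saturate :: "nat \<Rightarrow> (nat \<times> letter option \<times> nat) list \<Rightarrow> (nat \<times> letter option \<times> nat) list" where
  "saturate N T = foldl (\<lambda>T _. pass N T) T (candidates N)"

text \<open>
  The invariant of the loops: \<open>T'\<close> arises from \<open>T\<close> by shortcuts, which do not change the values of
  runs between any two states.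
\<close>

definition extends ::
  "nat \<Rightarrow> (nat \<times> letter option \<times> nat) list \<Rightarrow> (nat \<times> letter option \<times> nat) list \<Rightarrow> bool" where
  "extends N T T' \<longleftrightarrow> valid F m N T' \<and> set T \<subseteq> set T' \<and>
     (\<forall>p g q. reach P valP (set T') p g q \<longleftrightarrow> reach P valP (set T) p g q)"

lemma extendsD:
  assumes "extends N T T'"
  shows "valid F m N T'" "set T \<subseteq> set T'"
    "reach P valP (set T') p g q \<longleftrightarrow> reach P valP (set T) p g q"
  using assms unfolding extends_def by blast+

lemma extends_trans: "extends N T T' \<Longrightarrow> extends N T' T'' \<Longrightarrow> extends N T T''"
  by (auto simp: extends_def)

lemma step_extends:
  assumes "valid F m N T" "t \<in> set (candidates N)"
  shows "extends N T (step N T t)"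
proof (cases "test N T t")
  case False
  then show ?thesis using assms by (auto simp: extends_def step_def)
next
  case True
  obtain p q i where t: "t = (p, C_label i, q)" "p < N" "q < N" "i < length cs" "p = q \<longrightarrow> cs ! i \<noteq> \<one>\<^bsub>C\<^esub>"
    using assms(2) by (auto simp: candidates_iff)
  let ?c = "cs ! i"
  have seg: "segment T p (Inl (\<phi> ?c)) q \<or> segment T p (Inr (\<psi> ?c)) q"
    using True test_iff[OF assms(1) t(2-4)] t(1) by blast
  \<comment> \<open>a shortcut needs a path of length at least one\<close>
  have nontrivial: "p \<noteq> q \<or> (\<phi> ?c \<noteq> \<one>\<^bsub>G\<^esub> \<and> \<psi> ?c \<noteq> \<one>\<^bsub>H\<^esub>)"
  proof -
    have "\<phi> ?c \<noteq> \<phi> \<one>\<^bsub>C\<^esub> \<and> \<psi> ?c \<noteq> \<psi> \<one>\<^bsub>C\<^esub>" if "?c \<noteq> \<one>\<^bsub>C\<^esub>"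
      using that t(4) inj_on_eq_iff[OF GT.emb_inj] inj_on_eq_iff[OF HT.emb_inj]
      by (simp del: GT.emb_one HT.emb_one)
    then show ?thesis using t(5) by auto
  qed
  have "(p, q) \<in> {(p, q). \<exists>l. (p, l, q) \<in> set T}\<^sup>+"
  proof -
    have "{(p, q). \<exists>l. (p, l, q) \<in> set (factor_part tr T)} \<subseteq> {(p, q). \<exists>l. (p, l, q) \<in> set T}" for tr
      by (auto simp: set_factor_part)
    from trancl_mono[OF _ this] show ?thesis
      using seg nontrivial by (auto simp: segment_def dest!: reach_trancl)
  qed
  then have valid: "valid F m N (t # T)"
    unfolding t(1) by (intro valid_Cons[OF progressive assms(1) t(2,3) C_label_wf[OF t(4)]])
  have vP: "valP (C_label i) = cl [Inl (\<phi> ?c)]" "valP (C_label i) = cl [Inr (\<psi> ?c)]"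
    using val_C_label(3)[OF t(4)] amalg_inl_inr[of ?c] t(4) by (simp_all add: amalg_inl_def amalg_inr_def)
  have short: "reach P valP (set T) p (valP (C_label i)) q"
    using seg segment_sound[OF assms(1)] vP by metis
  have closed: "valP l \<in> carrier P" if "(p, l, q) \<in> set (t # T)" for p l q
    using valid_bounds[OF valid that] PG.label_val_closed[OF gsP_closed] by auto
  have "reach P valP (set T) r g s" if "reach P valP (set (t # T)) r g s" for r g s
  proof -
    have "reach P valP (set T) r ((\<lambda>g. g) g) s"
    proof (rule PG.reach_simulate[OF PG.is_group _ _ _ that])
      show "(\<lambda>g. g) \<in> hom P P" by (auto simp: hom_def)
      show "valP l \<in> carrier P \<and> reach P valP (set T) p' (valP l) q'" if "(p', l, q') \<in> set (t # T)" for p' l q'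
      proof (cases "(p', l, q') \<in> set T")
        case True
        then show ?thesis using closed[OF that] PG.reach_edge[OF True, of valP] by simp
      next
        case False
        then have "p' = p" "l = C_label i" "q' = q" using that t(1) by auto
        then show ?thesis using closed[OF that] short by simp
      qed
      show "valP l \<in> carrier P" if "(p', l, q') \<in> set T" for p' l q'
        using closed that by auto
    qed
    then show ?thesis by simp
  qed
  moreover have "reach P valP (set (t # T)) p g q" if "reach P valP (set T) p g q" for p g q
    using that by (rule reach_mono) auto
  ultimately show ?thesis using True valid by (auto simp: extends_def step_def)
qed

lemma steps_extend:
  "valid F m N T \<Longrightarrow> set ts \<subseteq> set (candidates N) \<Longrightarrow> extends N T (foldl (step N) T ts)"
proof (induction ts rule: rev_induct)
  case (snoc t ts)
  then have "extends N T (foldl (step N) T ts)" by simp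
  moreover from this have "extends N (foldl (step N) T ts) (step N (foldl (step N) T ts) t)"
    using snoc.prems by (intro step_extends) (auto dest: extendsD(1))
  ultimately have "extends N T (step N (foldl (step N) T ts) t)" by (rule extends_trans)
  then show ?case by simp
qed (simp add: extends_def)

lemma pass_extends: "valid F m N T \<Longrightarrow> extends N T (pass N T)"
  by (simp add: pass_def steps_extend)

lemma passes_extend: "valid F m N T \<Longrightarrow> extends N T (foldl (\<lambda>T _. pass N T) T us)"
proof (induction us rule: rev_induct)
  case (snoc u us)
  then have "extends N T (foldl (\<lambda>T _. pass N T) T us)" by simp
  moreover from this have "extends N (foldl (\<lambda>T _. pass N T) T us) (pass N (foldl (\<lambda>T _. pass N T) T us))"
    by (intro pass_extends extendsD(1))
  ultimately have "extends N T (pass N (foldl (\<lambda>T _. pass N T) T us))" by (rule extends_trans)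
  then show ?case by simp
qed (simp add: extends_def)

lemma steps_add:
  assumes "valid F m N T" "set ts \<subseteq> set (candidates N)" "t \<in> set ts" "test N T t"
  shows "t \<in> set (foldl (step N) T ts)"
proof -
  obtain us vs where ts: "ts = us @ t # vs" using split_list[OF assms(3)] by blast
  let ?T = "foldl (step N) T us"
  have T: "extends N T ?T" using assms ts by (intro steps_extend) auto
  then have valid: "valid F m N ?T" by (rule extendsD)
  have "test N ?T t"
    by (rule test_mono[OF assms(1) valid]) (use extendsD(2)[OF T] assms in auto)
  then have "t \<in> set (step N ?T t)" by (simp add: step_def)
  moreover have "extends N ?T (step N ?T t)" using assms(2) ts valid by (intro step_extends) auto
  then have "extends N (step N ?T t) (foldl (step N) (step N ?T t) vs)"
    using assms(2) ts by (intro steps_extend extendsD(1)) auto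
  from extendsD(2)[OF this] have "set (step N ?T t) \<subseteq> set (foldl (step N) T ts)" unfolding ts by simp
  ultimately show ?thesis by blast
qed

lemma steps_saturated:
  "valid F m N T \<Longrightarrow> saturated N T \<Longrightarrow> set ts \<subseteq> set (candidates N) \<Longrightarrow> set (foldl (step N) T ts) = set T"
proof (induction ts rule: rev_induct)
  case (snoc t ts)
  let ?T = "foldl (step N) T ts"
  have eq: "set ?T = set T" using snoc by simp
  have valid: "valid F m N ?T"
    using snoc.prems by (intro extendsD(1)[OF steps_extend]) auto
  have "t \<in> set T" if "test N ?T t"
    using test_mono[OF valid snoc.prems(1) _ _ that] eq snoc.prems(2,3) by (simp add: saturated_def)
  then have "set (step N ?T t) = set ?T"
    unfolding step_def eq[symmetric] by (simp add: insert_absorb)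
  then show ?case unfolding foldl_append foldl.simps eq .
qed simp

lemma pass_saturated:
  assumes "valid F m N T" "saturated N T"
  shows "saturated N (pass N T)"
proof -
  have eq: "set (pass N T) = set T" using steps_saturated[OF assms] by (simp add: pass_def)
  have valid: "valid F m N (pass N T)" using extendsD(1)[OF pass_extends[OF assms(1)]] .
  have "t \<in> set T" if "t \<in> set (candidates N)" "test N (pass N T) t" for t
    using test_mono[OF valid assms(1) _ that] eq assms(2) that(1) by (simp add: saturated_def)
  then show ?thesis using eq by (simp add: saturated_def)
qed

text \<open>
  As long as the transitions are not saturated, a pass adds a candidate; so there cannot be more
  than \<open>length (candidates N)\<close> such passes.
\<close>

lemma saturate_saturated:
  assumes "valid F m N T"
  shows "saturated N (saturate N T)"
proof -
  let ?S = "set (candidates N)" and ?it = "foldl (\<lambda>T _. pass N T) T"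
  have progress: "saturated N (?it us) \<or> length us \<le> card (set (?it us) \<inter> ?S)" for us :: "(nat \<times> letter option \<times> nat) list"
  proof (induction us rule: rev_induct)
    case (snoc u us)
    let ?T = "?it us"
    have valid: "valid F m N ?T" using extendsD(1)[OF passes_extend[OF assms]] .
    show ?case
    proof (cases "saturated N ?T")
      case True
      then show ?thesis using pass_saturated[OF valid] by simp
    next
      case False
      then obtain t where t: "t \<in> ?S" "test N ?T t" "t \<notin> set ?T" by (auto simp: saturated_def)
      have "t \<in> set (pass N ?T)" using steps_add[OF valid _ t(1,2)] by (simp add: pass_def)
      moreover have "set ?T \<subseteq> set (pass N ?T)" using extendsD(2)[OF pass_extends[OF valid]] .
      ultimately have "set ?T \<inter> ?S \<subset> set (pass N ?T) \<inter> ?S" using t by blast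
      then have "card (set ?T \<inter> ?S) < card (set (pass N ?T) \<inter> ?S)" by (intro psubset_card_mono) auto
      then show ?thesis using snoc.IH False by simp
    qed
  qed simp
  have "saturated N (?it (candidates N))"
  proof (rule ccontr)
    assume not: "\<not> saturated N (?it (candidates N))"
    then have "length (candidates N) \<le> card (set (?it (candidates N)) \<inter> ?S)" using progress by blast
    then have "card ?S \<le> card (set (?it (candidates N)) \<inter> ?S)" using card_length[of "candidates N"] by simp
    then have "?S \<subseteq> set (?it (candidates N))"
      using card_seteq[of ?S "set (?it (candidates N)) \<inter> ?S"] by auto
    then show False using not by (auto simp: saturated_def)
  qed
  then show ?thesis by (simp add: saturate_def)
qed

definition reads_one :: "nat \<times> nat \<times> (nat \<times> letter option \<times> nat) list \<Rightarrow> nat \<Rightarrow> bool" where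
  "reads_one B p \<longleftrightarrow>
     oracle_answer G gsG trG (fst B) (saturate (fst B) (snd (snd B))) p (fst (snd B)) []"

lemma reads_one_iff:
  assumes "valid F m N T" "p < N" "e < N"
  shows "reads_one (N, e, T) p \<longleftrightarrow> reach P valP (set T) p \<one>\<^bsub>P\<^esub> e"
proof -
  have ext: "extends N T (saturate N T)" using passes_extend[OF assms(1)] by (simp add: saturate_def)
  have "reads_one (N, e, T) p \<longleftrightarrow> reach P valP (set (saturate N T)) p \<one>\<^bsub>P\<^esub> e"
    using saturated_reach_one[OF extendsD(1)[OF ext] saturate_saturated[OF assms(1)] assms(2,3)]
    by (simp add: reads_one_def)
  then show ?thesis unfolding extendsD(3)[OF ext] .
qed

text \<open>
  The final states at which the automaton accepts an element equal to \<open>w\<close>; the answer is yes if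
  there are any.
\<close>

definition decide :: "automaton \<Rightarrow> letter list \<Rightarrow> nat list" where
  "decide A w = concat (map (\<lambda>f. if reads_one
     (foldl append_letter (num_states A, f, transitions A) (map flip (rev w))) (start A)
     then [f] else []) (finals A))"

lemma wf_word_flip: "wf_word k w \<Longrightarrow> wf_word k (map flip (rev w))"
proof -
  have "letter_index (flip x) = letter_index x" for x by (cases x) auto
  then show "wf_word k w \<Longrightarrow> wf_word k (map flip (rev w))" by (auto simp: wf_word_def)
qed

lemma automaton_valid:
  assumes "wf_automaton k A" "underlying_graph A \<in> F"
  shows "valid F k (num_states A) (transitions A)"
  using assms by (auto simp: wf_automaton_def valid_def wf_label_def underlying_graph_def graph_of_def)

lemma decide_correct:
  assumes A: "wf_automaton m A" "underlying_graph A \<in> F" and w: "wf_word m w"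
  shows "decide A w \<noteq> [] \<longleftrightarrow> word_val P gsP w \<in> rational_subset P gsP A"
proof -
  let ?T = "transitions A" and ?v = "word_val P gsP w"
  note valid = automaton_valid[OF A]
  have v: "?v \<in> carrier P" using PG.word_val_closed[OF gsP_closed] w by simp
  have final: "reads_one (foldl append_letter (num_states A, f, ?T) (map flip (rev w))) (start A) \<longleftrightarrow>
      reach P valP (set ?T) (start A) ?v f" if f: "f \<in> set (finals A)" for f
  proof -
    obtain N e T where B: "foldl append_letter (num_states A, f, ?T) (map flip (rev w)) = (N, e, T)"
      by (metis surj_pair)
    have b: "f < num_states A" "start A < num_states A" using A(1) f by (auto simp: wf_automaton_def)
    note app = PG.append_word[OF gsP_closed progressive valid b wf_word_flip B]
    have app: "valid F m N T" "start A < N" "e < N" "reach P valP (set T) (start A) g e \<longleftrightarrow>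
        (\<exists>h. reach P valP (set ?T) (start A) h f \<and> g = h \<otimes>\<^bsub>P\<^esub> inv\<^bsub>P\<^esub> ?v)" for g
      using app[of g] w PG.word_val_flip[OF gsP_closed, of w] by simp_all
    have "h \<in> carrier P" if "reach P valP (set ?T) (start A) h f" for h
      by (rule PG.reach_closed[OF that]) (use valid_bounds[OF valid] PG.label_val_closed[OF gsP_closed] in blast)
    then have "(\<exists>h. reach P valP (set ?T) (start A) h f \<and> \<one>\<^bsub>P\<^esub> = h \<otimes>\<^bsub>P\<^esub> inv\<^bsub>P\<^esub> ?v) \<longleftrightarrow>
        reach P valP (set ?T) (start A) ?v f"
      using v PG.inv_equality PG.inv_inv PG.inv_closed by (metis PG.r_inv)
    then show ?thesis unfolding B reads_one_iff[OF app(1-3)] app(4) .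
  qed
  show ?thesis
    using final by (auto simp: decide_def PG.rational_subset_reach[OF gsP_closed A(1)])
qed

end

section \<open>The algorithm runs in polynomial time\<close>

abbreviation enc_trans :: "nat \<times> letter option \<times> nat \<Rightarrow> tree" where
  "enc_trans \<equiv> enc_pair enc_nat (enc_pair enc_label enc_nat)"

lemma enc_transition_conv: "enc_transition = enc_trans"
  by (auto simp: fun_eq_iff enc_transition_def)

abbreviation enc_tuple ::
  "(nat \<times> nat \<times> nat list \<times> (nat \<times> letter option \<times> nat) list) \<times> letter list \<Rightarrow> tree" where
  "enc_tuple \<equiv> enc_pair (enc_pair enc_nat (enc_pair enc_nat
     (enc_pair (enc_list enc_nat) (enc_list enc_trans)))) (enc_list enc_letter)"

lemma enc_instance_conv:
  "enc_instance A w = enc_tuple ((num_states A, start A, finals A, transitions A), w)"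
  by (simp add: enc_instance_def enc_automaton_def enc_transition_conv)

lemma finite_wf_labels: "finite {l. wf_label k l}"
proof -
  have "{l. wf_label k l} \<subseteq> insert None (Some ` (Gen ` {..<k} \<union> Inv ` {..<k}))"
  proof
    fix l assume "l \<in> {l. wf_label k l}"
    then show "l \<in> insert None (Some ` (Gen ` {..<k} \<union> Inv ` {..<k}))"
      by (cases l; cases "the l") (auto simp: wf_label_def)
  qed
  then show ?thesis by (rule finite_subset) simp
qed

lemma ptime_of_label: "ptime Ps enc_label eb {l. wf_label k l} f"
  by (rule ptime_finite[OF finite_wf_labels]) (auto simp: inj_on_def enc_label_inject)

lemma ptime_factor_part:
  assumes T: "ptime Ps ez (enc_list enc_trans) D T"
    and wf: "\<And>z p l q. z \<in> D \<Longrightarrow> (p, l, q) \<in> set (T z) \<Longrightarrow> wf_label k l"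
  shows "ptime Ps ez (enc_list enc_trans) D (\<lambda>z. factor_part tr (T z))"
  unfolding factor_part_def
proof (rule ptime_concat_map[OF T], rule ptime_map)
  let ?D = "{y. fst y \<in> D \<and> snd y \<in> set (T (fst y))}"
  have "ptime Ps (enc_pair ez enc_trans) enc_label ?D (\<lambda>y. fst (snd (snd y)))"
    by (rule ptime_fstI ptime_sndI ptime_id)+
  from ptime_comp[OF this ptime_of_label[where k = k]]
  show "ptime Ps (enc_pair ez enc_trans) (enc_list enc_label) ?D (\<lambda>y. tr (fst (snd (snd y))))"
    using wf by force
qed (rule ptime_pair ptime_fstI ptime_sndI ptime_id)+

lemma ptime_oracle_answer:
  assumes Ps: "i < length Ps" "Ps ! i = uniform_rsmp F K gs" and F: "progressive F"
    and tr: "\<And>l. wf_label k l \<Longrightarrow> list_all (wf_label (length gs)) (tr l)"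
    and pt: "ptime Ps ez enc_nat D N" "ptime Ps ez (enc_list enc_trans) D T" "ptime Ps ez enc_nat D p"
      "ptime Ps ez enc_nat D q" "ptime Ps ez (enc_list enc_letter) D w"
    and wf: "\<And>z. z \<in> D \<Longrightarrow> valid F k (N z) (T z) \<and> p z < N z \<and> q z < N z \<and> wf_word (length gs) (w z)"
  shows "ptime Ps ez enc_bool D (\<lambda>z. oracle_answer K gs tr (N z) (T z) (p z) (q z) (w z))"
proof -
  let ?A = "\<lambda>z. \<lparr>num_states = N z, start = p z, finals = [q z], transitions = factor_part tr (T z)\<rparr>"
  let ?t = "\<lambda>z. ((N z, p z, [q z], factor_part tr (T z)), w z)"
  have "ptime Ps ez (enc_list enc_trans) D (\<lambda>z. factor_part tr (T z))"
    by (rule ptime_factor_part[OF pt(2)]) (use wf valid_bounds in blast)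
  then have t: "ptime Ps ez enc_tuple D ?t"
    by (intro ptime_pair ptime_Cons ptime_const pt)
  have enc: "enc_tuple (?t z) = enc_instance (?A z) (w z)" for z
    by (simp add: enc_instance_conv)
  have inst: "wf_automaton (length gs) (?A z)" "underlying_graph (?A z) \<in> F" "wf_word (length gs) (w z)" if "z \<in> D" for z
  proof -
    have "valid F (length gs) (N z) (factor_part tr (T z))"
      using wf[OF that] by (intro valid_factor_part[OF F _ tr]) auto
    from valid_automaton[OF this] show "wf_automaton (length gs) (?A z)" "underlying_graph (?A z) \<in> F"
      using wf[OF that] by auto
    show "wf_word (length gs) (w z)" using wf[OF that] by simp
  qed
  have "ptime Ps enc_tuple enc_bool (?t ` D)
      (\<lambda>((N, p, fs, T), w). word_val K gs w \<in> rational_subset K gs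
        \<lparr>num_states = N, start = p, finals = fs, transitions = T\<rparr>)"
    by (rule ptime_query[OF Ps(1)]; unfold Ps(2) uniform_rsmp_def)
      (auto simp del: enc_pair_simp simp: enc intro!: exI inst)
  from ptime_comp[OF t this] show ?thesis by (simp add: oracle_answer_def)
qed

context amalgam_membership
begin

abbreviation "problems \<equiv> [uniform_rsmp F G gsG, uniform_rsmp F H gsH]"

lemma ptime_candidates:
  assumes "ptime problems ez enc_nat D N"
  shows "ptime problems ez (enc_list enc_trans) D (\<lambda>z. candidates (N z))"
  unfolding candidates_def
  by (rule ptime_const ptime_concat_map ptime_map ptime_upt ptime_if ptime_eq_nat assms
      ptime_comp[OF ptime_fst assms] ptime_pair ptime_fstI ptime_sndI ptime_id | simp; fail)+

text \<open>
  The translations of labels and the words of the queries depend on a label only; since there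
  are finitely many labels, the program looks them up in tables.
\<close>

lemma ptime_test:
  assumes pt: "ptime problems ez enc_nat D N" "ptime problems ez (enc_list enc_trans) D T"
      "ptime problems ez enc_trans D t"
    and wf: "\<And>z. z \<in> D \<Longrightarrow> valid F m (N z) (T z) \<and> t z \<in> set (candidates (N z))"
  shows "ptime problems ez enc_bool D (\<lambda>z. test (N z) (T z) (t z))"
proof -
  have bounds: "fst (t z) < N z" "snd (snd (t z)) < N z" "wf_label m (fst (snd (t z)))"
    "wf_word (length gsG) (map the (trG (fst (snd (t z)))))"
    "wf_word (length gsH) (map the (trH (fst (snd (t z)))))" if z: "z \<in> D" for z
  proof -
    obtain p q i where t: "t z = (p, C_label i, q)" "p < N z" "q < N z" "i < length cs"
      using wf[OF z] by (auto simp: candidates_iff)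
    then show "fst (t z) < N z" "snd (snd (t z)) < N z" "wf_label m (fst (snd (t z)))"
      by (simp_all add: C_label_wf)
    show "wf_word (length gsG) (map the (trG (fst (snd (t z)))))"
      using t by (simp add: trG_C_label) (simp add: C_label_def wf_word_def length_gsG)
    show "wf_word (length gsH) (map the (trH (fst (snd (t z)))))"
      using t by (simp add: trH_C_label wf_word_def length_gsH)
  qed
  note ends = ptime_fstI[OF pt(3)] ptime_sndI[OF ptime_sndI[OF pt(3)]]
    and label = ptime_fstI[OF ptime_sndI[OF pt(3)]]
  have words: "ptime problems ez (enc_list enc_letter) D (\<lambda>z. f (fst (snd (t z))))" for f
    by (rule ptime_comp[OF label ptime_of_label[where k = m]]) (use bounds in auto)
  show ?thesis
    unfolding test_def
    by (intro ptime_disj ptime_oracle_answer[of 0 problems F G gsG m trG]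
        ptime_oracle_answer[of 1 problems F H gsH m trH]
        pt ends words[of "\<lambda>l. map the (trG l)"] words[of "\<lambda>l. map the (trH l)"] progressive trG_wf trH_wf)
      (use bounds wf in auto)
qed

lemma ptime_step:
  assumes pt: "ptime problems ez enc_nat D N" "ptime problems ez (enc_list enc_trans) D T"
      "ptime problems ez enc_trans D t"
    and wf: "\<And>z. z \<in> D \<Longrightarrow> valid F m (N z) (T z) \<and> t z \<in> set (candidates (N z))"
  shows "ptime problems ez (enc_list enc_trans) D (\<lambda>z. step (N z) (T z) (t z))"
  unfolding step_def
  by (intro ptime_if ptime_test[OF pt wf] ptime_Cons ptime_subset[OF pt(2)] ptime_subset[OF pt(3)]) auto

lemma size_steps:
  "size (enc_list enc_trans (foldl (step N) T ts)) \<le> size (enc_list enc_trans T) + size (enc_list enc_trans ts)"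
  by (induction ts rule: rev_induct) (auto simp: step_def simp del: enc_pair_simp)

lemma ptime_pass:
  assumes pt: "ptime problems ez enc_nat D N" "ptime problems ez (enc_list enc_trans) D T"
    and wf: "\<And>z. z \<in> D \<Longrightarrow> valid F m (N z) (T z)"
  shows "ptime problems ez (enc_list enc_trans) D (\<lambda>z. pass (N z) (T z))"
proof -
  note cand = ptime_candidates[OF pt(1)]
  obtain p :: "nat poly" where p: "\<And>z. z \<in> D \<Longrightarrow> size (enc_list enc_trans (T z)) \<le> poly p (size (ez z))"
    using pt(2) by (rule ptimeE) blast
  obtain q :: "nat poly" where q: "\<And>z. z \<in> D \<Longrightarrow> size (enc_list enc_trans (candidates (N z))) \<le> poly q (size (ez z))"
    using cand by (rule ptimeE) blast
  let ?D = "{y. fst y \<in> D \<and> valid F m (N (fst y)) (fst (snd y)) \<and> snd (snd y) \<in> set (candidates (N (fst y)))}"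
  show ?thesis
    unfolding pass_def
  proof (rule ptime_foldl[where Df = ?D and q = "p + q", OF pt(2) cand])
    show "ptime problems (enc_pair ez (enc_pair (enc_list enc_trans) enc_trans)) (enc_list enc_trans) ?D
        (\<lambda>y. step (N (fst y)) (fst (snd y)) (snd (snd y)))"
      by (rule ptime_step ptime_comp[OF ptime_fst pt(1)] ptime_fstI ptime_sndI ptime_id | simp; fail)+
    show "(z, foldl (step (N z)) (T z) ys, x) \<in> ?D"
      if "z \<in> D" "candidates (N z) = ys @ x # zs" for z ys x zs
      using that steps_extend[OF wf[OF that(1)], of ys] extendsD(1) by auto
    show "size (enc_list enc_trans (foldl (step (N z)) (T z) ys)) \<le> poly (p + q) (size (ez z))"
      if "z \<in> D" "candidates (N z) = ys @ zs" for z ys zs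
      using size_steps[of "N z" "T z" ys] p[OF that(1)] q[OF that(1)] unfolding that(2) by simp
  qed
qed

lemma ptime_saturate:
  assumes pt: "ptime problems ez enc_nat D N" "ptime problems ez (enc_list enc_trans) D T"
    and wf: "\<And>z. z \<in> D \<Longrightarrow> valid F m (N z) (T z)"
  shows "ptime problems ez (enc_list enc_trans) D (\<lambda>z. saturate (N z) (T z))"
proof -
  note cand = ptime_candidates[OF pt(1)]
  obtain p :: "nat poly" where p: "\<And>z. z \<in> D \<Longrightarrow> size (enc_list enc_trans (T z)) \<le> poly p (size (ez z))"
    using pt(2) by (rule ptimeE) blast
  obtain q :: "nat poly" where q: "\<And>z. z \<in> D \<Longrightarrow> size (enc_list enc_trans (candidates (N z))) \<le> poly q (size (ez z))"
    using cand by (rule ptimeE) blast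
  let ?D = "{y. fst y \<in> D \<and> valid F m (N (fst y)) (fst (snd y))}"
  have size: "size (enc_list enc_trans (foldl (\<lambda>T _. pass N T) T us)) \<le>
      size (enc_list enc_trans T) + length us * size (enc_list enc_trans (candidates N))"
    for N T and us :: "(nat \<times> letter option \<times> nat) list"
  proof (induction us rule: rev_induct)
    case (snoc u us)
    then show ?case
      using size_steps[of N "foldl (\<lambda>T _. pass N T) T us" "candidates N"] by (simp add: pass_def)
  qed simp
  show ?thesis
    unfolding saturate_def
  proof (rule ptime_foldl[where Df = ?D and q = "p + q * q", OF pt(2) cand])
    show "ptime problems (enc_pair ez (enc_pair (enc_list enc_trans) enc_trans)) (enc_list enc_trans) ?D
        (\<lambda>y. pass (N (fst y)) (fst (snd y)))"
      by (rule ptime_pass ptime_comp[OF ptime_fst pt(1)] ptime_fstI ptime_sndI ptime_id | simp; fail)+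
    show "(z, foldl (\<lambda>T _. pass (N z) T) (T z) ys, x) \<in> ?D" if "z \<in> D" for z ys x
      using that extendsD(1)[OF passes_extend[OF wf[OF that]]] by simp
    show "size (enc_list enc_trans (foldl (\<lambda>T _. pass (N z) T) (T z) ys)) \<le> poly (p + q * q) (size (ez z))"
      if z: "z \<in> D" "candidates (N z) = ys @ zs" for z ys zs
    proof -
      have "length ys \<le> length (candidates (N z))" using z(2) by simp
      then have "length ys \<le> poly q (size (ez z))"
        using length_le_size[of "candidates (N z)" enc_trans] q[OF z(1)] by linarith
      then have "length ys * size (enc_list enc_trans (candidates (N z))) \<le> poly q (size (ez z)) * poly q (size (ez z))"
        using q[OF z(1)] by (intro mult_mono) auto
      then show ?thesis using size[of "N z" "T z" ys] p[OF z(1)] by simp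
    qed
  qed
qed

text \<open>
  The size bound uses that state numbers grow by at most one per letter, so each new transition
  has a size linear in that of the input.
\<close>

lemma ptime_append_letters:
  assumes pt: "ptime Ps ez enc_nat D N" "ptime Ps ez enc_nat D f" "ptime Ps ez (enc_list enc_trans) D T"
      "ptime Ps ez (enc_list enc_letter) D us"
  shows "ptime Ps ez (enc_pair enc_nat (enc_pair enc_nat (enc_list enc_trans))) D
    (\<lambda>z. foldl append_letter (N z, f z, T z) (us z))"
proof -
  let ?eB = "enc_pair enc_nat (enc_pair enc_nat (enc_list enc_trans))"
  obtain pN :: "nat poly" where pN: "\<And>z. z \<in> D \<Longrightarrow> size (enc_nat (N z)) \<le> poly pN (size (ez z))"
    using pt(1) by (rule ptimeE) blast
  obtain pf :: "nat poly" where pf: "\<And>z. z \<in> D \<Longrightarrow> size (enc_nat (f z)) \<le> poly pf (size (ez z))"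
    using pt(2) by (rule ptimeE) blast
  obtain pT :: "nat poly" where pT: "\<And>z. z \<in> D \<Longrightarrow> size (enc_list enc_trans (T z)) \<le> poly pT (size (ez z))"
    using pt(3) by (rule ptimeE) blast
  obtain pu :: "nat poly" where pu: "\<And>z. z \<in> D \<Longrightarrow> size (enc_list enc_letter (us z)) \<le> poly pu (size (ez z))"
    using pt(4) by (rule ptimeE) blast
  have size: "fst (foldl append_letter (N, f, T) ys) = N + length ys \<and>
      fst (snd (foldl append_letter (N, f, T) ys)) \<le> M \<and>
      size (enc_list enc_trans (snd (snd (foldl append_letter (N, f, T) ys)))) \<le>
        size (enc_list enc_trans T) + length ys * (2 * M + L + 3)"
    if "\<And>x. x \<in> set ys \<Longrightarrow> size (enc_letter x) \<le> L" "N + f + length ys \<le> M" for N f T ys L M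
    using that
  proof (induction ys rule: rev_induct)
    case (snoc x ys)
    obtain N' f' T' where B: "foldl append_letter (N, f, T) ys = (N', f', T')" by (metis surj_pair)
    have "size (enc_letter x) \<le> L" using snoc.prems(1) by simp
    then show ?case
      using snoc.IH[OF snoc.prems(1)] snoc.prems(2) by (simp add: append_letter_simp B)
  qed simp
  define pM where "pM = pN + pf + pu"
  define q where "q = [:2:] + [:2:] * pM + pT + pu * ([:2:] * pM + pu + [:3:])"
  have step: "ptime Ps (enc_pair ez (enc_pair ?eB enc_letter)) ?eB UNIV (\<lambda>y. append_letter (fst (snd y)) (snd (snd y)))"
  proof -
    have label: "ptime Ps (enc_pair ez (enc_pair ?eB enc_letter)) enc_label UNIV (\<lambda>y. Some (snd (snd y)))"
      by (rule ptime_recode[OF ptime_sndI[OF ptime_sndI[OF ptime_id]], where h = id]) auto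
    show ?thesis
      unfolding append_letter_def
      by (rule ptime_pair ptime_Suc ptime_Cons label ptime_fstI ptime_sndI ptime_id)+
  qed
  show ?thesis
  proof (rule ptime_foldl[OF ptime_pair[OF pt(1) ptime_pair[OF pt(2,3)]] pt(4) step, of q])
    fix z ys zs assume z: "z \<in> D" "us z = ys @ zs"
    let ?s = "size (ez z)"
    have letters: "size (enc_letter x) \<le> poly pu ?s" if "x \<in> set ys" for x
      using elem_size[of x "us z" enc_letter] that z(2) pu[OF z(1)] by simp
    have len: "length ys \<le> poly pu ?s"
      using length_le_size[of "us z" enc_letter] pu[OF z(1)] z(2) by simp
    then have M: "N z + f z + length ys \<le> poly pM ?s"
      using pN[OF z(1)] pf[OF z(1)] by (simp add: pM_def)
    obtain N' f' T' where B: "foldl append_letter (N z, f z, T z) ys = (N', f', T')" by (metis surj_pair)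
    define X where "X = 2 * poly pM ?s + poly pu ?s + 3"
    have "length ys * X \<le> poly pu ?s * X" using len by (rule mult_le_mono1)
    moreover have "N' = N z + length ys" "f' \<le> poly pM ?s"
      "size (enc_list enc_trans T') \<le> size (enc_list enc_trans (T z)) + length ys * X"
      using size[OF letters M, of "T z"] unfolding B X_def by simp_all
    moreover have "poly q ?s = 2 + 2 * poly pM ?s + poly pT ?s + poly pu ?s * X"
      by (simp add: q_def X_def)
    ultimately have "N' + f' + size (enc_list enc_trans T') + 2 \<le> poly q ?s"
      using M pT[OF z(1)] by linarith
    then show "size (?eB (foldl append_letter (N z, f z, T z) ys)) \<le> poly q ?s"
      unfolding B by simp
  qed simp
qed

definition inputs :: "(automaton \<times> letter list) set" where
  "inputs = {(A, w). wf_automaton m A \<and> underlying_graph A \<in> F \<and> wf_word m w}"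

lemma ptime_decide: "ptime problems (\<lambda>(A, w). enc_instance A w) (enc_list enc_nat) inputs (\<lambda>(A, w). decide A w)"
proof -
  let ?e = "\<lambda>(A, w). enc_instance A w"
  have field: "ptime problems ?e eb inputs (\<lambda>z. g ((num_states (fst z), start (fst z), finals (fst z), transitions (fst z)), snd z))"
    if "ptime problems enc_tuple eb UNIV g" for g and eb :: "'x \<Rightarrow> tree"
    using that
    by (rule ptime_recode[where h = "\<lambda>z. ((num_states (fst z), start (fst z), finals (fst z), transitions (fst z)), snd z)"])
      (auto simp: enc_instance_conv)
  have fields: "ptime problems ?e enc_nat inputs (\<lambda>z. num_states (fst z))"
    "ptime problems ?e enc_nat inputs (\<lambda>z. start (fst z))"
    "ptime problems ?e (enc_list enc_nat) inputs (\<lambda>z. finals (fst z))"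
    "ptime problems ?e (enc_list enc_trans) inputs (\<lambda>z. transitions (fst z))"
    "ptime problems ?e (enc_list enc_letter) inputs (\<lambda>z. snd z)"
    using field[OF ptime_fstI[OF ptime_fstI[OF ptime_id]]]
      field[OF ptime_fstI[OF ptime_sndI[OF ptime_fstI[OF ptime_id]]]]
      field[OF ptime_fstI[OF ptime_sndI[OF ptime_sndI[OF ptime_fstI[OF ptime_id]]]]]
      field[OF ptime_sndI[OF ptime_sndI[OF ptime_sndI[OF ptime_fstI[OF ptime_id]]]]]
      field[OF ptime_sndI[OF ptime_id]] by simp_all
  have flip: "ptime problems enc_letter enc_letter {x. letter_index x < m} flip"
  proof (rule ptime_finite)
    have "{x. letter_index x < m} = the ` ({l. wf_label m l} - {None})"
      by (force simp: wf_label_def image_iff)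
    then show "finite {x. letter_index x < m}" using finite_wf_labels by simp
  qed (auto simp: inj_on_def enc_letter_inject)
  have inverse: "ptime problems ?e (enc_list enc_letter) inputs (\<lambda>z. map flip (rev (snd z)))"
    by (rule ptime_map[OF ptime_rev[OF fields(5)] ptime_comp[OF ptime_snd flip]])
      (auto simp: inputs_def wf_word_def)
  let ?D = "{y. fst y \<in> inputs \<and> snd y \<in> set (finals (fst (fst y)))}"
  let ?B = "\<lambda>y. foldl append_letter (num_states (fst (fst y)), snd y, transitions (fst (fst y))) (map flip (rev (snd (fst y))))"
  have lift: "ptime problems (enc_pair ?e enc_nat) eb ?D (\<lambda>y. g (fst y))"
    if "ptime problems ?e eb inputs g" for g and eb :: "'x \<Rightarrow> tree"
    by (rule ptime_comp[OF ptime_fst that]) auto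
  have B: "ptime problems (enc_pair ?e enc_nat) (enc_pair enc_nat (enc_pair enc_nat (enc_list enc_trans))) ?D ?B"
    by (intro ptime_append_letters lift fields inverse ptime_snd)
  have wf: "valid F m (fst (?B y)) (snd (snd (?B y))) \<and> start (fst (fst y)) < fst (?B y) \<and> fst (snd (?B y)) < fst (?B y)"
    if y: "y \<in> ?D" for y
  proof -
    obtain A w f where y_eq: "y = ((A, w), f)" by (metis surj_pair)
    have A: "wf_automaton m A" "underlying_graph A \<in> F" "wf_word m w" "f \<in> set (finals A)"
      using y y_eq by (auto simp: inputs_def)
    obtain N e T where B: "foldl append_letter (num_states A, f, transitions A) (map flip (rev w)) = (N, e, T)"
      by (metis surj_pair)
    have "f < num_states A" "start A < num_states A" using A by (auto simp: wf_automaton_def)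
    from PG.append_word[OF gsP_closed progressive automaton_valid[OF A(1,2)] this wf_word_flip[OF A(3)] B]
    show ?thesis using B by (simp add: y_eq)
  qed
  have saturated: "ptime problems (enc_pair ?e enc_nat) (enc_list enc_trans) ?D
      (\<lambda>y. saturate (fst (?B y)) (snd (snd (?B y))))"
    by (intro ptime_saturate ptime_fstI[OF B] ptime_sndI[OF ptime_sndI[OF B]]) (use wf in blast)
  have test: "ptime problems (enc_pair ?e enc_nat) enc_bool ?D (\<lambda>y. reads_one (?B y) (start (fst (fst y))))"
    unfolding reads_one_def
  proof (rule ptime_oracle_answer[of 0 problems F G gsG m trG])
    fix y assume y: "y \<in> ?D"
    have "valid F m (fst (?B y)) (saturate (fst (?B y)) (snd (snd (?B y))))"
      using wf[OF y] extendsD(1)[OF passes_extend] unfolding saturate_def by blast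
    then show "valid F m (fst (?B y)) (saturate (fst (?B y)) (snd (snd (?B y)))) \<and>
        start (fst (fst y)) < fst (?B y) \<and> fst (snd (?B y)) < fst (?B y) \<and> wf_word (length gsG) []"
      using wf[OF y] by (simp add: wf_word_def)
  qed (intro progressive trG_wf saturated ptime_const ptime_fstI[OF B] ptime_fstI[OF ptime_sndI[OF B]]
      lift[OF fields(2)] | simp)+
  have "ptime problems ?e (enc_list enc_nat) inputs (\<lambda>z. decide (fst z) (snd z))"
    unfolding decide_def
    by (rule ptime_concat_map[OF fields(3)] ptime_if[OF test] ptime_Cons ptime_const ptime_snd)+
  then show ?thesis by (simp add: case_prod_unfold)
qed

theorem amalgam_cook_reducible: "cook_reducible (uniform_rsmp F P gsP) problems"
proof (rule ptime_imp_cook_reducible[OF ptime_decide])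
  show "yes (uniform_rsmp F P gsP) \<union> no (uniform_rsmp F P gsP) \<subseteq> (\<lambda>(A, w). enc_instance A w) ` inputs"
    by (force simp: uniform_rsmp_def inputs_def)
  fix z assume "z \<in> inputs"
  then obtain A w where z: "z = (A, w)" "wf_automaton m A" "underlying_graph A \<in> F" "wf_word m w"
    by (auto simp: inputs_def)
  have "enc_list enc_nat l \<noteq> Leaf \<longleftrightarrow> l \<noteq> []" for l by (cases l) auto
  then show "enc_list enc_nat (case z of (A, w) \<Rightarrow> decide A w) \<noteq> Leaf \<longleftrightarrow>
      (case z of (A, w) \<Rightarrow> enc_instance A w) \<in> yes (uniform_rsmp F P gsP)"
    using z decide_correct[OF z(2-4)] by (auto simp: uniform_rsmp_def enc_instance_inject)
qed

end

section \<open>The reduction\<close>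

theorem theorem4p4:
  fixes F :: "nat pair_pre_digraph set"
    and G :: "('a, 'm) monoid_scheme" and H :: "('b, 'n) monoid_scheme"
    and C :: "('c, 'k) monoid_scheme"
    and \<phi> :: "'c \<Rightarrow> 'a" and \<psi> :: "'c \<Rightarrow> 'b"
    and xs :: "'a list" and ys :: "'b list" and cs :: "'c list"
  assumes "progressive F"
    and "group G" and "group H" and "group C"
    and "set xs \<subseteq> carrier G" and "generate G (set xs) = carrier G"
    and "set ys \<subseteq> carrier H" and "generate H (set ys) = carrier H"
    and "finite (carrier C)" and "set cs = carrier C"
    and "\<phi> \<in> mon C G" and "\<psi> \<in> mon C H"
  shows "cook_reducible
    (uniform_rsmp F (amalgam G H C \<phi> \<psi>)
      (map (amalg_inl G H C \<phi> \<psi>) (xs @ map \<phi> cs) @ map (amalg_inr G H C \<phi> \<psi>) (ys @ map \<psi> cs)))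
    [uniform_rsmp F G (xs @ map \<phi> cs), uniform_rsmp F H (ys @ map \<psi> cs)]"
proof -
  interpret G: group G by fact
  interpret H: group H by fact
  interpret C: group C by fact
  interpret amalgam_membership G H C \<phi> \<psi> F xs ys cs
    by unfold_locales (use assms in \<open>auto simp: mon_def\<close>)
  show ?thesis using amalgam_cook_reducible unfolding gsP_def gsG_def gsH_def .
qed

end
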